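(* Let $\mathcal{A}$ and $\mathcal{B}$ be bicategories. Then $\mathcal{A}$ and $\mathcal{B}$ are biequivalent if and only if there exist a bicategory $\mathcal{C}$ and strict functors $P\colon\mathcal{C}\to\mathcal{A}$, $Q\colon\mathcal{C}\to\mathcal{B}$ each of which is a surjective equivalence.
   Context: Bicategories $\mathcal{A},\mathcal{B}$ are biequivalent if there exist pseudofunctors $F\colon\mathcal{A}\to\mathcal{B}$, $G\colon\mathcal{B}\to\mathcal{A}$ with $GF\cong 1_{\mathcal{A}}$ in the functor bicategory $[\mathcal{A},\mathcal{A}]$ (pseudofunctors, pseudonatural transformations, modifications) and $FG\cong 1_{\mathcal{B}}$ in $[\mathcal{B},\mathcal{B}]$. A strict functor (strict 2-functor) is a pseudofunctor preserving composition and identities of 1-cells strictly (its coherence 2-cells are identities). A pseudofunctor $F\colon\mathcal{A}\to\mathcal{B}$ is a surjective equivalence if it is surjective on objects (for every $b\in\mathcal{B}$ there is $a\in\mathcal{A}$ with $Fa=b$) and for all objects $a,a'$ the functor $F\colon\mathcal{A}(a,a')\to\mathcal{B}(Fa,Fa')$ is surjective on objects, full and faithful. *)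

theory Defs
  imports Main
begin

text \<open>A bicategory is given by sets of objects, 1-cells and 2-cells, with source/target
of 1-cells, domain/codomain 1-cells of 2-cells, vertical composition (bv_comp B beta alpha
is "beta after alpha"), identity 2-cells, horizontal composition of 1-cells and 2-cells
(b_hcomp B g f is "g after f"), identity 1-cells, associators (h g) f to h (g f), and left
and right unitors 1 f to f, f 1 to f.\<close>

record ('o, 'm, 'c) bicat =
  b_obj :: "'o set"
  b_arr :: "'m set"
  b_src :: "'m \<Rightarrow> 'o"
  b_trg :: "'m \<Rightarrow> 'o"
  b_cell :: "'c set"
  b_dom :: "'c \<Rightarrow> 'm"
  b_cod :: "'c \<Rightarrow> 'm"
  b_vcomp :: "'c \<Rightarrow> 'c \<Rightarrow> 'c"
  b_idc :: "'m \<Rightarrow> 'c"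
  b_hcomp :: "'m \<Rightarrow> 'm \<Rightarrow> 'm"
  b_hcompc :: "'c \<Rightarrow> 'c \<Rightarrow> 'c"
  b_ide :: "'o \<Rightarrow> 'm"
  b_assoc :: "'m \<Rightarrow> 'm \<Rightarrow> 'm \<Rightarrow> 'c"
  b_lunit :: "'m \<Rightarrow> 'c"
  b_runit :: "'m \<Rightarrow> 'c"

definition hom :: "('o, 'm, 'c) bicat \<Rightarrow> 'o \<Rightarrow> 'o \<Rightarrow> 'm set" where
  "hom B a b = {f \<in> b_arr B. b_src B f = a \<and> b_trg B f = b}"

definition cells :: "('o, 'm, 'c) bicat \<Rightarrow> 'm \<Rightarrow> 'm \<Rightarrow> 'c set" where
  "cells B f g = {\<alpha> \<in> b_cell B. b_dom B \<alpha> = f \<and> b_cod B \<alpha> = g}"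

definition iso2 :: "('o, 'm, 'c) bicat \<Rightarrow> 'c \<Rightarrow> bool" where
  "iso2 B \<alpha> \<longleftrightarrow> \<alpha> \<in> b_cell B \<and>
     (\<exists>\<beta> \<in> cells B (b_cod B \<alpha>) (b_dom B \<alpha>).
        b_vcomp B \<beta> \<alpha> = b_idc B (b_dom B \<alpha>) \<and> b_vcomp B \<alpha> \<beta> = b_idc B (b_cod B \<alpha>))"

definition inv2 :: "('o, 'm, 'c) bicat \<Rightarrow> 'c \<Rightarrow> 'c" where
  "inv2 B \<alpha> = (THE \<beta>. \<beta> \<in> cells B (b_cod B \<alpha>) (b_dom B \<alpha>) \<and>
        b_vcomp B \<beta> \<alpha> = b_idc B (b_dom B \<alpha>) \<and> b_vcomp B \<alpha> \<beta> = b_idc B (b_cod B \<alpha>))"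

definition bicategory :: "('o, 'm, 'c) bicat \<Rightarrow> bool" where
  "bicategory B \<longleftrightarrow>
    \<comment> \<open>graph structure\<close>
    (\<forall>f \<in> b_arr B. b_src B f \<in> b_obj B \<and> b_trg B f \<in> b_obj B) \<and>
    (\<forall>\<alpha> \<in> b_cell B. b_dom B \<alpha> \<in> b_arr B \<and> b_cod B \<alpha> \<in> b_arr B \<and>
        b_src B (b_dom B \<alpha>) = b_src B (b_cod B \<alpha>) \<and> b_trg B (b_dom B \<alpha>) = b_trg B (b_cod B \<alpha>)) \<and>
    \<comment> \<open>hom-categories\<close>
    (\<forall>f \<in> b_arr B. b_idc B f \<in> cells B f f) \<and>
    (\<forall>\<alpha> \<in> b_cell B. \<forall>\<beta> \<in> b_cell B. b_cod B \<alpha> = b_dom B \<beta> \<longrightarrow>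
        b_vcomp B \<beta> \<alpha> \<in> cells B (b_dom B \<alpha>) (b_cod B \<beta>)) \<and>
    (\<forall>\<alpha> \<in> b_cell B. b_vcomp B (b_idc B (b_cod B \<alpha>)) \<alpha> = \<alpha> \<and> b_vcomp B \<alpha> (b_idc B (b_dom B \<alpha>)) = \<alpha>) \<and>
    (\<forall>\<alpha> \<in> b_cell B. \<forall>\<beta> \<in> b_cell B. \<forall>\<gamma> \<in> b_cell B.
        b_cod B \<alpha> = b_dom B \<beta> \<and> b_cod B \<beta> = b_dom B \<gamma> \<longrightarrow>
        b_vcomp B \<gamma> (b_vcomp B \<beta> \<alpha>) = b_vcomp B (b_vcomp B \<gamma> \<beta>) \<alpha>) \<and>
    \<comment> \<open>identity 1-cells and horizontal composition (a functor)\<close>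
    (\<forall>a \<in> b_obj B. b_ide B a \<in> hom B a a) \<and>
    (\<forall>f \<in> b_arr B. \<forall>g \<in> b_arr B. b_trg B f = b_src B g \<longrightarrow>
        b_hcomp B g f \<in> hom B (b_src B f) (b_trg B g)) \<and>
    (\<forall>\<alpha> \<in> b_cell B. \<forall>\<beta> \<in> b_cell B. b_trg B (b_dom B \<alpha>) = b_src B (b_dom B \<beta>) \<longrightarrow>
        b_hcompc B \<beta> \<alpha> \<in> cells B (b_hcomp B (b_dom B \<beta>) (b_dom B \<alpha>))
                                    (b_hcomp B (b_cod B \<beta>) (b_cod B \<alpha>))) \<and>
    (\<forall>f \<in> b_arr B. \<forall>g \<in> b_arr B. b_trg B f = b_src B g \<longrightarrow>
        b_hcompc B (b_idc B g) (b_idc B f) = b_idc B (b_hcomp B g f)) \<and>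
    (\<forall>\<alpha> \<in> b_cell B. \<forall>\<alpha>' \<in> b_cell B. \<forall>\<beta> \<in> b_cell B. \<forall>\<beta>' \<in> b_cell B.
        b_cod B \<alpha> = b_dom B \<alpha>' \<and> b_cod B \<beta> = b_dom B \<beta>' \<and>
        b_trg B (b_dom B \<alpha>) = b_src B (b_dom B \<beta>) \<longrightarrow>
        b_hcompc B (b_vcomp B \<beta>' \<beta>) (b_vcomp B \<alpha>' \<alpha>) =
        b_vcomp B (b_hcompc B \<beta>' \<alpha>') (b_hcompc B \<beta> \<alpha>)) \<and>
    \<comment> \<open>associator: invertible and natural\<close>
    (\<forall>f \<in> b_arr B. \<forall>g \<in> b_arr B. \<forall>h \<in> b_arr B.
        b_trg B f = b_src B g \<and> b_trg B g = b_src B h \<longrightarrow>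
        b_assoc B h g f \<in> cells B (b_hcomp B (b_hcomp B h g) f) (b_hcomp B h (b_hcomp B g f)) \<and>
        iso2 B (b_assoc B h g f)) \<and>
    (\<forall>\<alpha> \<in> b_cell B. \<forall>\<beta> \<in> b_cell B. \<forall>\<gamma> \<in> b_cell B.
        b_trg B (b_dom B \<alpha>) = b_src B (b_dom B \<beta>) \<and> b_trg B (b_dom B \<beta>) = b_src B (b_dom B \<gamma>) \<longrightarrow>
        b_vcomp B (b_assoc B (b_cod B \<gamma>) (b_cod B \<beta>) (b_cod B \<alpha>)) (b_hcompc B (b_hcompc B \<gamma> \<beta>) \<alpha>) =
        b_vcomp B (b_hcompc B \<gamma> (b_hcompc B \<beta> \<alpha>)) (b_assoc B (b_dom B \<gamma>) (b_dom B \<beta>) (b_dom B \<alpha>))) \<and>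
    \<comment> \<open>unitors: invertible and natural\<close>
    (\<forall>f \<in> b_arr B. b_lunit B f \<in> cells B (b_hcomp B (b_ide B (b_trg B f)) f) f \<and> iso2 B (b_lunit B f)) \<and>
    (\<forall>f \<in> b_arr B. b_runit B f \<in> cells B (b_hcomp B f (b_ide B (b_src B f))) f \<and> iso2 B (b_runit B f)) \<and>
    (\<forall>\<alpha> \<in> b_cell B.
        b_vcomp B \<alpha> (b_lunit B (b_dom B \<alpha>)) =
        b_vcomp B (b_lunit B (b_cod B \<alpha>)) (b_hcompc B (b_idc B (b_ide B (b_trg B (b_dom B \<alpha>)))) \<alpha>)) \<and>
    (\<forall>\<alpha> \<in> b_cell B.
        b_vcomp B \<alpha> (b_runit B (b_dom B \<alpha>)) =
        b_vcomp B (b_runit B (b_cod B \<alpha>)) (b_hcompc B \<alpha> (b_idc B (b_ide B (b_src B (b_dom B \<alpha>)))))) \<and>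
    \<comment> \<open>pentagon\<close>
    (\<forall>f \<in> b_arr B. \<forall>g \<in> b_arr B. \<forall>h \<in> b_arr B. \<forall>k \<in> b_arr B.
        b_trg B f = b_src B g \<and> b_trg B g = b_src B h \<and> b_trg B h = b_src B k \<longrightarrow>
        b_vcomp B (b_hcompc B (b_idc B k) (b_assoc B h g f))
          (b_vcomp B (b_assoc B k (b_hcomp B h g) f) (b_hcompc B (b_assoc B k h g) (b_idc B f))) =
        b_vcomp B (b_assoc B k h (b_hcomp B g f)) (b_assoc B (b_hcomp B k h) g f)) \<and>
    \<comment> \<open>triangle\<close>
    (\<forall>f \<in> b_arr B. \<forall>g \<in> b_arr B. b_trg B f = b_src B g \<longrightarrow>
        b_vcomp B (b_hcompc B (b_idc B g) (b_lunit B f)) (b_assoc B g (b_ide B (b_trg B f)) f) =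
        b_hcompc B (b_runit B g) (b_idc B f))"

text \<open>pf_cmp F g f : F g \<circ> F f \<Rightarrow> F (g \<circ> f); pf_unit F a : 1_{F a} \<Rightarrow> F (1_a).\<close>

record ('ao, 'am, 'ac, 'bo, 'bm, 'bc) psfun =
  pf_obj :: "'ao \<Rightarrow> 'bo"
  pf_arr :: "'am \<Rightarrow> 'bm"
  pf_cell :: "'ac \<Rightarrow> 'bc"
  pf_cmp :: "'am \<Rightarrow> 'am \<Rightarrow> 'bc"
  pf_unit :: "'ao \<Rightarrow> 'bc"

definition pseudofunctor ::
  "('ao, 'am, 'ac) bicat \<Rightarrow> ('bo, 'bm, 'bc) bicat \<Rightarrow> ('ao, 'am, 'ac, 'bo, 'bm, 'bc) psfun \<Rightarrow> bool" where
  "pseudofunctor A B F \<longleftrightarrow>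
    (\<forall>a \<in> b_obj A. pf_obj F a \<in> b_obj B) \<and>
    (\<forall>f \<in> b_arr A. pf_arr F f \<in> hom B (pf_obj F (b_src A f)) (pf_obj F (b_trg A f))) \<and>
    (\<forall>\<alpha> \<in> b_cell A. pf_cell F \<alpha> \<in> cells B (pf_arr F (b_dom A \<alpha>)) (pf_arr F (b_cod A \<alpha>))) \<and>
    (\<forall>f \<in> b_arr A. pf_cell F (b_idc A f) = b_idc B (pf_arr F f)) \<and>
    (\<forall>\<alpha> \<in> b_cell A. \<forall>\<beta> \<in> b_cell A. b_cod A \<alpha> = b_dom A \<beta> \<longrightarrow>
        pf_cell F (b_vcomp A \<beta> \<alpha>) = b_vcomp B (pf_cell F \<beta>) (pf_cell F \<alpha>)) \<and>
    (\<forall>f \<in> b_arr A. \<forall>g \<in> b_arr A. b_trg A f = b_src A g \<longrightarrow>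
        pf_cmp F g f \<in> cells B (b_hcomp B (pf_arr F g) (pf_arr F f)) (pf_arr F (b_hcomp A g f)) \<and>
        iso2 B (pf_cmp F g f)) \<and>
    (\<forall>\<alpha> \<in> b_cell A. \<forall>\<beta> \<in> b_cell A. b_trg A (b_dom A \<alpha>) = b_src A (b_dom A \<beta>) \<longrightarrow>
        b_vcomp B (pf_cell F (b_hcompc A \<beta> \<alpha>)) (pf_cmp F (b_dom A \<beta>) (b_dom A \<alpha>)) =
        b_vcomp B (pf_cmp F (b_cod A \<beta>) (b_cod A \<alpha>)) (b_hcompc B (pf_cell F \<beta>) (pf_cell F \<alpha>))) \<and>
    (\<forall>a \<in> b_obj A. pf_unit F a \<in> cells B (b_ide B (pf_obj F a)) (pf_arr F (b_ide A a)) \<and>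
        iso2 B (pf_unit F a)) \<and>
    \<comment> \<open>associativity coherence\<close>
    (\<forall>f \<in> b_arr A. \<forall>g \<in> b_arr A. \<forall>h \<in> b_arr A.
        b_trg A f = b_src A g \<and> b_trg A g = b_src A h \<longrightarrow>
        b_vcomp B (pf_cell F (b_assoc A h g f))
          (b_vcomp B (pf_cmp F (b_hcomp A h g) f) (b_hcompc B (pf_cmp F h g) (b_idc B (pf_arr F f)))) =
        b_vcomp B (pf_cmp F h (b_hcomp A g f))
          (b_vcomp B (b_hcompc B (b_idc B (pf_arr F h)) (pf_cmp F g f))
             (b_assoc B (pf_arr F h) (pf_arr F g) (pf_arr F f)))) \<and>
    \<comment> \<open>unit coherence\<close>
    (\<forall>f \<in> b_arr A.
        b_vcomp B (pf_cell F (b_lunit A f))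
          (b_vcomp B (pf_cmp F (b_ide A (b_trg A f)) f)
             (b_hcompc B (pf_unit F (b_trg A f)) (b_idc B (pf_arr F f)))) =
        b_lunit B (pf_arr F f)) \<and>
    (\<forall>f \<in> b_arr A.
        b_vcomp B (pf_cell F (b_runit A f))
          (b_vcomp B (pf_cmp F f (b_ide A (b_src A f)))
             (b_hcompc B (b_idc B (pf_arr F f)) (pf_unit F (b_src A f)))) =
        b_runit B (pf_arr F f))"

definition pf_comp ::
  "('co, 'cm, 'cc) bicat \<Rightarrow> ('bo, 'bm, 'bc, 'co, 'cm, 'cc) psfun \<Rightarrow> ('ao, 'am, 'ac, 'bo, 'bm, 'bc) psfun
   \<Rightarrow> ('ao, 'am, 'ac, 'co, 'cm, 'cc) psfun" where
  "pf_comp C G F =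
    \<lparr> pf_obj = pf_obj G \<circ> pf_obj F,
      pf_arr = pf_arr G \<circ> pf_arr F,
      pf_cell = pf_cell G \<circ> pf_cell F,
      pf_cmp = (\<lambda>g f. b_vcomp C (pf_cell G (pf_cmp F g f)) (pf_cmp G (pf_arr F g) (pf_arr F f))),
      pf_unit = (\<lambda>a. b_vcomp C (pf_cell G (pf_unit F a)) (pf_unit G (pf_obj F a))) \<rparr>"

definition pf_id :: "('ao, 'am, 'ac) bicat \<Rightarrow> ('ao, 'am, 'ac, 'ao, 'am, 'ac) psfun" where
  "pf_id A =
    \<lparr> pf_obj = id, pf_arr = id, pf_cell = id,
      pf_cmp = (\<lambda>g f. b_idc A (b_hcomp A g f)),
      pf_unit = (\<lambda>a. b_idc A (b_ide A a)) \<rparr>"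

text \<open>For sigma : F \<Rightarrow> G, component tr_obj sigma a : F a \<rightarrow> G a and, for f : a \<rightarrow> b,
  tr_arr sigma f : G f \<circ> sigma_a \<Rightarrow> sigma_b \<circ> F f (invertible).\<close>

record ('ao, 'am, 'bm, 'bc) pstrans =
  tr_obj :: "'ao \<Rightarrow> 'bm"
  tr_arr :: "'am \<Rightarrow> 'bc"

definition pseudonat ::
  "('ao, 'am, 'ac) bicat \<Rightarrow> ('bo, 'bm, 'bc) bicat \<Rightarrow> ('ao, 'am, 'ac, 'bo, 'bm, 'bc) psfun
   \<Rightarrow> ('ao, 'am, 'ac, 'bo, 'bm, 'bc) psfun \<Rightarrow> ('ao, 'am, 'bm, 'bc) pstrans \<Rightarrow> bool" where
  "pseudonat A B F G \<sigma> \<longleftrightarrow>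
    (\<forall>a \<in> b_obj A. tr_obj \<sigma> a \<in> hom B (pf_obj F a) (pf_obj G a)) \<and>
    (\<forall>f \<in> b_arr A.
        tr_arr \<sigma> f \<in> cells B (b_hcomp B (pf_arr G f) (tr_obj \<sigma> (b_src A f)))
                              (b_hcomp B (tr_obj \<sigma> (b_trg A f)) (pf_arr F f)) \<and>
        iso2 B (tr_arr \<sigma> f)) \<and>
    \<comment> \<open>naturality in 2-cells\<close>
    (\<forall>\<alpha> \<in> b_cell A.
        b_vcomp B (tr_arr \<sigma> (b_cod A \<alpha>))
          (b_hcompc B (pf_cell G \<alpha>) (b_idc B (tr_obj \<sigma> (b_src A (b_dom A \<alpha>))))) =
        b_vcomp B (b_hcompc B (b_idc B (tr_obj \<sigma> (b_trg A (b_dom A \<alpha>)))) (pf_cell F \<alpha>))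
          (tr_arr \<sigma> (b_dom A \<alpha>))) \<and>
    \<comment> \<open>compatibility with composition\<close>
    (\<forall>f \<in> b_arr A. \<forall>g \<in> b_arr A. b_trg A f = b_src A g \<longrightarrow>
       (let a = b_src A f; b = b_trg A f; c = b_trg A g in
        b_vcomp B (tr_arr \<sigma> (b_hcomp A g f))
          (b_hcompc B (pf_cmp G g f) (b_idc B (tr_obj \<sigma> a))) =
        b_vcomp B (b_hcompc B (b_idc B (tr_obj \<sigma> c)) (pf_cmp F g f))
         (b_vcomp B (b_assoc B (tr_obj \<sigma> c) (pf_arr F g) (pf_arr F f))
          (b_vcomp B (b_hcompc B (tr_arr \<sigma> g) (b_idc B (pf_arr F f)))
           (b_vcomp B (inv2 B (b_assoc B (pf_arr G g) (tr_obj \<sigma> b) (pf_arr F f)))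
            (b_vcomp B (b_hcompc B (b_idc B (pf_arr G g)) (tr_arr \<sigma> f))
              (b_assoc B (pf_arr G g) (pf_arr G f) (tr_obj \<sigma> a))))))) ) \<and>
    \<comment> \<open>compatibility with units\<close>
    (\<forall>a \<in> b_obj A.
        b_vcomp B (tr_arr \<sigma> (b_ide A a)) (b_hcompc B (pf_unit G a) (b_idc B (tr_obj \<sigma> a))) =
        b_vcomp B (b_hcompc B (b_idc B (tr_obj \<sigma> a)) (pf_unit F a))
          (b_vcomp B (inv2 B (b_runit B (tr_obj \<sigma> a))) (b_lunit B (tr_obj \<sigma> a))))"

definition tr_comp ::
  "('ao, 'am, 'ac) bicat \<Rightarrow> ('bo, 'bm, 'bc) bicat \<Rightarrow> ('ao, 'am, 'ac, 'bo, 'bm, 'bc) psfun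
   \<Rightarrow> ('ao, 'am, 'ac, 'bo, 'bm, 'bc) psfun \<Rightarrow> ('ao, 'am, 'ac, 'bo, 'bm, 'bc) psfun
   \<Rightarrow> ('ao, 'am, 'bm, 'bc) pstrans \<Rightarrow> ('ao, 'am, 'bm, 'bc) pstrans \<Rightarrow> ('ao, 'am, 'bm, 'bc) pstrans" where
  "tr_comp A B F G H \<tau> \<sigma> =
    \<lparr> tr_obj = (\<lambda>a. b_hcomp B (tr_obj \<tau> a) (tr_obj \<sigma> a)),
      tr_arr = (\<lambda>f. let a = b_src A f; b = b_trg A f in
        b_vcomp B (inv2 B (b_assoc B (tr_obj \<tau> b) (tr_obj \<sigma> b) (pf_arr F f)))
         (b_vcomp B (b_hcompc B (b_idc B (tr_obj \<tau> b)) (tr_arr \<sigma> f))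
          (b_vcomp B (b_assoc B (tr_obj \<tau> b) (pf_arr G f) (tr_obj \<sigma> a))
           (b_vcomp B (b_hcompc B (tr_arr \<tau> f) (b_idc B (tr_obj \<sigma> a)))
             (inv2 B (b_assoc B (pf_arr H f) (tr_obj \<tau> a) (tr_obj \<sigma> a)))))) ) \<rparr>"

definition tr_id ::
  "('bo, 'bm, 'bc) bicat \<Rightarrow> ('ao, 'am, 'ac, 'bo, 'bm, 'bc) psfun \<Rightarrow> ('ao, 'am, 'bm, 'bc) pstrans" where
  "tr_id B F =
    \<lparr> tr_obj = (\<lambda>a. b_ide B (pf_obj F a)),
      tr_arr = (\<lambda>f. b_vcomp B (inv2 B (b_lunit B (pf_arr F f))) (b_runit B (pf_arr F f))) \<rparr>"

definition modification ::
  "('ao, 'am, 'ac) bicat \<Rightarrow> ('bo, 'bm, 'bc) bicat \<Rightarrow> ('ao, 'am, 'ac, 'bo, 'bm, 'bc) psfun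
   \<Rightarrow> ('ao, 'am, 'ac, 'bo, 'bm, 'bc) psfun \<Rightarrow> ('ao, 'am, 'bm, 'bc) pstrans
   \<Rightarrow> ('ao, 'am, 'bm, 'bc) pstrans \<Rightarrow> ('ao \<Rightarrow> 'bc) \<Rightarrow> bool" where
  "modification A B F G \<sigma> \<tau> \<Gamma> \<longleftrightarrow>
    (\<forall>a \<in> b_obj A. \<Gamma> a \<in> cells B (tr_obj \<sigma> a) (tr_obj \<tau> a)) \<and>
    (\<forall>f \<in> b_arr A.
        b_vcomp B (tr_arr \<tau> f) (b_hcompc B (b_idc B (pf_arr G f)) (\<Gamma> (b_src A f))) =
        b_vcomp B (b_hcompc B (\<Gamma> (b_trg A f)) (b_idc B (pf_arr F f))) (tr_arr \<sigma> f))"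

text \<open>Invertible modification = isomorphism in the hom-category [A,B](F,G); vertical
  composition of modifications is componentwise, identities have identity components.\<close>

definition inv_modification ::
  "('ao, 'am, 'ac) bicat \<Rightarrow> ('bo, 'bm, 'bc) bicat \<Rightarrow> ('ao, 'am, 'ac, 'bo, 'bm, 'bc) psfun
   \<Rightarrow> ('ao, 'am, 'ac, 'bo, 'bm, 'bc) psfun \<Rightarrow> ('ao, 'am, 'bm, 'bc) pstrans
   \<Rightarrow> ('ao, 'am, 'bm, 'bc) pstrans \<Rightarrow> ('ao \<Rightarrow> 'bc) \<Rightarrow> bool" where
  "inv_modification A B F G \<sigma> \<tau> \<Gamma> \<longleftrightarrow>
    modification A B F G \<sigma> \<tau> \<Gamma> \<and>
    (\<exists>\<Gamma>'. modification A B F G \<tau> \<sigma> \<Gamma>' \<and>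
       (\<forall>a \<in> b_obj A. b_vcomp B (\<Gamma>' a) (\<Gamma> a) = b_idc B (tr_obj \<sigma> a) \<and>
                      b_vcomp B (\<Gamma> a) (\<Gamma>' a) = b_idc B (tr_obj \<tau> a)))"

definition equiv_in_functor_bicat ::
  "('ao, 'am, 'ac) bicat \<Rightarrow> ('bo, 'bm, 'bc) bicat \<Rightarrow> ('ao, 'am, 'ac, 'bo, 'bm, 'bc) psfun
   \<Rightarrow> ('ao, 'am, 'ac, 'bo, 'bm, 'bc) psfun \<Rightarrow> bool" where
  "equiv_in_functor_bicat A B F G \<longleftrightarrow>
    (\<exists>\<sigma> \<tau>. pseudonat A B F G \<sigma> \<and> pseudonat A B G F \<tau> \<and>
       (\<exists>\<Gamma>. inv_modification A B F F (tr_comp A B F G F \<tau> \<sigma>) (tr_id B F) \<Gamma>) \<and>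
       (\<exists>\<Delta>. inv_modification A B G G (tr_comp A B G F G \<sigma> \<tau>) (tr_id B G) \<Delta>))"

definition biequivalent :: "('ao, 'am, 'ac) bicat \<Rightarrow> ('bo, 'bm, 'bc) bicat \<Rightarrow> bool" where
  "biequivalent A B \<longleftrightarrow>
    (\<exists>F G. pseudofunctor A B F \<and> pseudofunctor B A G \<and>
       equiv_in_functor_bicat A A (pf_comp A G F) (pf_id A) \<and>
       equiv_in_functor_bicat B B (pf_comp B F G) (pf_id B))"

definition strict_functor ::
  "('ao, 'am, 'ac) bicat \<Rightarrow> ('bo, 'bm, 'bc) bicat \<Rightarrow> ('ao, 'am, 'ac, 'bo, 'bm, 'bc) psfun \<Rightarrow> bool" where
  "strict_functor A B F \<longleftrightarrow>
    pseudofunctor A B F \<and>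
    (\<forall>f \<in> b_arr A. \<forall>g \<in> b_arr A. b_trg A f = b_src A g \<longrightarrow>
        pf_arr F (b_hcomp A g f) = b_hcomp B (pf_arr F g) (pf_arr F f) \<and>
        pf_cmp F g f = b_idc B (b_hcomp B (pf_arr F g) (pf_arr F f))) \<and>
    (\<forall>a \<in> b_obj A. pf_arr F (b_ide A a) = b_ide B (pf_obj F a) \<and>
        pf_unit F a = b_idc B (b_ide B (pf_obj F a)))"

definition surjective_equivalence ::
  "('ao, 'am, 'ac) bicat \<Rightarrow> ('bo, 'bm, 'bc) bicat \<Rightarrow> ('ao, 'am, 'ac, 'bo, 'bm, 'bc) psfun \<Rightarrow> bool" where
  "surjective_equivalence A B F \<longleftrightarrow>
    pseudofunctor A B F \<and>
    (\<forall>b \<in> b_obj B. \<exists>a \<in> b_obj A. pf_obj F a = b) \<and>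
    (\<forall>a \<in> b_obj A. \<forall>a' \<in> b_obj A.
       \<comment> \<open>surjective on objects of the hom-category\<close>
       (\<forall>g \<in> hom B (pf_obj F a) (pf_obj F a'). \<exists>f \<in> hom A a a'. pf_arr F f = g) \<and>
       \<comment> \<open>full\<close>
       (\<forall>f \<in> hom A a a'. \<forall>f' \<in> hom A a a'. \<forall>\<beta> \<in> cells B (pf_arr F f) (pf_arr F f').
          \<exists>\<alpha> \<in> cells A f f'. pf_cell F \<alpha> = \<beta>) \<and>
       \<comment> \<open>faithful\<close>
       (\<forall>f \<in> hom A a a'. \<forall>f' \<in> hom A a a'. \<forall>\<alpha> \<in> cells A f f'. \<forall>\<alpha>' \<in> cells A f f'.
          pf_cell F \<alpha> = pf_cell F \<alpha>' \<longrightarrow> \<alpha> = \<alpha>'))"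

end

theory Submission
  imports Defs
begin

text \<open>
  From a biequivalence \<open>F : A \<rightarrow> B\<close>, take for \<open>C\<close> the bicategory of triples \<open>(a, b, e : F a \<rightarrow> b)\<close> with \<open>e\<close>
  an equivalence; its 1-cells are pairs \<open>(f, g)\<close> with an invertible square \<open>\<phi> : g \<odot> e \<Rightarrow> e' \<odot> F f\<close>, and
  its 2-cells are pairs of 2-cells compatible with the squares.  The two projections are strict by
  construction.  They are surjective equivalences because whiskering with an equivalence is fully
  faithful and essentially surjective, and because \<open>F\<close> is locally an equivalence.

  Conversely, a strict surjective equivalence \<open>P : C \<rightarrow> A\<close> has a pseudofunctor section \<open>S\<close>, obtained by
  choosing preimages and lifting 2-cells uniquely; every axiom is checked after applying \<open>P\<close>.  With a
  section \<open>T\<close> of \<open>Q : C \<rightarrow> B\<close>, put \<open>F = Q S\<close> and \<open>G = P T\<close>.  Since \<open>Q T Q S = Q S\<close>, the identity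
  transformation of \<open>Q S\<close> lifts along \<open>Q\<close> to an equivalence \<open>T Q S \<simeq> S\<close>, whose image under \<open>P\<close> is
  \<open>G F \<simeq> 1\<close>; the other composite is symmetric.
\<close>

section \<open>Calculus of 2-cells\<close>

text \<open>The second pseudofunctor \<open>G\<close> is used only to see that \<open>F\<close> is a
  local equivalence and reaches every object up to equivalence; the construction of \<open>C\<close>
  uses \<open>F\<close> alone. The projections can be strict because the comparison cells of
  \<open>F\<close> are absorbed into the squares, which leaves the other components to compose as in
  \<open>A\<close> and \<open>B\<close>. Hence equations between 2-cells of \<open>C\<close> are
  inherited, and the real work is to show that associators and unitors are compatible with pasted
  squares. For associators this takes pentagons; for unitors it takes, besides the triangle, Kelly's
  two unit coherences, which are not among the axioms and are derived first. In the converse the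
  obstacle is that the section \<open>S\<close> is not strict. Its comparison cells are chosen over
  identities, so that \<open>P S\<close> equals the identity on carriers, coherence cells included,
  and no correcting isomorphisms accumulate in composites such as \<open>Q T Q S\<close>.\<close>

notation b_vcomp (infixr "\<cdot>\<index>" 55)
notation b_hcomp (infixr "\<odot>\<index>" 60)
notation b_hcompc (infixr "\<star>\<index>" 60)
notation b_idc ("\<iota>\<index>")
notation b_assoc ("\<a>\<index>")
notation b_lunit ("\<l>\<index>")
notation b_runit ("\<r>\<index>")
notation b_ide ("\<one>\<index>")

locale bicat =
  fixes B :: "('o, 'm, 'c) bicat" (structure)
  assumes bicategory: "bicategory B"
begin

abbreviation "isoc \<equiv> iso2 B"
abbreviation "invc \<equiv> inv2 B"
abbreviation "src \<equiv> b_src B"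
abbreviation "trg \<equiv> b_trg B"
abbreviation "dm \<equiv> b_dom B"
abbreviation "cd \<equiv> b_cod B"
abbreviation "Obj \<equiv> b_obj B"
abbreviation "Arr \<equiv> b_arr B"
abbreviation "Cell \<equiv> b_cell B"

context
begin

private lemmas axs0 = bicategory[unfolded bicategory_def]
private lemmas ax_graph = axs0[THEN conjunct1, rule_format]
private lemmas axs1 = axs0[THEN conjunct2]
private lemmas ax_cells = axs1[THEN conjunct1, rule_format]
private lemmas axs2 = axs1[THEN conjunct2]
private lemmas ax_idc = axs2[THEN conjunct1, rule_format]
private lemmas axs3 = axs2[THEN conjunct2]
private lemmas ax_vcomp = axs3[THEN conjunct1, rule_format]
private lemmas axs4 = axs3[THEN conjunct2]
private lemmas ax_vunit = axs4[THEN conjunct1, rule_format]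
private lemmas axs5 = axs4[THEN conjunct2]
private lemmas ax_vassoc = axs5[THEN conjunct1, rule_format]
private lemmas axs6 = axs5[THEN conjunct2]
private lemmas ax_ide = axs6[THEN conjunct1, rule_format]
private lemmas axs7 = axs6[THEN conjunct2]
private lemmas ax_hcomp = axs7[THEN conjunct1, rule_format]
private lemmas axs8 = axs7[THEN conjunct2]
private lemmas ax_hcompc = axs8[THEN conjunct1, rule_format]
private lemmas axs9 = axs8[THEN conjunct2]
private lemmas ax_hcompc_idc = axs9[THEN conjunct1, rule_format]
private lemmas axs10 = axs9[THEN conjunct2]
private lemmas ax_interchange = axs10[THEN conjunct1, rule_format]
private lemmas axs11 = axs10[THEN conjunct2]
private lemmas ax_assoc = axs11[THEN conjunct1, rule_format]
private lemmas axs12 = axs11[THEN conjunct2]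
private lemmas ax_assoc_nat = axs12[THEN conjunct1, rule_format]
private lemmas axs13 = axs12[THEN conjunct2]
private lemmas ax_lunit = axs13[THEN conjunct1, rule_format]
private lemmas axs14 = axs13[THEN conjunct2]
private lemmas ax_runit = axs14[THEN conjunct1, rule_format]
private lemmas axs15 = axs14[THEN conjunct2]
private lemmas ax_lunit_nat = axs15[THEN conjunct1, rule_format]
private lemmas axs16 = axs15[THEN conjunct2]
private lemmas ax_runit_nat = axs16[THEN conjunct1, rule_format]
private lemmas axs17 = axs16[THEN conjunct2]
private lemmas ax_pentagon = axs17[THEN conjunct1, rule_format]
private lemmas ax_triangle = axs17[THEN conjunct2, rule_format]

section \<open>The bicategory axioms as rules\<close>

lemma src_trg_obj [simp]: "f \<in> Arr \<Longrightarrow> src f \<in> Obj" "f \<in> Arr \<Longrightarrow> trg f \<in> Obj"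
  using ax_graph by auto

lemma dom_cod [simp]:
  assumes "\<alpha> \<in> Cell"
  shows "dm \<alpha> \<in> Arr" "cd \<alpha> \<in> Arr" "src (cd \<alpha>) = src (dm \<alpha>)" "trg (cd \<alpha>) = trg (dm \<alpha>)"
  using ax_cells[OF assms] by auto

lemma idc [simp]:
  assumes "f \<in> Arr"
  shows "\<iota> f \<in> Cell" "dm (\<iota> f) = f" "cd (\<iota> f) = f"
  using ax_idc[OF assms] by (auto simp: cells_def)

lemma vcomp [simp]:
  assumes "\<alpha> \<in> Cell" "\<beta> \<in> Cell" "cd \<alpha> = dm \<beta>"
  shows "\<beta> \<cdot> \<alpha> \<in> Cell" "dm (\<beta> \<cdot> \<alpha>) = dm \<alpha>" "cd (\<beta> \<cdot> \<alpha>) = cd \<beta>"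
  using ax_vcomp[OF assms] by (auto simp: cells_def)

lemma vcomp_idc [simp]:
  assumes "\<alpha> \<in> Cell"
  shows "cd \<alpha> = f \<Longrightarrow> \<iota> f \<cdot> \<alpha> = \<alpha>" "dm \<alpha> = f \<Longrightarrow> \<alpha> \<cdot> \<iota> f = \<alpha>"
  using ax_vunit[OF assms] by auto

lemma vassoc [simp]:
  assumes "\<alpha> \<in> Cell" "\<beta> \<in> Cell" "\<gamma> \<in> Cell" "cd \<alpha> = dm \<beta>" "cd \<beta> = dm \<gamma>"
  shows "(\<gamma> \<cdot> \<beta>) \<cdot> \<alpha> = \<gamma> \<cdot> \<beta> \<cdot> \<alpha>"
  using ax_vassoc[OF assms(1-3)] assms(4,5) by simp

lemma ide [simp]:
  assumes "a \<in> Obj"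
  shows "\<one> a \<in> Arr" "src (\<one> a) = a" "trg (\<one> a) = a"
  using ax_ide[OF assms] by (auto simp: hom_def)

lemma hcomp [simp]:
  assumes "f \<in> Arr" "g \<in> Arr" "trg f = src g"
  shows "g \<odot> f \<in> Arr" "src (g \<odot> f) = src f" "trg (g \<odot> f) = trg g"
  using ax_hcomp[OF assms] by (auto simp: hom_def)

lemma hcompc [simp]:
  assumes "\<alpha> \<in> Cell" "\<beta> \<in> Cell" "trg (dm \<alpha>) = src (dm \<beta>)"
  shows "\<beta> \<star> \<alpha> \<in> Cell" "dm (\<beta> \<star> \<alpha>) = dm \<beta> \<odot> dm \<alpha>" "cd (\<beta> \<star> \<alpha>) = cd \<beta> \<odot> cd \<alpha>"
  using ax_hcompc[OF assms] by (auto simp: cells_def)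

lemma hcompc_idc [simp]:
  assumes "f \<in> Arr" "g \<in> Arr" "trg f = src g"
  shows "\<iota> g \<star> \<iota> f = \<iota> (g \<odot> f)"
  by (rule ax_hcompc_idc[OF assms])

lemma interchange:
  assumes "\<alpha> \<in> Cell" "\<alpha>' \<in> Cell" "\<beta> \<in> Cell" "\<beta>' \<in> Cell"
    "cd \<alpha> = dm \<alpha>'" "cd \<beta> = dm \<beta>'" "trg (dm \<alpha>) = src (dm \<beta>)"
  shows "(\<beta>' \<star> \<alpha>') \<cdot> (\<beta> \<star> \<alpha>) = (\<beta>' \<cdot> \<beta>) \<star> (\<alpha>' \<cdot> \<alpha>)"
  using ax_interchange[OF assms(1-4)] assms(5-) by simp

lemma assoc [simp]:
  assumes "f \<in> Arr" "g \<in> Arr" "h \<in> Arr" "trg f = src g" "trg g = src h"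
  shows "\<a> h g f \<in> Cell" "dm (\<a> h g f) = (h \<odot> g) \<odot> f" "cd (\<a> h g f) = h \<odot> g \<odot> f"
    "isoc (\<a> h g f)"
  using ax_assoc[OF assms(1-3)] assms(4-) by (auto simp: cells_def)

lemma assoc_nat:
  assumes "\<alpha> \<in> Cell" "\<beta> \<in> Cell" "\<gamma> \<in> Cell" "dm \<alpha> = f" "dm \<beta> = g" "dm \<gamma> = h"
    "trg f = src g" "trg g = src h"
  shows "(\<gamma> \<star> \<beta> \<star> \<alpha>) \<cdot> \<a> h g f = \<a> (cd \<gamma>) (cd \<beta>) (cd \<alpha>) \<cdot> ((\<gamma> \<star> \<beta>) \<star> \<alpha>)"
  using ax_assoc_nat[OF assms(1-3)] assms(4-) by simp

lemma lunit [simp]: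
  assumes "f \<in> Arr"
  shows "\<l> f \<in> Cell" "dm (\<l> f) = \<one> (trg f) \<odot> f" "cd (\<l> f) = f" "isoc (\<l> f)"
  using ax_lunit[OF assms] by (auto simp: cells_def)

lemma runit [simp]:
  assumes "f \<in> Arr"
  shows "\<r> f \<in> Cell" "dm (\<r> f) = f \<odot> \<one> (src f)" "cd (\<r> f) = f" "isoc (\<r> f)"
  using ax_runit[OF assms] by (auto simp: cells_def)

lemma lunit_nat:
  assumes "\<alpha> \<in> Cell" "cd \<alpha> = f" "trg f = x"
  shows "\<l> f \<cdot> (\<iota> (\<one> x) \<star> \<alpha>) = \<alpha> \<cdot> \<l> (dm \<alpha>)"
  using ax_lunit_nat[OF assms(1)] assms by auto

lemma runit_nat:
  assumes "\<alpha> \<in> Cell" "cd \<alpha> = f" "src f = x"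
  shows "\<r> f \<cdot> (\<alpha> \<star> \<iota> (\<one> x)) = \<alpha> \<cdot> \<r> (dm \<alpha>)"
  using ax_runit_nat[OF assms(1)] assms by auto

lemma pentagon:
  assumes "f \<in> Arr" "g \<in> Arr" "h \<in> Arr" "k \<in> Arr" "trg f = src g" "trg g = src h" "trg h = src k"
  shows "(\<iota> k \<star> \<a> h g f) \<cdot> \<a> k (h \<odot> g) f \<cdot> (\<a> k h g \<star> \<iota> f) = \<a> k h (g \<odot> f) \<cdot> \<a> (k \<odot> h) g f"
  using ax_pentagon[OF assms(1-4)] assms(5-) by simp

lemma triangle:
  assumes "f \<in> Arr" "g \<in> Arr" "trg f = src g"
  shows "(\<iota> g \<star> \<l> f) \<cdot> \<a> g (\<one> (trg f)) f = \<r> g \<star> \<iota> f"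
  using ax_triangle[OF assms] .

end

text \<open>Composites are kept nested to the right, where an equation for
  \<open>x \<cdot> y\<close> no longer matches once a further factor stands on the right. These
  variants carry that factor \<open>r\<close>.\<close>

lemma reassoc2:
  assumes "x \<cdot> y = z" "x \<in> Cell" "y \<in> Cell" "cd y = dm x" "r \<in> Cell" "cd r = dm y"
  shows "x \<cdot> y \<cdot> r = z \<cdot> r"
  using assms vassoc by metis

lemma reassoc3:
  assumes "x \<cdot> y \<cdot> w = z" "x \<in> Cell" "y \<in> Cell" "w \<in> Cell" "cd y = dm x" "cd w = dm y"
    "r \<in> Cell" "cd r = dm w"
  shows "x \<cdot> y \<cdot> w \<cdot> r = z \<cdot> r"
proof -
  have "(x \<cdot> y \<cdot> w) \<cdot> r = x \<cdot> y \<cdot> w \<cdot> r" using assms(2-) by simp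
  then show ?thesis by (simp only: assms(1))
qed

lemma assoc_nat_r:
  assumes "\<alpha> \<in> Cell" "\<beta> \<in> Cell" "\<gamma> \<in> Cell" "dm \<alpha> = f" "dm \<beta> = g" "dm \<gamma> = h"
    "trg f = src g" "trg g = src h" "r \<in> Cell" "cd r = (h \<odot> g) \<odot> f"
  shows "(\<gamma> \<star> \<beta> \<star> \<alpha>) \<cdot> \<a> h g f \<cdot> r = \<a> (cd \<gamma>) (cd \<beta>) (cd \<alpha>) \<cdot> ((\<gamma> \<star> \<beta>) \<star> \<alpha>) \<cdot> r"
  using reassoc2[OF assoc_nat[OF assms(1-8)], of r] assms by auto

text \<open>The instance of naturality whose left-hand side is hidden by \<open>\<iota> g \<star> \<iota> f = \<iota> (g \<odot> f)\<close>.\<close>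

lemma assoc_nat_idc:
  assumes "\<gamma> \<in> Cell" "f \<in> Arr" "g \<in> Arr" "dm \<gamma> = h" "trg f = src g" "trg g = src h"
  shows "(\<gamma> \<star> \<iota> (g \<odot> f)) \<cdot> \<a> h g f = \<a> (cd \<gamma>) g f \<cdot> ((\<gamma> \<star> \<iota> g) \<star> \<iota> f)"
    "r \<in> Cell \<Longrightarrow> cd r = (h \<odot> g) \<odot> f \<Longrightarrow>
      (\<gamma> \<star> \<iota> (g \<odot> f)) \<cdot> \<a> h g f \<cdot> r = \<a> (cd \<gamma>) g f \<cdot> ((\<gamma> \<star> \<iota> g) \<star> \<iota> f) \<cdot> r"
  using assoc_nat[OF _ _ assms(1) _ _ assms(4), of "\<iota> f" "\<iota> g" f g]
    assoc_nat_r[OF _ _ assms(1) _ _ assms(4), of "\<iota> f" "\<iota> g" f g r] assms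
  by (simp_all only: hcompc_idc idc simp_thms)

lemma lunit_nat_r:
  assumes "\<alpha> \<in> Cell" "cd \<alpha> = f" "trg f = x" "r \<in> Cell" "cd r = \<one> x \<odot> dm \<alpha>"
  shows "\<l> f \<cdot> (\<iota> (\<one> x) \<star> \<alpha>) \<cdot> r = \<alpha> \<cdot> \<l> (dm \<alpha>) \<cdot> r"
  using reassoc2[OF lunit_nat[OF assms(1-3)], of r] assms by auto

lemma runit_nat_r:
  assumes "\<alpha> \<in> Cell" "cd \<alpha> = f" "src f = x" "r \<in> Cell" "cd r = dm \<alpha> \<odot> \<one> x"
  shows "\<r> f \<cdot> (\<alpha> \<star> \<iota> (\<one> x)) \<cdot> r = \<alpha> \<cdot> \<r> (dm \<alpha>) \<cdot> r"
  using reassoc2[OF runit_nat[OF assms(1-3)], of r] assms by auto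

text \<open>Read from left to right, these rules move associators towards the codomain of a
  composite and unitors towards its domain.\<close>

lemmas nat = assoc_nat assoc_nat_r assoc_nat_idc lunit_nat lunit_nat_r runit_nat runit_nat_r

lemma whisker_left:
  assumes "\<alpha> \<in> Cell" "\<beta> \<in> Cell" "f \<in> Arr" "cd \<alpha> = dm \<beta>" "trg (dm \<alpha>) = src f"
  shows "\<iota> f \<star> (\<beta> \<cdot> \<alpha>) = (\<iota> f \<star> \<beta>) \<cdot> (\<iota> f \<star> \<alpha>)"
  using interchange[of \<alpha> \<beta> "\<iota> f" "\<iota> f"] assms by simp

lemma whisker_right:
  assumes "\<alpha> \<in> Cell" "\<beta> \<in> Cell" "f \<in> Arr" "cd \<alpha> = dm \<beta>" "trg f = src (dm \<alpha>)"
  shows "(\<beta> \<cdot> \<alpha>) \<star> \<iota> f = (\<beta> \<star> \<iota> f) \<cdot> (\<alpha> \<star> \<iota> f)"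
  using interchange[of "\<iota> f" "\<iota> f" \<alpha> \<beta>] assms by simp

lemmas whisker = whisker_left whisker_right

section \<open>Invertible 2-cells\<close>

lemma iso_cell: "isoc \<alpha> \<Longrightarrow> \<alpha> \<in> Cell"
  by (simp add: iso2_def)

lemma inv_unique:
  assumes "\<alpha> \<in> Cell" "\<beta> \<in> Cell" "\<beta>' \<in> Cell" "dm \<beta> = cd \<alpha>" "cd \<beta>' = dm \<alpha>"
    "\<beta> \<cdot> \<alpha> = \<iota> (dm \<alpha>)" "\<alpha> \<cdot> \<beta>' = \<iota> (cd \<alpha>)"
  shows "\<beta> = \<beta>'"
proof -
  have "(\<beta> \<cdot> \<alpha>) \<cdot> \<beta>' = \<beta> \<cdot> \<alpha> \<cdot> \<beta>'" using assms(1-5) by simp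
  then show ?thesis using assms by simp
qed

lemma inv_props:
  assumes "isoc \<alpha>"
  shows "invc \<alpha> \<in> cells B (cd \<alpha>) (dm \<alpha>) \<and> invc \<alpha> \<cdot> \<alpha> = \<iota> (dm \<alpha>) \<and> \<alpha> \<cdot> invc \<alpha> = \<iota> (cd \<alpha>)"
  unfolding inv2_def
proof (rule theI')
  show "\<exists>!\<beta>. \<beta> \<in> cells B (cd \<alpha>) (dm \<alpha>) \<and> \<beta> \<cdot> \<alpha> = \<iota> (dm \<alpha>) \<and> \<alpha> \<cdot> \<beta> = \<iota> (cd \<alpha>)"
  proof (rule ex_ex1I)
    show "\<exists>\<beta>. \<beta> \<in> cells B (cd \<alpha>) (dm \<alpha>) \<and> \<beta> \<cdot> \<alpha> = \<iota> (dm \<alpha>) \<and> \<alpha> \<cdot> \<beta> = \<iota> (cd \<alpha>)"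
      using assms by (auto simp: iso2_def)
  next
    fix \<beta> \<beta>'
    assume "\<beta> \<in> cells B (cd \<alpha>) (dm \<alpha>) \<and> \<beta> \<cdot> \<alpha> = \<iota> (dm \<alpha>) \<and> \<alpha> \<cdot> \<beta> = \<iota> (cd \<alpha>)"
      "\<beta>' \<in> cells B (cd \<alpha>) (dm \<alpha>) \<and> \<beta>' \<cdot> \<alpha> = \<iota> (dm \<alpha>) \<and> \<alpha> \<cdot> \<beta>' = \<iota> (cd \<alpha>)"
    then show "\<beta> = \<beta>'" using inv_unique[of \<alpha> \<beta> \<beta>'] iso_cell[OF assms] by (simp add: cells_def)
  qed
qed

lemma invc [simp]:
  assumes "isoc \<alpha>"
  shows "invc \<alpha> \<in> Cell" "dm (invc \<alpha>) = cd \<alpha>" "cd (invc \<alpha>) = dm \<alpha>"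
    "invc \<alpha> \<cdot> \<alpha> = \<iota> (dm \<alpha>)" "\<alpha> \<cdot> invc \<alpha> = \<iota> (cd \<alpha>)"
  using inv_props[OF assms] by (auto simp: cells_def)

lemma isoI:
  assumes "\<alpha> \<in> Cell" "\<beta> \<in> Cell" "dm \<beta> = cd \<alpha>" "cd \<beta> = dm \<alpha>"
    "\<beta> \<cdot> \<alpha> = \<iota> (dm \<alpha>)" "\<alpha> \<cdot> \<beta> = \<iota> (cd \<alpha>)"
  shows "isoc \<alpha>"
  using assms by (auto simp: iso2_def cells_def)

context
  notes iso_cell [simp]
begin

lemma inv_eqI:
  assumes "\<alpha> \<in> Cell" "\<beta> \<in> Cell" "dm \<beta> = cd \<alpha>" "cd \<beta> = dm \<alpha>"
    "\<beta> \<cdot> \<alpha> = \<iota> (dm \<alpha>)" "\<alpha> \<cdot> \<beta> = \<iota> (cd \<alpha>)"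
  shows "invc \<alpha> = \<beta>"
  using inv_unique[of \<alpha> "invc \<alpha>" \<beta>] isoI[OF assms] assms by simp

lemma inv_cancel [simp]:
  assumes "isoc \<alpha>" "r \<in> Cell"
  shows "cd r = dm \<alpha> \<Longrightarrow> invc \<alpha> \<cdot> \<alpha> \<cdot> r = r" "cd r = cd \<alpha> \<Longrightarrow> \<alpha> \<cdot> invc \<alpha> \<cdot> r = r"
  using assms reassoc2[of "invc \<alpha>" \<alpha> _ r] reassoc2[of \<alpha> "invc \<alpha>" _ r] by simp_all

lemma iso_inv [simp]: "isoc \<alpha> \<Longrightarrow> isoc (invc \<alpha>)"
  by (rule isoI[of _ \<alpha>]) simp_all

lemma iso_idc [simp]: "f \<in> Arr \<Longrightarrow> isoc (\<iota> f)"
  by (rule isoI[of _ "\<iota> f"]) simp_all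

lemma iso_vcomp [simp]:
  assumes "isoc \<alpha>" "isoc \<beta>" "cd \<alpha> = dm \<beta>"
  shows "isoc (\<beta> \<cdot> \<alpha>)"
  by (rule isoI[of _ "invc \<alpha> \<cdot> invc \<beta>"]) (use assms in simp_all)

lemma iso_hcompc [simp]:
  assumes "isoc \<alpha>" "isoc \<beta>" "trg (dm \<alpha>) = src (dm \<beta>)"
  shows "isoc (\<beta> \<star> \<alpha>)"
  by (rule isoI[of _ "invc \<beta> \<star> invc \<alpha>"]) (use assms in \<open>simp_all add: interchange\<close>)

lemma inv_idc [simp]: "f \<in> Arr \<Longrightarrow> invc (\<iota> f) = \<iota> f"
  by (rule inv_eqI) simp_all

lemma inv_hcompc [simp]:
  assumes "isoc \<alpha>" "isoc \<beta>" "trg (dm \<alpha>) = src (dm \<beta>)"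
  shows "invc (\<beta> \<star> \<alpha>) = invc \<beta> \<star> invc \<alpha>"
  by (rule inv_eqI) (use assms in \<open>simp_all add: interchange\<close>)

lemma iso_cancel_left:
  assumes "isoc \<gamma>" "\<alpha> \<in> Cell" "\<beta> \<in> Cell" "cd \<alpha> = dm \<gamma>" "cd \<beta> = dm \<gamma>" "\<gamma> \<cdot> \<alpha> = \<gamma> \<cdot> \<beta>"
  shows "\<alpha> = \<beta>"
proof -
  have "invc \<gamma> \<cdot> \<gamma> \<cdot> \<alpha> = invc \<gamma> \<cdot> \<gamma> \<cdot> \<beta>" using assms(6) by simp
  then show ?thesis using assms(1-5) by simp
qed

lemma iso_cancel_right:
  assumes "isoc \<gamma>" "\<alpha> \<in> Cell" "\<beta> \<in> Cell" "dm \<alpha> = cd \<gamma>" "dm \<beta> = cd \<gamma>" "\<alpha> \<cdot> \<gamma> = \<beta> \<cdot> \<gamma>"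
  shows "\<alpha> = \<beta>"
proof -
  have "(\<alpha> \<cdot> \<gamma>) \<cdot> invc \<gamma> = (\<beta> \<cdot> \<gamma>) \<cdot> invc \<gamma>" using assms(6) by simp
  then show ?thesis using assms(1-5) by simp
qed

end

text \<open>Naturality of the invertible \<open>\<l>\<close> exhibits \<alpha> as a conjugate of its
  whiskering with an identity 1-cell.\<close>

lemma ide_whisker_faithful_left:
  assumes "\<alpha> \<in> Cell" "\<beta> \<in> Cell" "dm \<alpha> = dm \<beta>" "cd \<alpha> = cd \<beta>"
    "\<iota> (\<one> (trg (dm \<alpha>))) \<star> \<alpha> = \<iota> (\<one> (trg (dm \<alpha>))) \<star> \<beta>"
  shows "\<alpha> = \<beta>"
  by (rule iso_cancel_right[of "\<l> (dm \<alpha>)"])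
     (use assms lunit_nat[of \<alpha>, OF _ refl refl] lunit_nat[of \<beta>, OF _ refl refl] in simp_all)

lemma ide_whisker_faithful_right:
  assumes "\<alpha> \<in> Cell" "\<beta> \<in> Cell" "dm \<alpha> = dm \<beta>" "cd \<alpha> = cd \<beta>"
    "\<alpha> \<star> \<iota> (\<one> (src (dm \<alpha>))) = \<beta> \<star> \<iota> (\<one> (src (dm \<alpha>)))"
  shows "\<alpha> = \<beta>"
  by (rule iso_cancel_right[of "\<r> (dm \<alpha>)"])
     (use assms runit_nat[of \<alpha>, OF _ refl refl] runit_nat[of \<beta>, OF _ refl refl] in simp_all)

text \<open>Kelly's observation that this coherence follows from pentagon and triangle. Both sides
  are whiskered with an identity 1-cell on the left, which loses nothing, and compared after an
  invertible composite of associators, where one pentagon and two triangles apply.\<close>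

lemma lunit_hcomp:
  assumes [simp]: "f \<in> Arr" "g \<in> Arr" "trg f = src g"
  shows "\<l> (g \<odot> f) \<cdot> \<a> (\<one> (trg g)) g f = \<l> g \<star> \<iota> f"
proof (rule ide_whisker_faithful_left)
  define e where "e = \<one> (trg g)"
  have e [simp]: "e \<in> Arr" "src e = trg g" "trg e = trg g" "\<one> (trg g) = e" by (simp_all add: e_def)
  have "(\<iota> e \<star> (\<l> (g \<odot> f) \<cdot> \<a> e g f)) \<cdot> \<a> e (e \<odot> g) f \<cdot> (\<a> e e g \<star> \<iota> f)
      = (\<iota> e \<star> \<l> (g \<odot> f)) \<cdot> \<a> e e (g \<odot> f) \<cdot> \<a> (e \<odot> e) g f"
    using pentagon[of f g e e] by (simp add: whisker)
  also have "\<dots> = (\<r> e \<star> \<iota> (g \<odot> f)) \<cdot> \<a> (e \<odot> e) g f"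
    using triangle[of "g \<odot> f" e] by (subst reassoc2) simp_all
  also have "\<dots> = \<a> e g f \<cdot> ((\<r> e \<star> \<iota> g) \<star> \<iota> f)"
    by (simp add: nat)
  also have "\<dots> = (\<iota> e \<star> (\<l> g \<star> \<iota> f)) \<cdot> \<a> e (e \<odot> g) f \<cdot> (\<a> e e g \<star> \<iota> f)"
    using triangle[of g e, symmetric] by (simp add: assoc_nat_r whisker)
  finally have eq: "(\<iota> e \<star> (\<l> (g \<odot> f) \<cdot> \<a> e g f)) \<cdot> \<a> e (e \<odot> g) f \<cdot> (\<a> e e g \<star> \<iota> f) =
      (\<iota> e \<star> (\<l> g \<star> \<iota> f)) \<cdot> \<a> e (e \<odot> g) f \<cdot> (\<a> e e g \<star> \<iota> f)" .
  show "\<iota> (\<one> (trg (dm (\<l> (g \<odot> f) \<cdot> \<a> (\<one> (trg g)) g f)))) \<star> (\<l> (g \<odot> f) \<cdot> \<a> (\<one> (trg g)) g f) =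
    \<iota> (\<one> (trg (dm (\<l> (g \<odot> f) \<cdot> \<a> (\<one> (trg g)) g f)))) \<star> (\<l> g \<star> \<iota> f)"
    by (rule iso_cancel_right[of "\<a> e (e \<odot> g) f \<cdot> (\<a> e e g \<star> \<iota> f)"]) (use eq in simp_all)
qed simp_all

text \<open>Mirror image of \<open>lunit_hcomp\<close>: the whiskering is on the right, and the
  comparison is made after composing with an associator.\<close>

lemma runit_hcomp:
  assumes [simp]: "f \<in> Arr" "g \<in> Arr" "trg f = src g"
  shows "(\<iota> g \<star> \<r> f) \<cdot> \<a> g f (\<one> (src f)) = \<r> (g \<odot> f)"
proof (rule ide_whisker_faithful_right)
  let ?e = "\<one> (src f)"
  have "\<a> g f ?e \<cdot> (((\<iota> g \<star> \<r> f) \<cdot> \<a> g f ?e) \<star> \<iota> ?e) = (\<iota> g \<star> (\<r> f \<star> \<iota> ?e)) \<cdot> \<a> g (f \<odot> ?e) ?e \<cdot> (\<a> g f ?e \<star> \<iota> ?e)"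
    by (simp add: whisker assoc_nat_r)
  also have "\<dots> = (\<iota> g \<star> (\<iota> f \<star> \<l> ?e)) \<cdot> (\<iota> g \<star> \<a> f ?e ?e) \<cdot> \<a> g (f \<odot> ?e) ?e \<cdot> (\<a> g f ?e \<star> \<iota> ?e)"
    using triangle[of ?e f, symmetric] by (simp add: whisker)
  also have "\<dots> = (\<iota> g \<star> (\<iota> f \<star> \<l> ?e)) \<cdot> \<a> g f (?e \<odot> ?e) \<cdot> \<a> (g \<odot> f) ?e ?e"
    using pentagon[of ?e ?e f g] by simp
  also have "\<dots> = \<a> g f ?e \<cdot> (\<iota> (g \<odot> f) \<star> \<l> ?e) \<cdot> \<a> (g \<odot> f) ?e ?e"
    by (simp add: assoc_nat_r)
  also have "\<dots> = \<a> g f ?e \<cdot> (\<r> (g \<odot> f) \<star> \<iota> ?e)"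
    using triangle[of ?e "g \<odot> f"] by simp
  finally have eq: "\<a> g f ?e \<cdot> (((\<iota> g \<star> \<r> f) \<cdot> \<a> g f ?e) \<star> \<iota> ?e) = \<a> g f ?e \<cdot> (\<r> (g \<odot> f) \<star> \<iota> ?e)" .
  show "((\<iota> g \<star> \<r> f) \<cdot> \<a> g f ?e) \<star> \<iota> (\<one> (src (dm ((\<iota> g \<star> \<r> f) \<cdot> \<a> g f ?e)))) =
      \<r> (g \<odot> f) \<star> \<iota> (\<one> (src (dm ((\<iota> g \<star> \<r> f) \<cdot> \<a> g f ?e))))"
    by (rule iso_cancel_left[of "\<a> g f ?e"]) (use eq in simp_all)
qed simp_all

text \<open>Naturality of \<open>\<l>\<close> at itself gives \<open>\<l> (\<one> a \<odot> \<one>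
  a) = \<iota> (\<one> a) \<star> \<l> (\<one> a)\<close>. Then \<open>lunit_hcomp\<close> and the
  triangle evaluate the same composite, so the two unitors agree after whiskering with
  \<open>\<one> a\<close>.\<close>

lemma lunit_ide_eq_runit_ide:
  assumes [simp]: "a \<in> Obj"
  shows "\<l> (\<one> a) = \<r> (\<one> a)"
proof (rule ide_whisker_faithful_right)
  have "\<l> (\<one> a \<odot> \<one> a) = \<iota> (\<one> a) \<star> \<l> (\<one> a)"
    by (rule iso_cancel_left[of "\<l> (\<one> a)"]) (use lunit_nat[of "\<l> (\<one> a)"] in simp_all)
  then show "\<l> (\<one> a) \<star> \<iota> (\<one> (src (dm (\<l> (\<one> a))))) = \<r> (\<one> a) \<star> \<iota> (\<one> (src (dm (\<l> (\<one> a)))))"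
    using lunit_hcomp[of "\<one> a" "\<one> a"] triangle[of "\<one> a" "\<one> a"] by simp
qed simp_all

end

section \<open>Squares\<close>

context bicat
begin

lemma assoc_inv_nat:
  assumes "\<alpha> \<in> Cell" "\<beta> \<in> Cell" "\<gamma> \<in> Cell" "cd \<alpha> = f" "cd \<beta> = g" "cd \<gamma> = h"
    "trg f = src g" "trg g = src h"
  shows "invc (\<a> h g f) \<cdot> (\<gamma> \<star> \<beta> \<star> \<alpha>) = ((\<gamma> \<star> \<beta>) \<star> \<alpha>) \<cdot> invc (\<a> (dm \<gamma>) (dm \<beta>) (dm \<alpha>))"
proof -
  have [simp]: "f \<in> Arr" "g \<in> Arr" "h \<in> Arr" using assms by auto
  have [simp]: "trg (dm \<alpha>) = src (dm \<beta>)" "trg (dm \<beta>) = src (dm \<gamma>)"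
    using assms by (metis dom_cod(3,4))+
  have "(\<gamma> \<star> \<beta> \<star> \<alpha>) \<cdot> \<a> (dm \<gamma>) (dm \<beta>) (dm \<alpha>) = \<a> h g f \<cdot> ((\<gamma> \<star> \<beta>) \<star> \<alpha>)"
    using assms by (simp add: assoc_nat)
  then have "(invc (\<a> h g f) \<cdot> (\<gamma> \<star> \<beta> \<star> \<alpha>)) \<cdot> \<a> (dm \<gamma>) (dm \<beta>) (dm \<alpha>) = (\<gamma> \<star> \<beta>) \<star> \<alpha>"
    using assms by simp
  then have "((invc (\<a> h g f) \<cdot> (\<gamma> \<star> \<beta> \<star> \<alpha>)) \<cdot> \<a> (dm \<gamma>) (dm \<beta>) (dm \<alpha>)) \<cdot> invc (\<a> (dm \<gamma>) (dm \<beta>) (dm \<alpha>))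
    = ((\<gamma> \<star> \<beta>) \<star> \<alpha>) \<cdot> invc (\<a> (dm \<gamma>) (dm \<beta>) (dm \<alpha>))" by simp
  then show ?thesis using assms by simp
qed

lemma assoc_inv_nat_r:
  assumes "\<alpha> \<in> Cell" "\<beta> \<in> Cell" "\<gamma> \<in> Cell" "cd \<alpha> = f" "cd \<beta> = g" "cd \<gamma> = h"
    "trg f = src g" "trg g = src h" "r \<in> Cell" "cd r = dm \<gamma> \<odot> dm \<beta> \<odot> dm \<alpha>"
  shows "invc (\<a> h g f) \<cdot> (\<gamma> \<star> \<beta> \<star> \<alpha>) \<cdot> r = ((\<gamma> \<star> \<beta>) \<star> \<alpha>) \<cdot> invc (\<a> (dm \<gamma>) (dm \<beta>) (dm \<alpha>)) \<cdot> r"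
proof -
  have [simp]: "f \<in> Arr" "g \<in> Arr" "h \<in> Arr" using assms by auto
  have [simp]: "trg (dm \<alpha>) = src (dm \<beta>)" "trg (dm \<beta>) = src (dm \<gamma>)" "trg f = src g" "trg g = src h"
    using assms by (metis dom_cod(3,4))+
  show ?thesis
    using reassoc2[OF assoc_inv_nat[OF assms(1-8)], of r] assms(1-6,9,10) by simp
qed

text \<open>The composition and unit axioms of a pseudonatural transformation
  say that its component squares are compatible with \<open>paste\<close> and \<open>unit_sq\<close>.\<close>

definition sq where
  "sq e e' u g \<phi> \<longleftrightarrow> e \<in> Arr \<and> e' \<in> Arr \<and> u \<in> Arr \<and> g \<in> Arr \<and>
    src u = src e \<and> trg u = src e' \<and> src g = trg e \<and> trg g = trg e' \<and>
    \<phi> \<in> Cell \<and> dm \<phi> = g \<odot> e \<and> cd \<phi> = e' \<odot> u"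

definition paste where
  "paste e'' e' e u' u g' g \<phi>' \<phi> =
    \<a> e'' u' u \<cdot> (\<phi>' \<star> \<iota> u) \<cdot> invc (\<a> g' e' u) \<cdot> (\<iota> g' \<star> \<phi>) \<cdot> \<a> g' g e"

definition unit_sq where
  "unit_sq e = invc (\<r> e) \<cdot> \<l> e"

lemma sq_paste:
  assumes "sq e e' u g \<phi>" "sq e' e'' u' g' \<phi>'"
  shows "sq e e'' (u' \<odot> u) (g' \<odot> g) (paste e'' e' e u' u g' g \<phi>' \<phi>)"
    "isoc \<phi> \<Longrightarrow> isoc \<phi>' \<Longrightarrow> isoc (paste e'' e' e u' u g' g \<phi>' \<phi>)"
  using assms by (simp_all add: sq_def paste_def)

lemma sq_unit_sq:
  assumes "e \<in> Arr"
  shows "sq e e (\<one> (src e)) (\<one> (trg e)) (unit_sq e)" "isoc (unit_sq e)"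
  using assms by (simp_all add: sq_def unit_sq_def)

text \<open>The pentagon solved for the composites with inverse associators that occur in
  \<open>paste\<close>.\<close>

lemma pentagon_inv:
  assumes [simp]: "f \<in> Arr" "g \<in> Arr" "h \<in> Arr" "k \<in> Arr" "trg f = src g" "trg g = src h" "trg h = src k"
  shows "(\<iota> k \<star> invc (\<a> h g f)) \<cdot> \<a> k h (g \<odot> f) = \<a> k (h \<odot> g) f \<cdot> (\<a> k h g \<star> \<iota> f) \<cdot> invc (\<a> (k \<odot> h) g f)"
    and "invc (\<a> k h (g \<odot> f)) \<cdot> (\<iota> k \<star> \<a> h g f) \<cdot> \<a> k (h \<odot> g) f = \<a> (k \<odot> h) g f \<cdot> (invc (\<a> k h g) \<star> \<iota> f)"
proof -
  have 1: "(\<iota> k \<star> \<a> h g f) \<cdot> \<a> k (h \<odot> g) f \<cdot> (\<a> k h g \<star> \<iota> f) = \<a> k h (g \<odot> f) \<cdot> \<a> (k \<odot> h) g f"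
    by (simp add: pentagon)
  have "invc (\<iota> k \<star> \<a> h g f) \<cdot> ((\<iota> k \<star> \<a> h g f) \<cdot> \<a> k (h \<odot> g) f \<cdot> (\<a> k h g \<star> \<iota> f)) \<cdot> invc (\<a> (k \<odot> h) g f)
     = invc (\<iota> k \<star> \<a> h g f) \<cdot> (\<a> k h (g \<odot> f) \<cdot> \<a> (k \<odot> h) g f) \<cdot> invc (\<a> (k \<odot> h) g f)"
    by (simp only: 1)
  then show "(\<iota> k \<star> invc (\<a> h g f)) \<cdot> \<a> k h (g \<odot> f) = \<a> k (h \<odot> g) f \<cdot> (\<a> k h g \<star> \<iota> f) \<cdot> invc (\<a> (k \<odot> h) g f)"
    \<comment> \<open>The inverse of the whiskered associator is kept whole while it cancels, and is
      distributed only afterwards.\<close>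
    by (simp del: inv_hcompc) simp
  have "invc (\<a> k h (g \<odot> f)) \<cdot> ((\<iota> k \<star> \<a> h g f) \<cdot> \<a> k (h \<odot> g) f \<cdot> (\<a> k h g \<star> \<iota> f)) \<cdot> invc (\<a> k h g \<star> \<iota> f)
     = invc (\<a> k h (g \<odot> f)) \<cdot> (\<a> k h (g \<odot> f) \<cdot> \<a> (k \<odot> h) g f) \<cdot> invc (\<a> k h g \<star> \<iota> f)"
    by (simp only: 1)
  then show "invc (\<a> k h (g \<odot> f)) \<cdot> (\<iota> k \<star> \<a> h g f) \<cdot> \<a> k (h \<odot> g) f = \<a> (k \<odot> h) g f \<cdot> (invc (\<a> k h g) \<star> \<iota> f)"
    by (simp del: inv_hcompc) simp
qed

text \<open>Once naturality has brought the three squares into the same order on both sides, the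
  remaining associators are matched by four pentagons, one for each position of the crossing edge in
  a word with three other 1-cells: \<open>e0\<close> at the right end, \<open>e1\<close> and
  \<open>e2\<close> inside, \<open>e3\<close> at the left end.\<close>

lemma paste_assoc:
  assumes "sq e0 e1 u1 g1 \<phi>1" "sq e1 e2 u2 g2 \<phi>2" "sq e2 e3 u3 g3 \<phi>3"
  shows "paste e3 e2 e0 u3 (u2 \<odot> u1) g3 (g2 \<odot> g1) \<phi>3 (paste e2 e1 e0 u2 u1 g2 g1 \<phi>2 \<phi>1) \<cdot> (\<a> g3 g2 g1 \<star> \<iota> e0)
   = (\<iota> e3 \<star> \<a> u3 u2 u1) \<cdot> paste e3 e1 e0 (u3 \<odot> u2) u1 (g3 \<odot> g2) g1 (paste e3 e2 e1 u3 u2 g3 g2 \<phi>3 \<phi>2) \<phi>1"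
proof -
  have [simp]: "e0 \<in> Arr" "e1 \<in> Arr" "e2 \<in> Arr" "e3 \<in> Arr" "u1 \<in> Arr" "u2 \<in> Arr" "u3 \<in> Arr"
    "g1 \<in> Arr" "g2 \<in> Arr" "g3 \<in> Arr" "\<phi>1 \<in> Cell" "\<phi>2 \<in> Cell" "\<phi>3 \<in> Cell"
    "src u1 = src e0" "trg u1 = src e1" "src g1 = trg e0" "trg g1 = trg e1"
    "src u2 = src e1" "trg u2 = src e2" "src g2 = trg e1" "trg g2 = trg e2"
    "src u3 = src e2" "trg u3 = src e3" "src g3 = trg e2" "trg g3 = trg e3"
    "dm \<phi>1 = g1 \<odot> e0" "dm \<phi>2 = g2 \<odot> e1" "dm \<phi>3 = g3 \<odot> e2"
    "cd \<phi>1 = e1 \<odot> u1" "cd \<phi>2 = e2 \<odot> u2" "cd \<phi>3 = e3 \<odot> u3"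
    using assms by (simp_all add: sq_def)
  note p1 = pentagon[of e0 g1 g2 g3]
  note p2 = pentagon_inv(1)[of u1 e1 g2 g3]
  note p3 = pentagon_inv(2)[of u1 u2 e2 g3]
  note p4 = pentagon[of u1 u2 u3 e3, symmetric]
  show ?thesis
    unfolding paste_def
    by (simp add: whisker nat p1 reassoc2[OF p2] reassoc3[OF p3] reassoc2[OF p4])
qed


text \<open>This is what closes the compatible pairs of 2-cells under horizontal composition. The
  2-cells are pulled through the pasting one square at a time.\<close>

lemma paste_hcompc:
  assumes "sq e0 e1 u1 g1 \<phi>1" "sq e1 e2 u2 g2 \<phi>2" "sq e0 e1 v1 h1 \<psi>1" "sq e1 e2 v2 h2 \<psi>2"
    and "\<mu>1 \<in> cells B u1 v1" "\<mu>2 \<in> cells B u2 v2" "\<beta>1 \<in> cells B g1 h1" "\<beta>2 \<in> cells B g2 h2"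
    and c1: "\<psi>1 \<cdot> (\<beta>1 \<star> \<iota> e0) = (\<iota> e1 \<star> \<mu>1) \<cdot> \<phi>1"
    and c2: "\<psi>2 \<cdot> (\<beta>2 \<star> \<iota> e1) = (\<iota> e2 \<star> \<mu>2) \<cdot> \<phi>2"
  shows "paste e2 e1 e0 v2 v1 h2 h1 \<psi>2 \<psi>1 \<cdot> ((\<beta>2 \<star> \<beta>1) \<star> \<iota> e0)
    = (\<iota> e2 \<star> (\<mu>2 \<star> \<mu>1)) \<cdot> paste e2 e1 e0 u2 u1 g2 g1 \<phi>2 \<phi>1"
proof -
  have [simp]: "e0 \<in> Arr" "e1 \<in> Arr" "e2 \<in> Arr" "u1 \<in> Arr" "u2 \<in> Arr" "v1 \<in> Arr" "v2 \<in> Arr"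
    "g1 \<in> Arr" "g2 \<in> Arr" "h1 \<in> Arr" "h2 \<in> Arr" "\<phi>1 \<in> Cell" "\<phi>2 \<in> Cell" "\<psi>1 \<in> Cell" "\<psi>2 \<in> Cell"
    "src u1 = src e0" "trg u1 = src e1" "src g1 = trg e0" "trg g1 = trg e1"
    "src u2 = src e1" "trg u2 = src e2" "src g2 = trg e1" "trg g2 = trg e2"
    "src v1 = src e0" "trg v1 = src e1" "src h1 = trg e0" "trg h1 = trg e1"
    "src v2 = src e1" "trg v2 = src e2" "src h2 = trg e1" "trg h2 = trg e2"
    "dm \<phi>1 = g1 \<odot> e0" "dm \<phi>2 = g2 \<odot> e1" "cd \<phi>1 = e1 \<odot> u1" "cd \<phi>2 = e2 \<odot> u2"
    "dm \<psi>1 = h1 \<odot> e0" "dm \<psi>2 = h2 \<odot> e1" "cd \<psi>1 = e1 \<odot> v1" "cd \<psi>2 = e2 \<odot> v2"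
    "\<mu>1 \<in> Cell" "\<mu>2 \<in> Cell" "\<beta>1 \<in> Cell" "\<beta>2 \<in> Cell"
    "dm \<mu>1 = u1" "dm \<mu>2 = u2" "dm \<beta>1 = g1" "dm \<beta>2 = g2"
    "cd \<mu>1 = v1" "cd \<mu>2 = v2" "cd \<beta>1 = h1" "cd \<beta>2 = h2"
    using assms(1-8) by (simp_all add: sq_def cells_def)
  have n1: "\<a> h2 h1 e0 \<cdot> ((\<beta>2 \<star> \<beta>1) \<star> \<iota> e0) = (\<beta>2 \<star> \<beta>1 \<star> \<iota> e0) \<cdot> \<a> g2 g1 e0"
    by (simp add: nat)
  have n4: "(\<iota> e2 \<star> \<mu>2 \<star> \<mu>1) \<cdot> \<a> e2 u2 u1 \<cdot> r = \<a> e2 v2 v1 \<cdot> ((\<iota> e2 \<star> \<mu>2) \<star> \<mu>1) \<cdot> r"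
    if "r \<in> Cell" "cd r = (e2 \<odot> u2) \<odot> u1" for r
    using that by (simp add: nat)
  \<comment> \<open>By interchange \<beta>2 slides past, while \<open>c1\<close> carries \<beta>1
    across the first square and leaves \<mu>1; \<open>n3\<close> does the same at the second square
    with \<open>c2\<close>.\<close>
  have "(\<iota> h2 \<star> \<psi>1) \<cdot> (\<beta>2 \<star> \<beta>1 \<star> \<iota> e0) = \<beta>2 \<star> (\<psi>1 \<cdot> (\<beta>1 \<star> \<iota> e0))"
    by (simp add: interchange)
  also have "\<dots> = (\<beta>2 \<star> \<iota> e1 \<star> \<mu>1) \<cdot> (\<iota> g2 \<star> \<phi>1)"
    unfolding c1 by (simp add: interchange)
  finally have n2: "(\<iota> h2 \<star> \<psi>1) \<cdot> (\<beta>2 \<star> \<beta>1 \<star> \<iota> e0) = (\<beta>2 \<star> \<iota> e1 \<star> \<mu>1) \<cdot> (\<iota> g2 \<star> \<phi>1)" .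
  have "(\<psi>2 \<star> \<iota> v1) \<cdot> ((\<beta>2 \<star> \<iota> e1) \<star> \<mu>1) = (\<psi>2 \<cdot> (\<beta>2 \<star> \<iota> e1)) \<star> \<mu>1"
    by (simp add: interchange)
  also have "\<dots> = ((\<iota> e2 \<star> \<mu>2) \<star> \<mu>1) \<cdot> (\<phi>2 \<star> \<iota> u1)"
    unfolding c2 by (simp add: interchange)
  finally have n3: "(\<psi>2 \<star> \<iota> v1) \<cdot> ((\<beta>2 \<star> \<iota> e1) \<star> \<mu>1) = ((\<iota> e2 \<star> \<mu>2) \<star> \<mu>1) \<cdot> (\<phi>2 \<star> \<iota> u1)" .
  show ?thesis
    unfolding paste_def
    by (simp add: n1 n4 reassoc2[OF n2] reassoc2[OF n3] assoc_inv_nat_r)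
qed

text \<open>The triangle removes the right unitor hidden in \<open>unit_sq e'\<close>, and
  \<open>lunit_hcomp\<close>, used at \<open>e' \<odot> u\<close> and at \<open>g \<odot> e\<close>,
  identifies the left unitors; naturality along \<phi> joins the two.\<close>

lemma paste_lunit:
  assumes "sq e e' u g \<phi>"
  shows "\<phi> \<cdot> (\<l> g \<star> \<iota> e) = (\<iota> e' \<star> \<l> u) \<cdot> paste e' e' e (\<one> (src e')) u (\<one> (trg e')) g (unit_sq e') \<phi>"
proof -
  have [simp]: "e \<in> Arr" "e' \<in> Arr" "u \<in> Arr" "g \<in> Arr" "\<phi> \<in> Cell"
    "src u = src e" "trg u = src e'" "src g = trg e" "trg g = trg e'" "dm \<phi> = g \<odot> e" "cd \<phi> = e' \<odot> u"
    using assms by (simp_all add: sq_def)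
  have t: "(\<iota> e' \<star> \<l> u) \<cdot> \<a> e' (\<one> (src e')) u = \<r> e' \<star> \<iota> u"
    using triangle[of u e'] by simp
  have rr: "(\<r> e' \<star> \<iota> u) \<cdot> (invc (\<r> e') \<star> \<iota> u) = \<iota> (e' \<odot> u)"
    by (simp add: interchange)
  have l: "(\<l> e' \<star> \<iota> u) \<cdot> invc (\<a> (\<one> (trg e')) e' u) = \<l> (e' \<odot> u)"
    using lunit_hcomp[of u e', symmetric] by simp
  have l': "\<l> (g \<odot> e) \<cdot> \<a> (\<one> (trg e')) g e = \<l> g \<star> \<iota> e"
    using lunit_hcomp[of e g] by simp
  show ?thesis
    unfolding paste_def unit_sq_def
    by (simp add: whisker reassoc2[OF t] reassoc2[OF rr] reassoc2[OF l] nat l')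
qed

text \<open>Here \<open>runit_hcomp\<close> is used at \<open>e' \<odot> u\<close> and at
  \<open>g \<odot> e\<close>, and the triangle deals with the left unitor of
  \<open>unit_sq e\<close>.\<close>

lemma paste_runit:
  assumes "sq e e' u g \<phi>"
  shows "\<phi> \<cdot> (\<r> g \<star> \<iota> e) = (\<iota> e' \<star> \<r> u) \<cdot> paste e' e e u (\<one> (src e)) g (\<one> (trg e)) \<phi> (unit_sq e)"
proof -
  have [simp]: "e \<in> Arr" "e' \<in> Arr" "u \<in> Arr" "g \<in> Arr" "\<phi> \<in> Cell"
    "src u = src e" "trg u = src e'" "src g = trg e" "trg g = trg e'" "dm \<phi> = g \<odot> e" "cd \<phi> = e' \<odot> u"
    using assms by (simp_all add: sq_def)
  have t: "(\<iota> g \<star> \<l> e) \<cdot> \<a> g (\<one> (trg e)) e = \<r> g \<star> \<iota> e"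
    using triangle[of e g] by simp
  have r: "(\<iota> e' \<star> \<r> u) \<cdot> \<a> e' u (\<one> (src e)) = \<r> (e' \<odot> u)"
    using runit_hcomp[of u e'] by simp
  have "\<r> (g \<odot> e) \<cdot> invc (\<a> g e (\<one> (src e))) = \<iota> g \<star> \<r> e"
    using runit_hcomp[of e g, symmetric] by simp
  moreover have "(\<iota> g \<star> \<r> e) \<cdot> (\<iota> g \<star> invc (\<r> e)) = \<iota> (g \<odot> e)"
    by (simp add: interchange)
  ultimately have r': "\<r> (g \<odot> e) \<cdot> invc (\<a> g e (\<one> (src e))) \<cdot> (\<iota> g \<star> invc (\<r> e)) = \<iota> (g \<odot> e)"
    by (subst reassoc2) simp_all
  show ?thesis
    unfolding paste_def unit_sq_def
    by (simp add: whisker reassoc2[OF r] nat reassoc3[OF r'] t)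
qed

end

section \<open>Equivalences in a bicategory\<close>

lemma in_hom: "f \<in> hom B a b \<longleftrightarrow> f \<in> b_arr B \<and> b_src B f = a \<and> b_trg B f = b"
  by (simp add: hom_def)

lemma in_cells: "\<alpha> \<in> cells B f g \<longleftrightarrow> \<alpha> \<in> b_cell B \<and> b_dom B \<alpha> = f \<and> b_cod B \<alpha> = g"
  by (simp add: cells_def)

context bicat
begin

definition isomorphic where
  "isomorphic f g \<longleftrightarrow> (\<exists>\<alpha> \<in> cells B f g. isoc \<alpha>)"

lemma isomorphicI: "isoc \<alpha> \<Longrightarrow> dm \<alpha> = f \<Longrightarrow> cd \<alpha> = g \<Longrightarrow> isomorphic f g"
  unfolding isomorphic_def by (rule bexI[of _ \<alpha>]) (simp_all add: in_cells iso_cell)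

lemma isomorphicE:
  assumes "isomorphic f g"
  obtains \<alpha> where "isoc \<alpha>" "\<alpha> \<in> Cell" "dm \<alpha> = f" "cd \<alpha> = g"
  using assms by (auto simp: isomorphic_def in_cells)

lemma isomorphic_sym:
  assumes "isomorphic f g" shows "isomorphic g f"
proof -
  obtain \<alpha> where "isoc \<alpha>" "dm \<alpha> = f" "cd \<alpha> = g" using assms by (rule isomorphicE)
  then show ?thesis by (intro isomorphicI[of "invc \<alpha>"]) simp_all
qed

lemma isomorphic_trans:
  assumes "isomorphic f g" "isomorphic g h" shows "isomorphic f h"
proof -
  obtain \<alpha> where "isoc \<alpha>" "\<alpha> \<in> Cell" "dm \<alpha> = f" "cd \<alpha> = g" using assms(1) by (rule isomorphicE)
  moreover obtain \<beta> where "isoc \<beta>" "\<beta> \<in> Cell" "dm \<beta> = g" "cd \<beta> = h" using assms(2) by (rule isomorphicE)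
  ultimately show ?thesis by (intro isomorphicI[of "\<beta> \<cdot> \<alpha>"]) simp_all
qed

text \<open>No triangle identities are demanded of the two isomorphisms: the consequences drawn are
  that whiskering with \<open>e\<close> is fully faithful and essentially surjective, and plain
  invertibility gives these.\<close>

definition quasi_inverse where
  "quasi_inverse e d \<longleftrightarrow> e \<in> Arr \<and> d \<in> Arr \<and> src d = trg e \<and> trg d = src e \<and>
     isomorphic (d \<odot> e) (\<one> (src e)) \<and> isomorphic (e \<odot> d) (\<one> (trg e))"

definition equivalence where
  "equivalence e \<longleftrightarrow> (\<exists>d. quasi_inverse e d)"

lemma quasi_inverse_sym: "quasi_inverse e d \<Longrightarrow> quasi_inverse d e"
  by (simp add: quasi_inverse_def)

lemma equivalence_arr: "equivalence e \<Longrightarrow> e \<in> Arr"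
  by (auto simp: equivalence_def quasi_inverse_def)

lemma equivalence_ide: "a \<in> Obj \<Longrightarrow> equivalence (\<one> a)"
  unfolding equivalence_def quasi_inverse_def
  by (rule exI[of _ "\<one> a"]) (auto intro!: isomorphicI[of "\<l> (\<one> a)"])

text \<open>The natural family \<theta> says that whiskering with \<open>e\<close> and then with
  \<open>d\<close> is isomorphic to the identity functor, so whiskering with \<open>e\<close> has a
  one-sided inverse up to isomorphism.\<close>

lemma retract_left:
  assumes "quasi_inverse e d"
  obtains \<theta> where "\<And>u. u \<in> Arr \<Longrightarrow> trg u = src e \<Longrightarrow> \<theta> u \<in> Cell \<and> isoc (\<theta> u) \<and> dm (\<theta> u) = d \<odot> e \<odot> u \<and> cd (\<theta> u) = u"
    "\<And>\<alpha>. \<alpha> \<in> Cell \<Longrightarrow> trg (dm \<alpha>) = src e \<Longrightarrow> \<theta> (cd \<alpha>) \<cdot> (\<iota> d \<star> \<iota> e \<star> \<alpha>) = \<alpha> \<cdot> \<theta> (dm \<alpha>)"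
proof -
  obtain \<eta> where [simp]: "\<eta> \<in> Cell" "dm \<eta> = d \<odot> e" "cd \<eta> = \<one> (src e)" "isoc \<eta>"
    and [simp]: "e \<in> Arr" "d \<in> Arr" "src d = trg e" "trg d = src e"
    using assms by (auto simp: quasi_inverse_def isomorphic_def in_cells)
  define \<theta> where "\<theta> u = \<l> u \<cdot> (\<eta> \<star> \<iota> u) \<cdot> invc (\<a> d e u)" for u
  have t: "\<theta> u \<in> Cell \<and> isoc (\<theta> u) \<and> dm (\<theta> u) = d \<odot> e \<odot> u \<and> cd (\<theta> u) = u" if "u \<in> Arr" "trg u = src e" for u
    using that by (simp add: \<theta>_def)
  have n: "\<theta> (cd \<alpha>) \<cdot> (\<iota> d \<star> \<iota> e \<star> \<alpha>) = \<alpha> \<cdot> \<theta> (dm \<alpha>)" if [simp]: "\<alpha> \<in> Cell" "trg (dm \<alpha>) = src e" for \<alpha>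
  proof -
    have 1: "(\<eta> \<star> \<iota> (cd \<alpha>)) \<cdot> (\<iota> (d \<odot> e) \<star> \<alpha>) = (\<iota> (\<one> (src e)) \<star> \<alpha>) \<cdot> (\<eta> \<star> \<iota> (dm \<alpha>))"
      by (simp add: interchange)
    show ?thesis
      by (simp add: \<theta>_def assoc_inv_nat reassoc2[OF 1] nat)
  qed
  show ?thesis by (rule that[of \<theta>]) (use t n in auto)
qed

lemma retract_right:
  assumes "quasi_inverse e d"
  obtains \<theta> where "\<And>u. u \<in> Arr \<Longrightarrow> src u = trg e \<Longrightarrow> \<theta> u \<in> Cell \<and> isoc (\<theta> u) \<and> dm (\<theta> u) = (u \<odot> e) \<odot> d \<and> cd (\<theta> u) = u"
    "\<And>\<alpha>. \<alpha> \<in> Cell \<Longrightarrow> src (dm \<alpha>) = trg e \<Longrightarrow> \<theta> (cd \<alpha>) \<cdot> ((\<alpha> \<star> \<iota> e) \<star> \<iota> d) = \<alpha> \<cdot> \<theta> (dm \<alpha>)"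
proof -
  obtain \<epsilon> where [simp]: "\<epsilon> \<in> Cell" "dm \<epsilon> = e \<odot> d" "cd \<epsilon> = \<one> (trg e)" "isoc \<epsilon>"
    and [simp]: "e \<in> Arr" "d \<in> Arr" "src d = trg e" "trg d = src e"
    using assms by (auto simp: quasi_inverse_def isomorphic_def in_cells)
  define \<theta> where "\<theta> u = \<r> u \<cdot> (\<iota> u \<star> \<epsilon>) \<cdot> \<a> u e d" for u
  have t: "\<theta> u \<in> Cell \<and> isoc (\<theta> u) \<and> dm (\<theta> u) = (u \<odot> e) \<odot> d \<and> cd (\<theta> u) = u" if "u \<in> Arr" "src u = trg e" for u
    using that by (simp add: \<theta>_def)
  have n: "\<theta> (cd \<alpha>) \<cdot> ((\<alpha> \<star> \<iota> e) \<star> \<iota> d) = \<alpha> \<cdot> \<theta> (dm \<alpha>)" if [simp]: "\<alpha> \<in> Cell" "src (dm \<alpha>) = trg e" for \<alpha>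
  proof -
    have 1: "(\<iota> (cd \<alpha>) \<star> \<epsilon>) \<cdot> (\<alpha> \<star> \<iota> (e \<odot> d)) = (\<alpha> \<star> \<iota> (\<one> (trg e))) \<cdot> (\<iota> (dm \<alpha>) \<star> \<epsilon>)"
      by (simp add: interchange)
    have 2: "\<a> (cd \<alpha>) e d \<cdot> ((\<alpha> \<star> \<iota> e) \<star> \<iota> d) = (\<alpha> \<star> \<iota> (e \<odot> d)) \<cdot> \<a> (dm \<alpha>) e d"
      by (simp add: nat)
    show ?thesis
      by (simp add: \<theta>_def 2 reassoc2[OF 1] runit_nat_r)
  qed
  show ?thesis by (rule that[of \<theta>]) (use t n in auto)
qed

text \<open>Conjugation with \<theta> recovers \<alpha> from
  \<open>\<iota> d \<star> \<iota> e \<star> \<alpha>\<close>.\<close>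

lemma whisker_faithful_left:
  assumes "equivalence e" "\<alpha> \<in> cells B u v" "\<beta> \<in> cells B u v" "trg u = src e" "\<iota> e \<star> \<alpha> = \<iota> e \<star> \<beta>"
  shows "\<alpha> = \<beta>"
proof -
  obtain d where "quasi_inverse e d" using assms by (auto simp: equivalence_def)
  from retract_left[OF this] obtain \<theta> where
    t: "\<And>u. u \<in> Arr \<Longrightarrow> trg u = src e \<Longrightarrow> \<theta> u \<in> Cell \<and> isoc (\<theta> u) \<and> dm (\<theta> u) = d \<odot> e \<odot> u \<and> cd (\<theta> u) = u"
    and n: "\<And>\<alpha>. \<alpha> \<in> Cell \<Longrightarrow> trg (dm \<alpha>) = src e \<Longrightarrow> \<theta> (cd \<alpha>) \<cdot> (\<iota> d \<star> \<iota> e \<star> \<alpha>) = \<alpha> \<cdot> \<theta> (dm \<alpha>)"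
    by blast
  have [simp]: "\<alpha> \<in> Cell" "\<beta> \<in> Cell" "dm \<alpha> = u" "dm \<beta> = u" "cd \<alpha> = v" "cd \<beta> = v" "u \<in> Arr"
    using assms(2,3) by (auto simp: in_cells)
  show ?thesis
    by (rule iso_cancel_right[of "\<theta> u"]) (use t[of u] n[of \<alpha>] n[of \<beta>] assms(4,5) in auto)
qed

lemma whisker_faithful_right:
  assumes "equivalence e" "\<alpha> \<in> cells B u v" "\<beta> \<in> cells B u v" "src u = trg e" "\<alpha> \<star> \<iota> e = \<beta> \<star> \<iota> e"
  shows "\<alpha> = \<beta>"
proof -
  obtain d where "quasi_inverse e d" using assms by (auto simp: equivalence_def)
  from retract_right[OF this] obtain \<theta> where
    t: "\<And>u. u \<in> Arr \<Longrightarrow> src u = trg e \<Longrightarrow> \<theta> u \<in> Cell \<and> isoc (\<theta> u) \<and> dm (\<theta> u) = (u \<odot> e) \<odot> d \<and> cd (\<theta> u) = u"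
    and n: "\<And>\<alpha>. \<alpha> \<in> Cell \<Longrightarrow> src (dm \<alpha>) = trg e \<Longrightarrow> \<theta> (cd \<alpha>) \<cdot> ((\<alpha> \<star> \<iota> e) \<star> \<iota> d) = \<alpha> \<cdot> \<theta> (dm \<alpha>)"
    by blast
  have [simp]: "\<alpha> \<in> Cell" "\<beta> \<in> Cell" "dm \<alpha> = u" "dm \<beta> = u" "cd \<alpha> = v" "cd \<beta> = v" "u \<in> Arr"
    using assms(2,3) by (auto simp: in_cells)
  show ?thesis
    by (rule iso_cancel_right[of "\<theta> u"]) (use t[of u] n[of \<alpha>] n[of \<beta>] assms(4,5) in auto)
qed

text \<open>Fullness: transport \<open>\<gamma>\<close> along the retraction, then cancel the quasi-inverse, which is itself an equivalence.\<close>

lemma whisker_full_left: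
  assumes "equivalence e" "\<gamma> \<in> cells B (e \<odot> u) (e \<odot> v)" "u \<in> Arr" "v \<in> Arr" "trg u = src e" "trg v = src e" "src u = src v"
  obtains \<alpha> where "\<alpha> \<in> cells B u v" "\<iota> e \<star> \<alpha> = \<gamma>" "isoc \<gamma> \<Longrightarrow> isoc \<alpha>"
proof -
  obtain d where d: "quasi_inverse e d" using assms by (auto simp: equivalence_def)
  have [simp]: "e \<in> Arr" "d \<in> Arr" "src d = trg e" "trg d = src e" using d by (auto simp: quasi_inverse_def)
  from retract_left[OF d] obtain \<theta> where
    t: "\<And>u. u \<in> Arr \<Longrightarrow> trg u = src e \<Longrightarrow> \<theta> u \<in> Cell \<and> isoc (\<theta> u) \<and> dm (\<theta> u) = d \<odot> e \<odot> u \<and> cd (\<theta> u) = u"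
    and n: "\<And>\<alpha>. \<alpha> \<in> Cell \<Longrightarrow> trg (dm \<alpha>) = src e \<Longrightarrow> \<theta> (cd \<alpha>) \<cdot> (\<iota> d \<star> \<iota> e \<star> \<alpha>) = \<alpha> \<cdot> \<theta> (dm \<alpha>)"
    by blast
  have [simp]: "\<gamma> \<in> Cell" "dm \<gamma> = e \<odot> u" "cd \<gamma> = e \<odot> v" using assms(2) by (auto simp: in_cells)
  note [simp] = assms(3-) and tu [simp] = t[of u, OF assms(3,5)] and tv [simp] = t[of v, OF assms(4,6)]
  let ?\<alpha> = "\<theta> v \<cdot> (\<iota> d \<star> \<gamma>) \<cdot> invc (\<theta> u)"
  have a [simp]: "?\<alpha> \<in> Cell" "dm ?\<alpha> = u" "cd ?\<alpha> = v" by simp_all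
  have "\<theta> v \<cdot> (\<iota> d \<star> \<iota> e \<star> ?\<alpha>) = \<theta> v \<cdot> (\<iota> d \<star> \<gamma>)"
    using n[of ?\<alpha>] by simp
  then have "\<iota> d \<star> \<iota> e \<star> ?\<alpha> = \<iota> d \<star> \<gamma>"
    by (rule iso_cancel_left[of "\<theta> v", rotated -1]) simp_all
  then have "\<iota> e \<star> ?\<alpha> = \<gamma>"
    by (rule whisker_faithful_left[of d _ "e \<odot> u" "e \<odot> v", rotated -1])
       (use d in \<open>auto simp: in_cells equivalence_def intro: quasi_inverse_sym\<close>)
  moreover have "isoc ?\<alpha>" if "isoc \<gamma>" using that by simp
  ultimately show ?thesis using that[of ?\<alpha>] a by (simp add: in_cells)
qed

lemma whisker_full_right:
  assumes "equivalence e" "\<gamma> \<in> cells B (u \<odot> e) (v \<odot> e)" "u \<in> Arr" "v \<in> Arr" "src u = trg e" "src v = trg e" "trg u = trg v"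
  obtains \<alpha> where "\<alpha> \<in> cells B u v" "\<alpha> \<star> \<iota> e = \<gamma>"
proof -
  obtain d where d: "quasi_inverse e d" using assms by (auto simp: equivalence_def)
  have [simp]: "e \<in> Arr" "d \<in> Arr" "src d = trg e" "trg d = src e" using d by (auto simp: quasi_inverse_def)
  from retract_right[OF d] obtain \<theta> where
    t: "\<And>u. u \<in> Arr \<Longrightarrow> src u = trg e \<Longrightarrow> \<theta> u \<in> Cell \<and> isoc (\<theta> u) \<and> dm (\<theta> u) = (u \<odot> e) \<odot> d \<and> cd (\<theta> u) = u"
    and n: "\<And>\<alpha>. \<alpha> \<in> Cell \<Longrightarrow> src (dm \<alpha>) = trg e \<Longrightarrow> \<theta> (cd \<alpha>) \<cdot> ((\<alpha> \<star> \<iota> e) \<star> \<iota> d) = \<alpha> \<cdot> \<theta> (dm \<alpha>)"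
    by blast
  have [simp]: "\<gamma> \<in> Cell" "dm \<gamma> = u \<odot> e" "cd \<gamma> = v \<odot> e" using assms(2) by (auto simp: in_cells)
  note [simp] = assms(3-) and tu [simp] = t[of u, OF assms(3,5)] and tv [simp] = t[of v, OF assms(4,6)]
  let ?\<alpha> = "\<theta> v \<cdot> (\<gamma> \<star> \<iota> d) \<cdot> invc (\<theta> u)"
  have a [simp]: "?\<alpha> \<in> Cell" "dm ?\<alpha> = u" "cd ?\<alpha> = v" by simp_all
  have "\<theta> v \<cdot> ((?\<alpha> \<star> \<iota> e) \<star> \<iota> d) = \<theta> v \<cdot> (\<gamma> \<star> \<iota> d)"
    using n[of ?\<alpha>] by simp
  then have "(?\<alpha> \<star> \<iota> e) \<star> \<iota> d = \<gamma> \<star> \<iota> d"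
    by (rule iso_cancel_left[of "\<theta> v", rotated -1]) simp_all
  then have "?\<alpha> \<star> \<iota> e = \<gamma>"
    by (rule whisker_faithful_right[of d _ "u \<odot> e" "v \<odot> e", rotated -1])
       (use d in \<open>auto simp: in_cells equivalence_def intro: quasi_inverse_sym\<close>)
  then show ?thesis using that[of ?\<alpha>] a by (simp add: in_cells)
qed

text \<open>The lift is \<open>d \<odot> w\<close>; the retraction of the swapped pair, in which
  \<open>e\<close> is the quasi-inverse of \<open>d\<close>, supplies the isomorphism back to
  \<open>w\<close>.\<close>

lemma equivalence_lift_left:
  assumes "equivalence e" "w \<in> Arr" "trg w = trg e"
  obtains u where "u \<in> Arr" "src u = src w" "trg u = src e" "isomorphic (e \<odot> u) w"
proof -
  obtain d where d: "quasi_inverse e d" using assms by (auto simp: equivalence_def)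
  have [simp]: "e \<in> Arr" "d \<in> Arr" "src d = trg e" "trg d = src e" using d by (auto simp: quasi_inverse_def)
  from retract_left[OF quasi_inverse_sym[OF d]] obtain \<theta> where
    "\<And>u. u \<in> Arr \<Longrightarrow> trg u = src d \<Longrightarrow> \<theta> u \<in> Cell \<and> isoc (\<theta> u) \<and> dm (\<theta> u) = e \<odot> d \<odot> u \<and> cd (\<theta> u) = u"
    by blast
  from this[of w] show ?thesis using that[of "d \<odot> w"] assms by (auto intro: isomorphicI)
qed

lemma equivalence_lift_right:
  assumes "equivalence e" "w \<in> Arr" "src w = src e"
  obtains u where "u \<in> Arr" "src u = trg e" "trg u = trg w" "isomorphic (u \<odot> e) w"
proof -
  obtain d where d: "quasi_inverse e d" using assms by (auto simp: equivalence_def)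
  have [simp]: "e \<in> Arr" "d \<in> Arr" "src d = trg e" "trg d = src e" using d by (auto simp: quasi_inverse_def)
  from retract_right[OF quasi_inverse_sym[OF d]] obtain \<theta> where
    "\<And>u. u \<in> Arr \<Longrightarrow> src u = trg d \<Longrightarrow> \<theta> u \<in> Cell \<and> isoc (\<theta> u) \<and> dm (\<theta> u) = (u \<odot> d) \<odot> e \<and> cd (\<theta> u) = u"
    by blast
  from this[of w] show ?thesis using that[of "w \<odot> d"] assms by (auto intro: isomorphicI)
qed

end

section \<open>Pseudofunctors\<close>

text \<open>Later proofs refer to the premises by position: 8 is naturality of
  \<open>pf_cmp\<close>, 11 its associativity coherence, 12 and 13 are the unit coherences.\<close>

lemma pseudofunctorI:
  assumes "\<And>a. a \<in> b_obj A \<Longrightarrow> pf_obj F a \<in> b_obj B"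
    and "\<And>f. f \<in> b_arr A \<Longrightarrow> pf_arr F f \<in> hom B (pf_obj F (b_src A f)) (pf_obj F (b_trg A f))"
    and "\<And>\<alpha>. \<alpha> \<in> b_cell A \<Longrightarrow> pf_cell F \<alpha> \<in> cells B (pf_arr F (b_dom A \<alpha>)) (pf_arr F (b_cod A \<alpha>))"
    and "\<And>f. f \<in> b_arr A \<Longrightarrow> pf_cell F (\<iota>\<^bsub>A\<^esub> f) = \<iota>\<^bsub>B\<^esub> (pf_arr F f)"
    and "\<And>\<alpha> \<beta>. \<alpha> \<in> b_cell A \<Longrightarrow> \<beta> \<in> b_cell A \<Longrightarrow> b_cod A \<alpha> = b_dom A \<beta> \<Longrightarrow>
      pf_cell F (\<beta> \<cdot>\<^bsub>A\<^esub> \<alpha>) = pf_cell F \<beta> \<cdot>\<^bsub>B\<^esub> pf_cell F \<alpha>"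
    and "\<And>f g. f \<in> b_arr A \<Longrightarrow> g \<in> b_arr A \<Longrightarrow> b_trg A f = b_src A g \<Longrightarrow>
      pf_cmp F g f \<in> cells B (pf_arr F g \<odot>\<^bsub>B\<^esub> pf_arr F f) (pf_arr F (g \<odot>\<^bsub>A\<^esub> f))"
    and "\<And>f g. f \<in> b_arr A \<Longrightarrow> g \<in> b_arr A \<Longrightarrow> b_trg A f = b_src A g \<Longrightarrow> iso2 B (pf_cmp F g f)"
    and "\<And>\<alpha> \<beta>. \<alpha> \<in> b_cell A \<Longrightarrow> \<beta> \<in> b_cell A \<Longrightarrow> b_trg A (b_dom A \<alpha>) = b_src A (b_dom A \<beta>) \<Longrightarrow>
      pf_cell F (\<beta> \<star>\<^bsub>A\<^esub> \<alpha>) \<cdot>\<^bsub>B\<^esub> pf_cmp F (b_dom A \<beta>) (b_dom A \<alpha>) =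
      pf_cmp F (b_cod A \<beta>) (b_cod A \<alpha>) \<cdot>\<^bsub>B\<^esub> (pf_cell F \<beta> \<star>\<^bsub>B\<^esub> pf_cell F \<alpha>)"
    and "\<And>a. a \<in> b_obj A \<Longrightarrow> pf_unit F a \<in> cells B (\<one>\<^bsub>B\<^esub> (pf_obj F a)) (pf_arr F (\<one>\<^bsub>A\<^esub> a))"
    and "\<And>a. a \<in> b_obj A \<Longrightarrow> iso2 B (pf_unit F a)"
    and "\<And>f g h. f \<in> b_arr A \<Longrightarrow> g \<in> b_arr A \<Longrightarrow> h \<in> b_arr A \<Longrightarrow> b_trg A f = b_src A g \<Longrightarrow> b_trg A g = b_src A h \<Longrightarrow>
      pf_cell F (\<a>\<^bsub>A\<^esub> h g f) \<cdot>\<^bsub>B\<^esub> pf_cmp F (h \<odot>\<^bsub>A\<^esub> g) f \<cdot>\<^bsub>B\<^esub> (pf_cmp F h g \<star>\<^bsub>B\<^esub> \<iota>\<^bsub>B\<^esub> (pf_arr F f)) =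
      pf_cmp F h (g \<odot>\<^bsub>A\<^esub> f) \<cdot>\<^bsub>B\<^esub> (\<iota>\<^bsub>B\<^esub> (pf_arr F h) \<star>\<^bsub>B\<^esub> pf_cmp F g f) \<cdot>\<^bsub>B\<^esub>
        \<a>\<^bsub>B\<^esub> (pf_arr F h) (pf_arr F g) (pf_arr F f)"
    and "\<And>f. f \<in> b_arr A \<Longrightarrow> pf_cell F (\<l>\<^bsub>A\<^esub> f) \<cdot>\<^bsub>B\<^esub> pf_cmp F (\<one>\<^bsub>A\<^esub> (b_trg A f)) f \<cdot>\<^bsub>B\<^esub>
      (pf_unit F (b_trg A f) \<star>\<^bsub>B\<^esub> \<iota>\<^bsub>B\<^esub> (pf_arr F f)) = \<l>\<^bsub>B\<^esub> (pf_arr F f)"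
    and "\<And>f. f \<in> b_arr A \<Longrightarrow> pf_cell F (\<r>\<^bsub>A\<^esub> f) \<cdot>\<^bsub>B\<^esub> pf_cmp F f (\<one>\<^bsub>A\<^esub> (b_src A f)) \<cdot>\<^bsub>B\<^esub>
      (\<iota>\<^bsub>B\<^esub> (pf_arr F f) \<star>\<^bsub>B\<^esub> pf_unit F (b_src A f)) = \<r>\<^bsub>B\<^esub> (pf_arr F f)"
  shows "pseudofunctor A B F"
  unfolding pseudofunctor_def by (intro conjI ballI impI; (elim conjE)?; rule assms; assumption)

locale psfunctor = A: bicat A + B: bicat B
  for A :: "('ao, 'am, 'ac) bicat" and B :: "('bo, 'bm, 'bc) bicat" (structure) +
  fixes F :: "('ao, 'am, 'ac, 'bo, 'bm, 'bc) psfun"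
  assumes pseudofunctor: "pseudofunctor A B F"
begin

context
begin

private lemmas axs0 = pseudofunctor[unfolded pseudofunctor_def]
private lemmas ax_obj = axs0[THEN conjunct1, rule_format]
private lemmas axs1 = axs0[THEN conjunct2]
private lemmas ax_arr = axs1[THEN conjunct1, rule_format]
private lemmas axs2 = axs1[THEN conjunct2]
private lemmas ax_cell = axs2[THEN conjunct1, rule_format]
private lemmas axs3 = axs2[THEN conjunct2]
private lemmas ax_idc = axs3[THEN conjunct1, rule_format]
private lemmas axs4 = axs3[THEN conjunct2]
private lemmas ax_vcomp = axs4[THEN conjunct1, rule_format]
private lemmas axs5 = axs4[THEN conjunct2]
private lemmas ax_cmp = axs5[THEN conjunct1, rule_format]
private lemmas axs6 = axs5[THEN conjunct2]
private lemmas ax_cmp_nat = axs6[THEN conjunct1, rule_format]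
private lemmas axs7 = axs6[THEN conjunct2]
private lemmas ax_unit = axs7[THEN conjunct1, rule_format]
private lemmas axs8 = axs7[THEN conjunct2]
private lemmas ax_assoc = axs8[THEN conjunct1, rule_format]
private lemmas axs9 = axs8[THEN conjunct2]
private lemmas ax_lunit = axs9[THEN conjunct1, rule_format]
private lemmas ax_runit = axs9[THEN conjunct2, rule_format]

lemma F_obj [simp]: "a \<in> A.Obj \<Longrightarrow> pf_obj F a \<in> B.Obj"
  by (rule ax_obj)

lemma F_arr [simp]:
  assumes "f \<in> A.Arr"
  shows "pf_arr F f \<in> B.Arr" "B.src (pf_arr F f) = pf_obj F (A.src f)" "B.trg (pf_arr F f) = pf_obj F (A.trg f)"
  using ax_arr[OF assms] by (auto simp: in_hom)

lemma F_cell [simp]: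
  assumes "\<alpha> \<in> A.Cell"
  shows "pf_cell F \<alpha> \<in> B.Cell" "B.dm (pf_cell F \<alpha>) = pf_arr F (A.dm \<alpha>)" "B.cd (pf_cell F \<alpha>) = pf_arr F (A.cd \<alpha>)"
  using ax_cell[OF assms] by (auto simp: in_cells)

lemma F_idc [simp]: "f \<in> A.Arr \<Longrightarrow> pf_cell F (\<iota>\<^bsub>A\<^esub> f) = \<iota> (pf_arr F f)"
  by (rule ax_idc)

lemma F_vcomp [simp]:
  assumes "\<alpha> \<in> A.Cell" "\<beta> \<in> A.Cell" "A.cd \<alpha> = A.dm \<beta>"
  shows "pf_cell F (\<beta> \<cdot>\<^bsub>A\<^esub> \<alpha>) = pf_cell F \<beta> \<cdot> pf_cell F \<alpha>"
  by (rule ax_vcomp[OF assms])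

lemma F_cmp [simp]:
  assumes "f \<in> A.Arr" "g \<in> A.Arr" "A.trg f = A.src g"
  shows "pf_cmp F g f \<in> B.Cell" "B.dm (pf_cmp F g f) = pf_arr F g \<odot> pf_arr F f"
    "B.cd (pf_cmp F g f) = pf_arr F (g \<odot>\<^bsub>A\<^esub> f)" "B.isoc (pf_cmp F g f)"
  using ax_cmp[OF assms] by (auto simp: in_cells)

lemma F_cmp_nat:
  assumes "\<alpha> \<in> A.Cell" "\<beta> \<in> A.Cell" "A.dm \<alpha> = f" "A.dm \<beta> = g" "A.trg f = A.src g"
  shows "pf_cell F (\<beta> \<star>\<^bsub>A\<^esub> \<alpha>) \<cdot> pf_cmp F g f = pf_cmp F (A.cd \<beta>) (A.cd \<alpha>) \<cdot> (pf_cell F \<beta> \<star> pf_cell F \<alpha>)"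
  using ax_cmp_nat[OF assms(1,2)] assms(3-) by simp

lemma F_unit [simp]:
  assumes "a \<in> A.Obj"
  shows "pf_unit F a \<in> B.Cell" "B.dm (pf_unit F a) = \<one> (pf_obj F a)"
    "B.cd (pf_unit F a) = pf_arr F (\<one>\<^bsub>A\<^esub> a)" "B.isoc (pf_unit F a)"
  using ax_unit[OF assms] by (auto simp: in_cells)

lemma F_assoc:
  assumes "f \<in> A.Arr" "g \<in> A.Arr" "h \<in> A.Arr" "A.trg f = A.src g" "A.trg g = A.src h"
  shows "pf_cell F (\<a>\<^bsub>A\<^esub> h g f) \<cdot> pf_cmp F (h \<odot>\<^bsub>A\<^esub> g) f \<cdot> (pf_cmp F h g \<star> \<iota> (pf_arr F f)) =
    pf_cmp F h (g \<odot>\<^bsub>A\<^esub> f) \<cdot> (\<iota> (pf_arr F h) \<star> pf_cmp F g f) \<cdot> \<a> (pf_arr F h) (pf_arr F g) (pf_arr F f)"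
  using ax_assoc[OF assms(1-3)] assms(4-) by simp

lemma F_lunit:
  assumes "f \<in> A.Arr" "A.trg f = b"
  shows "pf_cell F (\<l>\<^bsub>A\<^esub> f) \<cdot> pf_cmp F (\<one>\<^bsub>A\<^esub> b) f \<cdot> (pf_unit F b \<star> \<iota> (pf_arr F f)) = \<l> (pf_arr F f)"
  using ax_lunit assms by auto

lemma F_runit:
  assumes "f \<in> A.Arr" "A.src f = a"
  shows "pf_cell F (\<r>\<^bsub>A\<^esub> f) \<cdot> pf_cmp F f (\<one>\<^bsub>A\<^esub> a) \<cdot> (\<iota> (pf_arr F f) \<star> pf_unit F a) = \<r> (pf_arr F f)"
  using ax_runit assms by auto

end

lemma F_iso [simp]:
  assumes "A.isoc \<alpha>" shows "B.isoc (pf_cell F \<alpha>)"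
proof (rule B.isoI)
  have [simp]: "\<alpha> \<in> A.Cell" using assms by (rule A.iso_cell)
  show "pf_cell F (A.invc \<alpha>) \<cdot> pf_cell F \<alpha> = \<iota> (B.dm (pf_cell F \<alpha>))"
    using F_vcomp[of \<alpha> "A.invc \<alpha>"] assms by simp
  show "pf_cell F \<alpha> \<cdot> pf_cell F (A.invc \<alpha>) = \<iota> (B.cd (pf_cell F \<alpha>))"
    using F_vcomp[of "A.invc \<alpha>" \<alpha>] assms by simp
qed (use assms A.iso_cell in auto)

end

locale psfunctor_comp = F: psfunctor A B F + G: psfunctor B C G
  for A :: "('ao, 'am, 'ac) bicat" and B :: "('bo, 'bm, 'bc) bicat" and C :: "('co, 'cm, 'cc) bicat" (structure)
    and F :: "('ao, 'am, 'ac, 'bo, 'bm, 'bc) psfun" and G :: "('bo, 'bm, 'bc, 'co, 'cm, 'cc) psfun"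
begin

lemma pseudofunctor_comp: "pseudofunctor A C (pf_comp C G F)"
proof (rule pseudofunctorI, goal_cases)
  case (8 \<alpha> \<beta>)
  note [simp] = this
  have "pf_cell G (pf_cell F (\<beta> \<star>\<^bsub>A\<^esub> \<alpha>)) \<cdot> pf_cell G (pf_cmp F (b_dom A \<beta>) (b_dom A \<alpha>)) =
    pf_cell G (pf_cmp F (b_cod A \<beta>) (b_cod A \<alpha>)) \<cdot> pf_cell G (pf_cell F \<beta> \<star>\<^bsub>B\<^esub> pf_cell F \<alpha>)"
    by (simp add: G.F_vcomp[symmetric] F.F_cmp_nat del: G.F_vcomp)
  from G.B.reassoc2[OF this] show ?case
    by (simp add: pf_comp_def G.F_cmp_nat)
next
  case (11 f g h)
  note [simp] = this
  have 1: "pf_cmp G (pf_arr F (h \<odot>\<^bsub>A\<^esub> g)) (pf_arr F f) \<cdot> (pf_cell G (pf_cmp F h g) \<star> \<iota> (pf_arr G (pf_arr F f)))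
    = pf_cell G (pf_cmp F h g \<star>\<^bsub>B\<^esub> \<iota>\<^bsub>B\<^esub> (pf_arr F f)) \<cdot> pf_cmp G (pf_arr F h \<odot>\<^bsub>B\<^esub> pf_arr F g) (pf_arr F f)"
    by (simp add: G.F_cmp_nat)
  have 2: "pf_cell G (pf_cell F (\<a>\<^bsub>A\<^esub> h g f)) \<cdot> pf_cell G (pf_cmp F (h \<odot>\<^bsub>A\<^esub> g) f) \<cdot> pf_cell G (pf_cmp F h g \<star>\<^bsub>B\<^esub> \<iota>\<^bsub>B\<^esub> (pf_arr F f))
    = pf_cell G (pf_cmp F h (g \<odot>\<^bsub>A\<^esub> f)) \<cdot> pf_cell G (\<iota>\<^bsub>B\<^esub> (pf_arr F h) \<star>\<^bsub>B\<^esub> pf_cmp F g f) \<cdot>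
       pf_cell G (\<a>\<^bsub>B\<^esub> (pf_arr F h) (pf_arr F g) (pf_arr F f))"
    by (simp add: G.F_vcomp[symmetric] F.F_assoc del: G.F_vcomp)
  note 3 = G.F_assoc[of "pf_arr F f" "pf_arr F g" "pf_arr F h"]
  have 4: "pf_cell G (\<iota>\<^bsub>B\<^esub> (pf_arr F h) \<star>\<^bsub>B\<^esub> pf_cmp F g f) \<cdot> pf_cmp G (pf_arr F h) (pf_arr F g \<odot>\<^bsub>B\<^esub> pf_arr F f) =
    pf_cmp G (pf_arr F h) (pf_arr F (g \<odot>\<^bsub>A\<^esub> f)) \<cdot> (\<iota> (pf_arr G (pf_arr F h)) \<star> pf_cell G (pf_cmp F g f))"
    by (simp add: G.F_cmp_nat)
  show ?case
    by (simp add: pf_comp_def G.B.whisker G.B.reassoc2[OF 1] G.B.reassoc3[OF 2] 3 G.B.reassoc2[OF 4])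
next
  case (12 f)
  note [simp] = this
  let ?b = "b_trg A f"
  have 1: "pf_cmp G (pf_arr F (\<one>\<^bsub>A\<^esub> ?b)) (pf_arr F f) \<cdot> (pf_cell G (pf_unit F ?b) \<star> \<iota> (pf_arr G (pf_arr F f)))
    = pf_cell G (pf_unit F ?b \<star>\<^bsub>B\<^esub> \<iota>\<^bsub>B\<^esub> (pf_arr F f)) \<cdot> pf_cmp G (\<one>\<^bsub>B\<^esub> (pf_obj F ?b)) (pf_arr F f)"
    by (simp add: G.F_cmp_nat)
  have 2: "pf_cell G (pf_cell F (\<l>\<^bsub>A\<^esub> f)) \<cdot> pf_cell G (pf_cmp F (\<one>\<^bsub>A\<^esub> ?b) f) \<cdot> pf_cell G (pf_unit F ?b \<star>\<^bsub>B\<^esub> \<iota>\<^bsub>B\<^esub> (pf_arr F f))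
    = pf_cell G (\<l>\<^bsub>B\<^esub> (pf_arr F f))"
    by (simp add: G.F_vcomp[symmetric] F.F_lunit del: G.F_vcomp)
  show ?case
    by (simp add: pf_comp_def G.B.whisker G.B.reassoc2[OF 1] G.B.reassoc3[OF 2] G.F_lunit)
next
  case (13 f)
  note [simp] = this
  let ?a = "b_src A f"
  have 1: "pf_cmp G (pf_arr F f) (pf_arr F (\<one>\<^bsub>A\<^esub> ?a)) \<cdot> (\<iota> (pf_arr G (pf_arr F f)) \<star> pf_cell G (pf_unit F ?a))
    = pf_cell G (\<iota>\<^bsub>B\<^esub> (pf_arr F f) \<star>\<^bsub>B\<^esub> pf_unit F ?a) \<cdot> pf_cmp G (pf_arr F f) (\<one>\<^bsub>B\<^esub> (pf_obj F ?a))"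
    by (simp add: G.F_cmp_nat)
  have 2: "pf_cell G (pf_cell F (\<r>\<^bsub>A\<^esub> f)) \<cdot> pf_cell G (pf_cmp F f (\<one>\<^bsub>A\<^esub> ?a)) \<cdot> pf_cell G (\<iota>\<^bsub>B\<^esub> (pf_arr F f) \<star>\<^bsub>B\<^esub> pf_unit F ?a)
    = pf_cell G (\<r>\<^bsub>B\<^esub> (pf_arr F f))"
    by (simp add: G.F_vcomp[symmetric] F.F_runit del: G.F_vcomp)
  show ?case
    by (simp add: pf_comp_def G.B.whisker G.B.reassoc2[OF 1] G.B.reassoc3[OF 2] G.F_runit)
qed (simp_all add: pf_comp_def in_hom in_cells)

sublocale GF: psfunctor A C "pf_comp C G F"
  by unfold_locales (rule pseudofunctor_comp)

end

section \<open>Local properties of pseudofunctors\<close>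

definition locally_faithful where
  "locally_faithful A F \<longleftrightarrow> (\<forall>f f'. \<forall>\<alpha> \<in> cells A f f'. \<forall>\<alpha>' \<in> cells A f f'. pf_cell F \<alpha> = pf_cell F \<alpha>' \<longrightarrow> \<alpha> = \<alpha>')"

definition locally_full where
  "locally_full A B F \<longleftrightarrow> (\<forall>f \<in> b_arr A. \<forall>f' \<in> b_arr A. b_src A f = b_src A f' \<longrightarrow> b_trg A f = b_trg A f' \<longrightarrow>
    (\<forall>\<beta> \<in> cells B (pf_arr F f) (pf_arr F f'). \<exists>\<alpha> \<in> cells A f f'. pf_cell F \<alpha> = \<beta>))"

definition locally_ess_surj where
  "locally_ess_surj A B F \<longleftrightarrow> (\<forall>a \<in> b_obj A. \<forall>a' \<in> b_obj A. \<forall>h \<in> hom B (pf_obj F a) (pf_obj F a').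
    \<exists>f \<in> hom A a a'. bicat.isomorphic B h (pf_arr F f))"

lemma locally_faithfulD:
  assumes "locally_faithful A F" "\<alpha> \<in> cells A f f'" "\<alpha>' \<in> cells A f f'" "pf_cell F \<alpha> = pf_cell F \<alpha>'"
  shows "\<alpha> = \<alpha>'"
  using assms unfolding locally_faithful_def by blast

lemma locally_fullE:
  assumes "locally_full A B F" "\<beta> \<in> cells B (pf_arr F f) (pf_arr F f')"
    "f \<in> b_arr A" "f' \<in> b_arr A" "b_src A f = b_src A f'" "b_trg A f = b_trg A f'"
  obtains \<alpha> where "\<alpha> \<in> cells A f f'" "pf_cell F \<alpha> = \<beta>"
  using assms unfolding locally_full_def by blast

lemma locally_ess_surjE:
  assumes "locally_ess_surj A B F" "h \<in> hom B (pf_obj F a) (pf_obj F a')" "a \<in> b_obj A" "a' \<in> b_obj A"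
  obtains f where "f \<in> hom A a a'" "bicat.isomorphic B h (pf_arr F f)"
  using assms unfolding locally_ess_surj_def by blast

text \<open>Fullness lifts the isomorphism and its inverse, and faithfulness makes the lifts inverse
  to each other.\<close>

lemma (in psfunctor) isomorphic_reflect:
  assumes ff: "locally_faithful A F" "locally_full A B F"
    and [simp]: "f \<in> A.Arr" "f' \<in> A.Arr" "A.src f = A.src f'" "A.trg f = A.trg f'"
    and iso: "B.isomorphic (pf_arr F f) (pf_arr F f')"
  shows "A.isomorphic f f'"
proof -
  obtain \<beta> where \<beta>: "B.isoc \<beta>" "\<beta> \<in> B.Cell" "B.dm \<beta> = pf_arr F f" "B.cd \<beta> = pf_arr F f'"
    using iso by (rule B.isomorphicE)
  obtain \<alpha> where a: "\<alpha> \<in> cells A f f'" "pf_cell F \<alpha> = \<beta>"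
    using \<beta> by (auto simp: in_cells intro: locally_fullE[OF ff(2), of \<beta> f f'])
  obtain \<alpha>' where a': "\<alpha>' \<in> cells A f' f" "pf_cell F \<alpha>' = B.invc \<beta>"
    using \<beta> by (auto simp: in_cells intro: locally_fullE[OF ff(2), of "B.invc \<beta>" f' f])
  have "\<alpha>' \<cdot>\<^bsub>A\<^esub> \<alpha> = \<iota>\<^bsub>A\<^esub> f"
    by (rule locally_faithfulD[OF ff(1), of _ f f]) (use a a' \<beta> in \<open>auto simp: in_cells\<close>)
  moreover have "\<alpha> \<cdot>\<^bsub>A\<^esub> \<alpha>' = \<iota>\<^bsub>A\<^esub> f'"
    by (rule locally_faithfulD[OF ff(1), of _ f' f']) (use a a' \<beta> in \<open>auto simp: in_cells\<close>)
  ultimately have "A.isoc \<alpha>"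
    by (intro A.isoI[of \<alpha> \<alpha>']) (use a a' in \<open>auto simp: in_cells\<close>)
  then show ?thesis using a by (auto simp: in_cells intro: A.isomorphicI)
qed

locale endo_psfunctor = psfunctor A A F
  for A :: "('ao, 'am, 'ac) bicat" and F :: "('ao, 'am, 'ac, 'ao, 'am, 'ac) psfun"

text \<open>A pseudofunctor receiving naturality isomorphisms \<open>f \<odot> s a \<cong> s b \<odot> H f\<close> along equivalences
  \<open>s a\<close> is conjugate to the identity on every hom-category.\<close>

lemma (in endo_psfunctor) locally_equivalence_if_conjugate_to_id:
  assumes s: "\<And>a. a \<in> A.Obj \<Longrightarrow> A.equivalence (s a) \<and> A.src (s a) = pf_obj F a \<and> A.trg (s a) = a"
    and t: "\<And>f. f \<in> A.Arr \<Longrightarrow> t f \<in> cells A (f \<odot>\<^bsub>A\<^esub> s (A.src f)) (s (A.trg f) \<odot>\<^bsub>A\<^esub> pf_arr F f) \<and> A.isoc (t f)"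
    and n: "\<And>\<alpha>. \<alpha> \<in> A.Cell \<Longrightarrow> t (A.cd \<alpha>) \<cdot>\<^bsub>A\<^esub> (\<alpha> \<star>\<^bsub>A\<^esub> \<iota>\<^bsub>A\<^esub> (s (A.src (A.dm \<alpha>)))) =
       (\<iota>\<^bsub>A\<^esub> (s (A.trg (A.dm \<alpha>))) \<star>\<^bsub>A\<^esub> pf_cell F \<alpha>) \<cdot>\<^bsub>A\<^esub> t (A.dm \<alpha>)"
  shows "locally_faithful A F" "locally_full A A F" "locally_ess_surj A A F"
proof -
  have s' [simp]: "s a \<in> A.Arr" "A.src (s a) = pf_obj F a" "A.trg (s a) = a" if "a \<in> A.Obj" for a
    using s[OF that] A.equivalence_arr by auto
  have t' [simp]: "t f \<in> A.Cell" "A.dm (t f) = f \<odot>\<^bsub>A\<^esub> s (A.src f)" "A.cd (t f) = s (A.trg f) \<odot>\<^bsub>A\<^esub> pf_arr F f" "A.isoc (t f)"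
    if "f \<in> A.Arr" for f using t[OF that] by (auto simp: in_cells)
  show faithful: "locally_faithful A F"
    unfolding locally_faithful_def
  proof (intro allI ballI impI)
    fix f f' \<alpha> \<alpha>' assume a: "\<alpha> \<in> cells A f f'" "\<alpha>' \<in> cells A f f'" and eq: "pf_cell F \<alpha> = pf_cell F \<alpha>'"
    have [simp]: "\<alpha> \<in> A.Cell" "\<alpha>' \<in> A.Cell" "A.dm \<alpha> = f" "A.dm \<alpha>' = f" "A.cd \<alpha> = f'" "A.cd \<alpha>' = f'" "f \<in> A.Arr" "f' \<in> A.Arr"
      "A.src f' = A.src f" "A.trg f' = A.trg f"
      using a A.dom_cod[of \<alpha>] by (auto simp: in_cells)
    have "\<alpha> \<star>\<^bsub>A\<^esub> \<iota>\<^bsub>A\<^esub> (s (A.src f)) = \<alpha>' \<star>\<^bsub>A\<^esub> \<iota>\<^bsub>A\<^esub> (s (A.src f))"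
      by (rule A.iso_cancel_left[of "t f'"]) (use n[of \<alpha>] n[of \<alpha>'] eq in simp_all)
    then show "\<alpha> = \<alpha>'"
      by (rule A.whisker_faithful_right[rotated -1]) (use s[of "A.src f"] a in auto)
  qed
  show full: "locally_full A A F"
    unfolding locally_full_def
  proof (intro ballI impI)
    fix f f' \<beta> assume [simp]: "f \<in> A.Arr" "f' \<in> A.Arr" "A.src f = A.src f'" "A.trg f = A.trg f'"
      and b: "\<beta> \<in> cells A (pf_arr F f) (pf_arr F f')"
    let ?a = "A.src f'" let ?b = "A.trg f'"
    have [simp]: "\<beta> \<in> A.Cell" "A.dm \<beta> = pf_arr F f" "A.cd \<beta> = pf_arr F f'" using b by (auto simp: in_cells)
    \<comment> \<open>Naturality dictates what a preimage of \<beta> must become after whiskering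
      with \<open>s ?a\<close>, and whiskering with an equivalence is full.\<close>
    have "A.invc (t f') \<cdot>\<^bsub>A\<^esub> (\<iota>\<^bsub>A\<^esub> (s ?b) \<star>\<^bsub>A\<^esub> \<beta>) \<cdot>\<^bsub>A\<^esub> t f \<in> cells A (f \<odot>\<^bsub>A\<^esub> s ?a) (f' \<odot>\<^bsub>A\<^esub> s ?a)"
      by (simp add: in_cells)
    then obtain \<alpha> where a: "\<alpha> \<in> cells A f f'"
      "\<alpha> \<star>\<^bsub>A\<^esub> \<iota>\<^bsub>A\<^esub> (s ?a) = A.invc (t f') \<cdot>\<^bsub>A\<^esub> (\<iota>\<^bsub>A\<^esub> (s ?b) \<star>\<^bsub>A\<^esub> \<beta>) \<cdot>\<^bsub>A\<^esub> t f"
      by (rule A.whisker_full_right[rotated]) (use s[of ?a] in auto)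
    have [simp]: "\<alpha> \<in> A.Cell" "A.dm \<alpha> = f" "A.cd \<alpha> = f'" using a by (auto simp: in_cells)
    have "(\<iota>\<^bsub>A\<^esub> (s ?b) \<star>\<^bsub>A\<^esub> pf_cell F \<alpha>) \<cdot>\<^bsub>A\<^esub> t f = (\<iota>\<^bsub>A\<^esub> (s ?b) \<star>\<^bsub>A\<^esub> \<beta>) \<cdot>\<^bsub>A\<^esub> t f"
      using n[of \<alpha>] a(2) by simp
    then have "\<iota>\<^bsub>A\<^esub> (s ?b) \<star>\<^bsub>A\<^esub> pf_cell F \<alpha> = \<iota>\<^bsub>A\<^esub> (s ?b) \<star>\<^bsub>A\<^esub> \<beta>"
      by (rule A.iso_cancel_right[of "t f", rotated -1]) simp_all
    then have "pf_cell F \<alpha> = \<beta>"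
      by (rule A.whisker_faithful_left[of "s ?b" _ "pf_arr F f" "pf_arr F f'", rotated -1]) (use s[of ?b] in \<open>auto simp: in_cells\<close>)
    then show "\<exists>\<alpha> \<in> cells A f f'. pf_cell F \<alpha> = \<beta>" using a by auto
  qed
  show "locally_ess_surj A A F"
    unfolding locally_ess_surj_def
  proof (intro ballI)
    fix a a' h assume [simp]: "a \<in> A.Obj" "a' \<in> A.Obj" and "h \<in> hom A (pf_obj F a) (pf_obj F a')"
    then have [simp]: "h \<in> A.Arr" "A.src h = pf_obj F a" "A.trg h = pf_obj F a'" by (auto simp: in_hom)
    \<comment> \<open>\<open>f\<close> is the transport of \<open>h\<close> along the equivalences:
      \<open>f \<odot> s a\<close> is isomorphic to \<open>s a' \<odot> h\<close> by choice and to
      \<open>s a' \<odot> pf_arr F f\<close> through \<open>t f\<close>. Cancelling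
      \<open>s a'\<close> gives the isomorphism sought.\<close>
    obtain f where f [simp]: "f \<in> A.Arr" "A.src f = a" "A.trg f = a'"
      and i: "A.isomorphic (f \<odot>\<^bsub>A\<^esub> s a) (s a' \<odot>\<^bsub>A\<^esub> h)"
      by (rule A.equivalence_lift_right[of "s a" "s a' \<odot>\<^bsub>A\<^esub> h"]) (use s[of a] in auto)
    have "A.isomorphic (f \<odot>\<^bsub>A\<^esub> s a) (s a' \<odot>\<^bsub>A\<^esub> pf_arr F f)"
      using t'[of f] by (intro A.isomorphicI[of "t f"]) simp_all
    with i have "A.isomorphic (s a' \<odot>\<^bsub>A\<^esub> h) (s a' \<odot>\<^bsub>A\<^esub> pf_arr F f)"
      using A.isomorphic_trans A.isomorphic_sym by blast
    then obtain \<gamma> where g: "A.isoc \<gamma>" "\<gamma> \<in> cells A (s a' \<odot>\<^bsub>A\<^esub> h) (s a' \<odot>\<^bsub>A\<^esub> pf_arr F f)"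
      by (auto elim!: A.isomorphicE simp: in_cells)
    obtain \<beta> where "\<beta> \<in> cells A h (pf_arr F f)" "A.isoc \<beta>"
      by (rule A.whisker_full_left[OF _ g(2)]) (use s[of a'] g(1) in auto)
    then show "\<exists>f \<in> hom A a a'. A.isomorphic h (pf_arr F f)"
      by (auto intro!: bexI[of _ f] A.isomorphicI[of \<beta>] simp: in_hom in_cells)
  qed
qed

text \<open>Of the goals this rule leaves, 16 is interchange, 19 naturality of the associator, 24
  and 25 naturality of the unitors, 26 the pentagon and 27 the triangle.\<close>

lemma bicategoryI:
  assumes "\<And>f. f \<in> b_arr B \<Longrightarrow> b_src B f \<in> b_obj B"
    and "\<And>f. f \<in> b_arr B \<Longrightarrow> b_trg B f \<in> b_obj B"
    and "\<And>\<alpha>. \<alpha> \<in> b_cell B \<Longrightarrow> b_dom B \<alpha> \<in> b_arr B"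
    and "\<And>\<alpha>. \<alpha> \<in> b_cell B \<Longrightarrow> b_cod B \<alpha> \<in> b_arr B"
    and "\<And>\<alpha>. \<alpha> \<in> b_cell B \<Longrightarrow> b_src B (b_dom B \<alpha>) = b_src B (b_cod B \<alpha>)"
    and "\<And>\<alpha>. \<alpha> \<in> b_cell B \<Longrightarrow> b_trg B (b_dom B \<alpha>) = b_trg B (b_cod B \<alpha>)"
    and "\<And>f. f \<in> b_arr B \<Longrightarrow> \<iota>\<^bsub>B\<^esub> f \<in> cells B f f"
    and "\<And>\<alpha> \<beta>. \<alpha> \<in> b_cell B \<Longrightarrow> \<beta> \<in> b_cell B \<Longrightarrow> b_cod B \<alpha> = b_dom B \<beta> \<Longrightarrow>
      \<beta> \<cdot>\<^bsub>B\<^esub> \<alpha> \<in> cells B (b_dom B \<alpha>) (b_cod B \<beta>)"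
    and "\<And>\<alpha>. \<alpha> \<in> b_cell B \<Longrightarrow> \<iota>\<^bsub>B\<^esub> (b_cod B \<alpha>) \<cdot>\<^bsub>B\<^esub> \<alpha> = \<alpha>"
    and "\<And>\<alpha>. \<alpha> \<in> b_cell B \<Longrightarrow> \<alpha> \<cdot>\<^bsub>B\<^esub> \<iota>\<^bsub>B\<^esub> (b_dom B \<alpha>) = \<alpha>"
    and "\<And>\<alpha> \<beta> \<gamma>. \<alpha> \<in> b_cell B \<Longrightarrow> \<beta> \<in> b_cell B \<Longrightarrow> \<gamma> \<in> b_cell B \<Longrightarrow>
      b_cod B \<alpha> = b_dom B \<beta> \<Longrightarrow> b_cod B \<beta> = b_dom B \<gamma> \<Longrightarrow>
      \<gamma> \<cdot>\<^bsub>B\<^esub> (\<beta> \<cdot>\<^bsub>B\<^esub> \<alpha>) = (\<gamma> \<cdot>\<^bsub>B\<^esub> \<beta>) \<cdot>\<^bsub>B\<^esub> \<alpha>"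
    and "\<And>a. a \<in> b_obj B \<Longrightarrow> \<one>\<^bsub>B\<^esub> a \<in> hom B a a"
    and "\<And>f g. f \<in> b_arr B \<Longrightarrow> g \<in> b_arr B \<Longrightarrow> b_trg B f = b_src B g \<Longrightarrow>
      g \<odot>\<^bsub>B\<^esub> f \<in> hom B (b_src B f) (b_trg B g)"
    and "\<And>\<alpha> \<beta>. \<alpha> \<in> b_cell B \<Longrightarrow> \<beta> \<in> b_cell B \<Longrightarrow> b_trg B (b_dom B \<alpha>) = b_src B (b_dom B \<beta>) \<Longrightarrow>
      \<beta> \<star>\<^bsub>B\<^esub> \<alpha> \<in> cells B (b_dom B \<beta> \<odot>\<^bsub>B\<^esub> b_dom B \<alpha>) (b_cod B \<beta> \<odot>\<^bsub>B\<^esub> b_cod B \<alpha>)"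
    and "\<And>f g. f \<in> b_arr B \<Longrightarrow> g \<in> b_arr B \<Longrightarrow> b_trg B f = b_src B g \<Longrightarrow>
      \<iota>\<^bsub>B\<^esub> g \<star>\<^bsub>B\<^esub> \<iota>\<^bsub>B\<^esub> f = \<iota>\<^bsub>B\<^esub> (g \<odot>\<^bsub>B\<^esub> f)"
    and "\<And>\<alpha> \<alpha>' \<beta> \<beta>'. \<alpha> \<in> b_cell B \<Longrightarrow> \<alpha>' \<in> b_cell B \<Longrightarrow> \<beta> \<in> b_cell B \<Longrightarrow> \<beta>' \<in> b_cell B \<Longrightarrow>
      b_cod B \<alpha> = b_dom B \<alpha>' \<Longrightarrow> b_cod B \<beta> = b_dom B \<beta>' \<Longrightarrow> b_trg B (b_dom B \<alpha>) = b_src B (b_dom B \<beta>) \<Longrightarrow>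
      (\<beta>' \<cdot>\<^bsub>B\<^esub> \<beta>) \<star>\<^bsub>B\<^esub> (\<alpha>' \<cdot>\<^bsub>B\<^esub> \<alpha>) = (\<beta>' \<star>\<^bsub>B\<^esub> \<alpha>') \<cdot>\<^bsub>B\<^esub> (\<beta> \<star>\<^bsub>B\<^esub> \<alpha>)"
    and "\<And>f g h. f \<in> b_arr B \<Longrightarrow> g \<in> b_arr B \<Longrightarrow> h \<in> b_arr B \<Longrightarrow> b_trg B f = b_src B g \<Longrightarrow> b_trg B g = b_src B h \<Longrightarrow>
      \<a>\<^bsub>B\<^esub> h g f \<in> cells B ((h \<odot>\<^bsub>B\<^esub> g) \<odot>\<^bsub>B\<^esub> f) (h \<odot>\<^bsub>B\<^esub> g \<odot>\<^bsub>B\<^esub> f)"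
    and "\<And>f g h. f \<in> b_arr B \<Longrightarrow> g \<in> b_arr B \<Longrightarrow> h \<in> b_arr B \<Longrightarrow> b_trg B f = b_src B g \<Longrightarrow> b_trg B g = b_src B h \<Longrightarrow>
      iso2 B (\<a>\<^bsub>B\<^esub> h g f)"
    and "\<And>\<alpha> \<beta> \<gamma>. \<alpha> \<in> b_cell B \<Longrightarrow> \<beta> \<in> b_cell B \<Longrightarrow> \<gamma> \<in> b_cell B \<Longrightarrow>
      b_trg B (b_dom B \<alpha>) = b_src B (b_dom B \<beta>) \<Longrightarrow> b_trg B (b_dom B \<beta>) = b_src B (b_dom B \<gamma>) \<Longrightarrow>
      \<a>\<^bsub>B\<^esub> (b_cod B \<gamma>) (b_cod B \<beta>) (b_cod B \<alpha>) \<cdot>\<^bsub>B\<^esub> ((\<gamma> \<star>\<^bsub>B\<^esub> \<beta>) \<star>\<^bsub>B\<^esub> \<alpha>) =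
      (\<gamma> \<star>\<^bsub>B\<^esub> (\<beta> \<star>\<^bsub>B\<^esub> \<alpha>)) \<cdot>\<^bsub>B\<^esub> \<a>\<^bsub>B\<^esub> (b_dom B \<gamma>) (b_dom B \<beta>) (b_dom B \<alpha>)"
    and "\<And>f. f \<in> b_arr B \<Longrightarrow> \<l>\<^bsub>B\<^esub> f \<in> cells B (\<one>\<^bsub>B\<^esub> (b_trg B f) \<odot>\<^bsub>B\<^esub> f) f"
    and "\<And>f. f \<in> b_arr B \<Longrightarrow> iso2 B (\<l>\<^bsub>B\<^esub> f)"
    and "\<And>f. f \<in> b_arr B \<Longrightarrow> \<r>\<^bsub>B\<^esub> f \<in> cells B (f \<odot>\<^bsub>B\<^esub> \<one>\<^bsub>B\<^esub> (b_src B f)) f"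
    and "\<And>f. f \<in> b_arr B \<Longrightarrow> iso2 B (\<r>\<^bsub>B\<^esub> f)"
    and "\<And>\<alpha>. \<alpha> \<in> b_cell B \<Longrightarrow> \<alpha> \<cdot>\<^bsub>B\<^esub> \<l>\<^bsub>B\<^esub> (b_dom B \<alpha>) =
      \<l>\<^bsub>B\<^esub> (b_cod B \<alpha>) \<cdot>\<^bsub>B\<^esub> (\<iota>\<^bsub>B\<^esub> (\<one>\<^bsub>B\<^esub> (b_trg B (b_dom B \<alpha>))) \<star>\<^bsub>B\<^esub> \<alpha>)"
    and "\<And>\<alpha>. \<alpha> \<in> b_cell B \<Longrightarrow> \<alpha> \<cdot>\<^bsub>B\<^esub> \<r>\<^bsub>B\<^esub> (b_dom B \<alpha>) =
      \<r>\<^bsub>B\<^esub> (b_cod B \<alpha>) \<cdot>\<^bsub>B\<^esub> (\<alpha> \<star>\<^bsub>B\<^esub> \<iota>\<^bsub>B\<^esub> (\<one>\<^bsub>B\<^esub> (b_src B (b_dom B \<alpha>))))"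
    and "\<And>f g h k. f \<in> b_arr B \<Longrightarrow> g \<in> b_arr B \<Longrightarrow> h \<in> b_arr B \<Longrightarrow> k \<in> b_arr B \<Longrightarrow>
      b_trg B f = b_src B g \<Longrightarrow> b_trg B g = b_src B h \<Longrightarrow> b_trg B h = b_src B k \<Longrightarrow>
      (\<iota>\<^bsub>B\<^esub> k \<star>\<^bsub>B\<^esub> \<a>\<^bsub>B\<^esub> h g f) \<cdot>\<^bsub>B\<^esub> (\<a>\<^bsub>B\<^esub> k (h \<odot>\<^bsub>B\<^esub> g) f \<cdot>\<^bsub>B\<^esub> (\<a>\<^bsub>B\<^esub> k h g \<star>\<^bsub>B\<^esub> \<iota>\<^bsub>B\<^esub> f)) =
      \<a>\<^bsub>B\<^esub> k h (g \<odot>\<^bsub>B\<^esub> f) \<cdot>\<^bsub>B\<^esub> \<a>\<^bsub>B\<^esub> (k \<odot>\<^bsub>B\<^esub> h) g f"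
    and "\<And>f g. f \<in> b_arr B \<Longrightarrow> g \<in> b_arr B \<Longrightarrow> b_trg B f = b_src B g \<Longrightarrow>
      (\<iota>\<^bsub>B\<^esub> g \<star>\<^bsub>B\<^esub> \<l>\<^bsub>B\<^esub> f) \<cdot>\<^bsub>B\<^esub> \<a>\<^bsub>B\<^esub> g (\<one>\<^bsub>B\<^esub> (b_trg B f)) f = \<r>\<^bsub>B\<^esub> g \<star>\<^bsub>B\<^esub> \<iota>\<^bsub>B\<^esub> f"
  shows "bicategory B"
  unfolding bicategory_def
  by (intro conjI ballI impI; (elim conjE)?; rule assms; assumption)

context bicat
begin

text \<open>The case of \<open>paste_hcompc\<close> with identities in every other slot. It pulls a
  comparison cell of \<open>F\<close> out of a pasted square.\<close>

lemma paste_vcomp_right: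
  assumes "sq e0 e1 u1 g1 \<phi>1" "sq e1 e2 u2 g2 \<phi>2" "\<mu> \<in> cells B u1 v1"
  shows "paste e2 e1 e0 u2 v1 g2 g1 \<phi>2 ((\<iota> e1 \<star> \<mu>) \<cdot> \<phi>1) = (\<iota> e2 \<star> (\<iota> u2 \<star> \<mu>)) \<cdot> paste e2 e1 e0 u2 u1 g2 g1 \<phi>2 \<phi>1"
proof -
  have [simp]: "e0 \<in> Arr" "e1 \<in> Arr" "e2 \<in> Arr" "u1 \<in> Arr" "u2 \<in> Arr" "v1 \<in> Arr"
    "g1 \<in> Arr" "g2 \<in> Arr" "\<phi>1 \<in> Cell" "\<phi>2 \<in> Cell"
    "src u1 = src e0" "trg u1 = src e1" "src g1 = trg e0" "trg g1 = trg e1"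
    "src u2 = src e1" "trg u2 = src e2" "src g2 = trg e1" "trg g2 = trg e2"
    "src v1 = src e0" "trg v1 = src e1" "\<mu> \<in> Cell" "dm \<mu> = u1" "cd \<mu> = v1"
    "dm \<phi>1 = g1 \<odot> e0" "dm \<phi>2 = g2 \<odot> e1" "cd \<phi>1 = e1 \<odot> u1" "cd \<phi>2 = e2 \<odot> u2"
    using assms dom_cod[of \<mu>] by (auto simp add: sq_def in_cells)
  have s: "sq e0 e1 v1 g1 ((\<iota> e1 \<star> \<mu>) \<cdot> \<phi>1)" by (simp add: sq_def)
  have s': "sq e0 e2 (u2 \<odot> v1) (g2 \<odot> g1) (paste e2 e1 e0 u2 v1 g2 g1 \<phi>2 ((\<iota> e1 \<star> \<mu>) \<cdot> \<phi>1))"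
    by (rule sq_paste(1)[OF s assms(2)])
  show ?thesis
    using paste_hcompc[OF assms(1,2) s assms(2,3), of "\<iota> u2" "\<iota> g1" "\<iota> g2"] s'
    by (simp add: in_cells sq_def)
qed

lemma paste_vcomp_left:
  assumes "sq e0 e1 u1 g1 \<phi>1" "sq e1 e2 u2 g2 \<phi>2" "\<mu> \<in> cells B u2 v2"
  shows "paste e2 e1 e0 v2 u1 g2 g1 ((\<iota> e2 \<star> \<mu>) \<cdot> \<phi>2) \<phi>1 = (\<iota> e2 \<star> (\<mu> \<star> \<iota> u1)) \<cdot> paste e2 e1 e0 u2 u1 g2 g1 \<phi>2 \<phi>1"
proof -
  have [simp]: "e0 \<in> Arr" "e1 \<in> Arr" "e2 \<in> Arr" "u1 \<in> Arr" "u2 \<in> Arr" "v2 \<in> Arr"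
    "g1 \<in> Arr" "g2 \<in> Arr" "\<phi>1 \<in> Cell" "\<phi>2 \<in> Cell"
    "src u1 = src e0" "trg u1 = src e1" "src g1 = trg e0" "trg g1 = trg e1"
    "src u2 = src e1" "trg u2 = src e2" "src g2 = trg e1" "trg g2 = trg e2"
    "src v2 = src e1" "trg v2 = src e2" "\<mu> \<in> Cell" "dm \<mu> = u2" "cd \<mu> = v2"
    "dm \<phi>1 = g1 \<odot> e0" "dm \<phi>2 = g2 \<odot> e1" "cd \<phi>1 = e1 \<odot> u1" "cd \<phi>2 = e2 \<odot> u2"
    using assms dom_cod[of \<mu>] by (auto simp add: sq_def in_cells)
  have s: "sq e1 e2 v2 g2 ((\<iota> e2 \<star> \<mu>) \<cdot> \<phi>2)" by (simp add: sq_def)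
  have s': "sq e0 e2 (v2 \<odot> u1) (g2 \<odot> g1) (paste e2 e1 e0 v2 u1 g2 g1 ((\<iota> e2 \<star> \<mu>) \<cdot> \<phi>2) \<phi>1)"
    by (rule sq_paste(1)[OF assms(1) s])
  show ?thesis
    using paste_hcompc[OF assms(1,2,1) s _ assms(3), of "\<iota> u1" "\<iota> g1" "\<iota> g2"] s'
    by (simp add: in_cells sq_def)
qed

end

section \<open>From biequivalences to local equivalences\<close>

lemma iso_of_inv_modification:
  assumes "bicat B" "inv_modification A B F G \<sigma> \<tau> \<Gamma>" "a \<in> b_obj A"
  shows "bicat.isomorphic B (tr_obj \<sigma> a) (tr_obj \<tau> a)"
proof -
  interpret bicat B by fact
  obtain \<Gamma>' where "\<Gamma> a \<in> cells B (tr_obj \<sigma> a) (tr_obj \<tau> a)" "\<Gamma>' a \<in> cells B (tr_obj \<tau> a) (tr_obj \<sigma> a)"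
    "\<Gamma>' a \<cdot>\<^bsub>B\<^esub> \<Gamma> a = \<iota>\<^bsub>B\<^esub> (tr_obj \<sigma> a)" "\<Gamma> a \<cdot>\<^bsub>B\<^esub> \<Gamma>' a = \<iota>\<^bsub>B\<^esub> (tr_obj \<tau> a)"
    using assms(2,3) unfolding inv_modification_def modification_def by blast
  then show ?thesis
    by (intro isomorphicI[of "\<Gamma> a"] isoI[of "\<Gamma> a" "\<Gamma>' a"]) (simp_all add: in_cells)
qed

text \<open>Evaluation at an object turns the two invertible modifications into isomorphisms between
  composites of components and identities, so the components of \<tau> are quasi-inverse to those of
  \<sigma>.\<close>

lemma equiv_in_functor_bicat_components:
  assumes "bicat B" "equiv_in_functor_bicat A B F G"
    "\<And>a. a \<in> b_obj A \<Longrightarrow> pf_obj F a \<in> b_obj B" "\<And>a. a \<in> b_obj A \<Longrightarrow> pf_obj G a \<in> b_obj B"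
  obtains \<sigma> where "pseudonat A B F G \<sigma>" "\<And>a. a \<in> b_obj A \<Longrightarrow> bicat.equivalence B (tr_obj \<sigma> a)"
proof -
  interpret bicat B by fact
  obtain \<sigma> \<tau> \<Gamma> \<Delta> where st: "pseudonat A B F G \<sigma>" "pseudonat A B G F \<tau>"
    and gd: "inv_modification A B F F (tr_comp A B F G F \<tau> \<sigma>) (tr_id B F) \<Gamma>"
      "inv_modification A B G G (tr_comp A B G F G \<sigma> \<tau>) (tr_id B G) \<Delta>"
    using assms(2) unfolding equiv_in_functor_bicat_def by blast
  have "equivalence (tr_obj \<sigma> a)" if a: "a \<in> b_obj A" for a
  proof -
    have "tr_obj \<sigma> a \<in> hom B (pf_obj F a) (pf_obj G a)" "tr_obj \<tau> a \<in> hom B (pf_obj G a) (pf_obj F a)"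
      using st a unfolding pseudonat_def by blast+
    moreover have "isomorphic (tr_obj \<tau> a \<odot>\<^bsub>B\<^esub> tr_obj \<sigma> a) (\<one>\<^bsub>B\<^esub> (pf_obj F a))"
      using iso_of_inv_modification[OF assms(1) gd(1) a] by (simp add: tr_comp_def tr_id_def)
    moreover have "isomorphic (tr_obj \<sigma> a \<odot>\<^bsub>B\<^esub> tr_obj \<tau> a) (\<one>\<^bsub>B\<^esub> (pf_obj G a))"
      using iso_of_inv_modification[OF assms(1) gd(2) a] by (simp add: tr_comp_def tr_id_def)
    ultimately show ?thesis
      unfolding equivalence_def quasi_inverse_def by (intro exI[of _ "tr_obj \<tau> a"]) (auto simp: in_hom)
  qed
  with st(1) show ?thesis by (rule that)
qed

lemma (in endo_psfunctor) locally_equivalence_if_equiv_id: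
  assumes "equiv_in_functor_bicat A A F (pf_id A)"
  shows "locally_faithful A F" "locally_full A A F" "locally_ess_surj A A F"
    "\<And>a. a \<in> A.Obj \<Longrightarrow> \<exists>e. A.equivalence e \<and> A.src e = pf_obj F a \<and> A.trg e = a"
proof -
  obtain \<sigma> where n: "pseudonat A A F (pf_id A) \<sigma>" and e: "\<And>a. a \<in> A.Obj \<Longrightarrow> A.equivalence (tr_obj \<sigma> a)"
    by (rule equiv_in_functor_bicat_components[OF A.bicat_axioms assms]) (auto simp: pf_id_def)
  have s: "A.equivalence (tr_obj \<sigma> a) \<and> A.src (tr_obj \<sigma> a) = pf_obj F a \<and> A.trg (tr_obj \<sigma> a) = a" if "a \<in> A.Obj" for a
    using n e that by (auto simp: pseudonat_def pf_id_def in_hom)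
  have "tr_arr \<sigma> f \<in> cells A (f \<odot>\<^bsub>A\<^esub> tr_obj \<sigma> (A.src f)) (tr_obj \<sigma> (A.trg f) \<odot>\<^bsub>A\<^esub> pf_arr F f) \<and> A.isoc (tr_arr \<sigma> f)"
    if "f \<in> A.Arr" for f
    using n that unfolding pseudonat_def by (simp add: pf_id_def)
  moreover have "tr_arr \<sigma> (A.cd \<alpha>) \<cdot>\<^bsub>A\<^esub> (\<alpha> \<star>\<^bsub>A\<^esub> \<iota>\<^bsub>A\<^esub> (tr_obj \<sigma> (A.src (A.dm \<alpha>)))) =
       (\<iota>\<^bsub>A\<^esub> (tr_obj \<sigma> (A.trg (A.dm \<alpha>))) \<star>\<^bsub>A\<^esub> pf_cell F \<alpha>) \<cdot>\<^bsub>A\<^esub> tr_arr \<sigma> (A.dm \<alpha>)" if "\<alpha> \<in> A.Cell" for \<alpha>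
    using n that unfolding pseudonat_def by (simp add: pf_id_def)
  ultimately show "locally_faithful A F" "locally_full A A F" "locally_ess_surj A A F"
    using locally_equivalence_if_conjugate_to_id[of "tr_obj \<sigma>" "tr_arr \<sigma>"] s by blast+
  show "\<exists>e. A.equivalence e \<and> A.src e = pf_obj F a \<and> A.trg e = a" if "a \<in> A.Obj" for a
    using s that by blast
qed

text \<open>The two-out-of-six argument, applied on hom-categories.\<close>

lemma biequivalence_locally_equivalence:
  assumes "psfunctor A B F" "psfunctor B A G"
    "equiv_in_functor_bicat A A (pf_comp A G F) (pf_id A)" "equiv_in_functor_bicat B B (pf_comp B F G) (pf_id B)"
  shows "locally_faithful A F" "locally_full A B F" "locally_ess_surj A B F"
    "\<And>b. b \<in> b_obj B \<Longrightarrow> \<exists>a \<in> b_obj A. \<exists>e. bicat.equivalence B e \<and> b_src B e = pf_obj F a \<and> b_trg B e = b"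
proof -
  interpret F: psfunctor A B F by fact
  interpret G: psfunctor B A G by fact
  interpret GF: psfunctor_comp A B A F G ..
  interpret FG: psfunctor_comp B A B G F ..
  interpret GFe: endo_psfunctor A "pf_comp A G F" ..
  interpret FGe: endo_psfunctor B "pf_comp B F G" ..
  note gf = GFe.locally_equivalence_if_equiv_id[OF assms(3)]
  note fg = FGe.locally_equivalence_if_equiv_id[OF assms(4)]
  have comp: "pf_cell (pf_comp A G F) \<alpha> = pf_cell G (pf_cell F \<alpha>)" "pf_cell (pf_comp B F G) \<beta> = pf_cell F (pf_cell G \<beta>)"
     "pf_arr (pf_comp A G F) f = pf_arr G (pf_arr F f)" "pf_arr (pf_comp B F G) g = pf_arr F (pf_arr G g)"
     "pf_obj (pf_comp A G F) a = pf_obj G (pf_obj F a)" "pf_obj (pf_comp B F G) b = pf_obj F (pf_obj G b)" for \<alpha> \<beta> f g a b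
    by (simp_all add: pf_comp_def)
  \<comment> \<open>If \<open>F\<close> identifies two 2-cells, then so does the faithful composite
    \<open>G F\<close>; the same holds for \<open>G\<close> and \<open>F G\<close>.\<close>
  show F1: "locally_faithful A F"
    using gf(1) unfolding locally_faithful_def comp by metis
  have G1: "locally_faithful B G"
    using fg(1) unfolding locally_faithful_def comp by metis
  show "locally_full A B F"
    unfolding locally_full_def
  proof (intro ballI impI)
    fix f f' \<beta> assume f [simp]: "f \<in> b_arr A" "f' \<in> b_arr A" "b_src A f = b_src A f'" "b_trg A f = b_trg A f'"
      and b: "\<beta> \<in> cells B (pf_arr F f) (pf_arr F f')"
    \<comment> \<open>Apply \<open>G\<close>, lift through the full composite \<open>G F\<close>,
      and compare images under the faithful \<open>G\<close>.\<close>
    have "pf_cell G \<beta> \<in> cells A (pf_arr (pf_comp A G F) f) (pf_arr (pf_comp A G F) f')"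
      using b by (auto simp: comp in_cells)
    then obtain \<alpha> where a: "\<alpha> \<in> cells A f f'" "pf_cell G (pf_cell F \<alpha>) = pf_cell G \<beta>"
      using locally_fullE[OF gf(2) _ f] by (metis comp(1))
    have "pf_cell F \<alpha> = \<beta>"
      by (rule locally_faithfulD[OF G1 _ b a(2)]) (use a in \<open>auto simp: in_cells\<close>)
    then show "\<exists>\<alpha> \<in> cells A f f'. pf_cell F \<alpha> = \<beta>" using a by blast
  qed
  \<comment> \<open>With fullness as well, \<open>G\<close> reflects isomorphisms of 1-cells, which
    turns essential surjectivity of \<open>G F\<close> into that of \<open>F\<close>.\<close>
  have G2: "locally_full B A G"
    unfolding locally_full_def
  proof (intro ballI impI)
    fix f f' \<beta> assume f [simp]: "f \<in> b_arr B" "f' \<in> b_arr B" "b_src B f = b_src B f'" "b_trg B f = b_trg B f'"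
      and b: "\<beta> \<in> cells A (pf_arr G f) (pf_arr G f')"
    have "pf_cell F \<beta> \<in> cells B (pf_arr (pf_comp B F G) f) (pf_arr (pf_comp B F G) f')"
      using b by (auto simp: comp in_cells)
    then obtain \<alpha> where a: "\<alpha> \<in> cells B f f'" "pf_cell F (pf_cell G \<alpha>) = pf_cell F \<beta>"
      using locally_fullE[OF fg(2) _ f] by (metis comp(2))
    have "pf_cell G \<alpha> = \<beta>"
      by (rule locally_faithfulD[OF F1 _ b a(2)]) (use a in \<open>auto simp: in_cells\<close>)
    then show "\<exists>\<alpha> \<in> cells B f f'. pf_cell G \<alpha> = \<beta>" using a by blast
  qed
  show "locally_ess_surj A B F"
    unfolding locally_ess_surj_def
  proof (intro ballI)
    fix a a' h assume a [simp]: "a \<in> b_obj A" "a' \<in> b_obj A" and "h \<in> hom B (pf_obj F a) (pf_obj F a')"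
    then have [simp]: "h \<in> b_arr B" "b_src B h = pf_obj F a" "b_trg B h = pf_obj F a'" by (auto simp: in_hom)
    have "pf_arr G h \<in> hom A (pf_obj (pf_comp A G F) a) (pf_obj (pf_comp A G F) a')"
      by (simp add: in_hom comp)
    then obtain f where f: "f \<in> hom A a a'" "F.A.isomorphic (pf_arr G h) (pf_arr G (pf_arr F f))"
      using gf(3) a unfolding locally_ess_surj_def comp by metis
    have "F.B.isomorphic h (pf_arr F f)"
      by (rule G.isomorphic_reflect[OF G1 G2 _ _ _ _ f(2)]) (use f(1) in \<open>auto simp: in_hom\<close>)
    then show "\<exists>f \<in> hom A a a'. F.B.isomorphic h (pf_arr F f)" using f by blast
  qed
  \<comment> \<open>The object over \<open>b\<close> is \<open>G b\<close>, and the equivalence is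
    the component at \<open>b\<close> of the transformation from \<open>F G\<close> to the
    identity.\<close>
  show "\<exists>a \<in> b_obj A. \<exists>e. F.B.equivalence e \<and> b_src B e = pf_obj F a \<and> b_trg B e = b" if "b \<in> b_obj B" for b
    using fg(4)[OF that] that by (intro bexI[of _ "pf_obj G b"]) (auto simp: comp)
qed

section \<open>The bicategory of cylinders\<close>

text \<open>A 1-cell stores its end objects and a 2-cell its domain and codomain: a pair of 1-cells
  with its square does not determine the equivalences at the ends, and a pair of 2-cells does not
  determine the squares that it relates.\<close>

type_synonym ('ao, 'bo, 'bm) cyl_obj = "'ao \<times> 'bo \<times> 'bm"
type_synonym ('ao, 'bo, 'am, 'bm, 'bc) cyl_arr =
  "('ao, 'bo, 'bm) cyl_obj \<times> ('ao, 'bo, 'bm) cyl_obj \<times> 'am \<times> 'bm \<times> 'bc"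
type_synonym ('ao, 'bo, 'am, 'bm, 'ac, 'bc) cyl_cell =
  "('ao, 'bo, 'am, 'bm, 'bc) cyl_arr \<times> ('ao, 'bo, 'am, 'bm, 'bc) cyl_arr \<times> 'ac \<times> 'bc"

abbreviation oE :: "('ao, 'bo, 'bm) cyl_obj \<Rightarrow> 'bm" where "oE X \<equiv> snd (snd X)"
abbreviation aS :: "('ao, 'bo, 'am, 'bm, 'bc) cyl_arr \<Rightarrow> ('ao, 'bo, 'bm) cyl_obj" where "aS m \<equiv> fst m"
abbreviation aT :: "('ao, 'bo, 'am, 'bm, 'bc) cyl_arr \<Rightarrow> ('ao, 'bo, 'bm) cyl_obj" where "aT m \<equiv> fst (snd m)"
abbreviation aF :: "('ao, 'bo, 'am, 'bm, 'bc) cyl_arr \<Rightarrow> 'am" where "aF m \<equiv> fst (snd (snd m))"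
abbreviation aG :: "('ao, 'bo, 'am, 'bm, 'bc) cyl_arr \<Rightarrow> 'bm" where "aG m \<equiv> fst (snd (snd (snd m)))"
abbreviation aP :: "('ao, 'bo, 'am, 'bm, 'bc) cyl_arr \<Rightarrow> 'bc" where "aP m \<equiv> snd (snd (snd (snd m)))"
abbreviation cA :: "('ao, 'bo, 'am, 'bm, 'ac, 'bc) cyl_cell \<Rightarrow> 'ac" where "cA c \<equiv> fst (snd (snd c))"
abbreviation cB :: "('ao, 'bo, 'am, 'bm, 'ac, 'bc) cyl_cell \<Rightarrow> 'bc" where "cB c \<equiv> snd (snd (snd c))"

context psfunctor
begin

definition cyl_objs :: "('ao, 'bo, 'bm) cyl_obj set" where
  "cyl_objs = {X. fst X \<in> A.Obj \<and> fst (snd X) \<in> B.Obj \<and> B.equivalence (oE X) \<and> oE X \<in> B.Arr \<and>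
     B.src (oE X) = pf_obj F (fst X) \<and> B.trg (oE X) = fst (snd X)}"

definition cyl_arrs :: "('ao, 'bo, 'am, 'bm, 'bc) cyl_arr set" where
  "cyl_arrs = {m. aS m \<in> cyl_objs \<and> aT m \<in> cyl_objs \<and>
     aF m \<in> A.Arr \<and> A.src (aF m) = fst (aS m) \<and> A.trg (aF m) = fst (aT m) \<and>
     aG m \<in> B.Arr \<and> B.src (aG m) = fst (snd (aS m)) \<and> B.trg (aG m) = fst (snd (aT m)) \<and>
     aP m \<in> B.Cell \<and> B.dm (aP m) = aG m \<odot> oE (aS m) \<and> B.cd (aP m) = oE (aT m) \<odot> pf_arr F (aF m) \<and>
     B.isoc (aP m)}"

definition cyl_cells :: "('ao, 'bo, 'am, 'bm, 'ac, 'bc) cyl_cell set" where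
  "cyl_cells = {c. fst c \<in> cyl_arrs \<and> fst (snd c) \<in> cyl_arrs \<and>
     aS (fst (snd c)) = aS (fst c) \<and> aT (fst (snd c)) = aT (fst c) \<and>
     cA c \<in> A.Cell \<and> A.dm (cA c) = aF (fst c) \<and> A.cd (cA c) = aF (fst (snd c)) \<and>
     cB c \<in> B.Cell \<and> B.dm (cB c) = aG (fst c) \<and> B.cd (cB c) = aG (fst (snd c)) \<and>
     aP (fst (snd c)) \<cdot> (cB c \<star> \<iota> (oE (aS (fst c)))) = (\<iota> (oE (aT (fst c))) \<star> pf_cell F (cA c)) \<cdot> aP (fst c)}"

definition cyl_paste :: "('ao, 'bo, 'am, 'bm, 'bc) cyl_arr \<Rightarrow> ('ao, 'bo, 'am, 'bm, 'bc) cyl_arr \<Rightarrow> 'bc" where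
  "cyl_paste n m = B.paste (oE (aT n)) (oE (aS n)) (oE (aS m)) (pf_arr F (aF n)) (pf_arr F (aF m)) (aG n) (aG m) (aP n) (aP m)"

text \<open>\<open>cyl_paste\<close> ends in the composite of the images under \<open>F\<close>;
  whiskering with \<open>pf_cmp\<close> moves it to the image of the composite. The failure of
  \<open>F\<close> to be strict thus sits in the square alone.\<close>

definition cyl_hcomp where
  "cyl_hcomp n m = (aS m, aT n, aF n \<odot>\<^bsub>A\<^esub> aF m, aG n \<odot> aG m,
     (\<iota> (oE (aT n)) \<star> pf_cmp F (aF n) (aF m)) \<cdot> cyl_paste n m)"

definition cyl_ide :: "('ao, 'bo, 'bm) cyl_obj \<Rightarrow> ('ao, 'bo, 'am, 'bm, 'bc) cyl_arr" where
  "cyl_ide X = (X, X, \<one>\<^bsub>A\<^esub> (fst X), \<one> (fst (snd X)), (\<iota> (oE X) \<star> pf_unit F (fst X)) \<cdot> B.unit_sq (oE X))"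

text \<open>Operations on 2-cells act separately on the \<open>A\<close>- and
  \<open>B\<close>-components, so their equations are inherited. What remains to be shown about
  squares is that each operation stays inside \<open>cyl_cells\<close>.\<close>

definition cyl :: "(('ao, 'bo, 'bm) cyl_obj, ('ao, 'bo, 'am, 'bm, 'bc) cyl_arr, ('ao, 'bo, 'am, 'bm, 'ac, 'bc) cyl_cell) bicat" where
  "cyl = \<lparr> b_obj = cyl_objs, b_arr = cyl_arrs, b_src = (\<lambda>m. aS m), b_trg = (\<lambda>m. aT m),
     b_cell = cyl_cells, b_dom = fst, b_cod = (\<lambda>c. fst (snd c)),
     b_vcomp = (\<lambda>d c. (fst c, fst (snd d), cA d \<cdot>\<^bsub>A\<^esub> cA c, cB d \<cdot> cB c)),
     b_idc = (\<lambda>m. (m, m, \<iota>\<^bsub>A\<^esub> (aF m), \<iota> (aG m))),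
     b_hcomp = cyl_hcomp,
     b_hcompc = (\<lambda>d c. (cyl_hcomp (fst d) (fst c), cyl_hcomp (fst (snd d)) (fst (snd c)), cA d \<star>\<^bsub>A\<^esub> cA c, cB d \<star> cB c)),
     b_ide = cyl_ide,
     b_assoc = (\<lambda>k n m. (cyl_hcomp (cyl_hcomp k n) m, cyl_hcomp k (cyl_hcomp n m),
        \<a>\<^bsub>A\<^esub> (aF k) (aF n) (aF m), \<a> (aG k) (aG n) (aG m))),
     b_lunit = (\<lambda>m. (cyl_hcomp (cyl_ide (aT m)) m, m, \<l>\<^bsub>A\<^esub> (aF m), \<l> (aG m))),
     b_runit = (\<lambda>m. (cyl_hcomp m (cyl_ide (aS m)), m, \<r>\<^bsub>A\<^esub> (aF m), \<r> (aG m))) \<rparr>"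

lemma cyl_simps [simp]:
  "b_obj cyl = cyl_objs" "b_arr cyl = cyl_arrs" "b_cell cyl = cyl_cells"
  "b_src cyl m = aS m" "b_trg cyl m = aT m" "b_dom cyl c = fst c" "b_cod cyl c = fst (snd c)"
  "d \<cdot>\<^bsub>cyl\<^esub> c = (fst c, fst (snd d), cA d \<cdot>\<^bsub>A\<^esub> cA c, cB d \<cdot> cB c)"
  "\<iota>\<^bsub>cyl\<^esub> m = (m, m, \<iota>\<^bsub>A\<^esub> (aF m), \<iota> (aG m))"
  "n \<odot>\<^bsub>cyl\<^esub> m = cyl_hcomp n m"
  "d \<star>\<^bsub>cyl\<^esub> c = (cyl_hcomp (fst d) (fst c), cyl_hcomp (fst (snd d)) (fst (snd c)), cA d \<star>\<^bsub>A\<^esub> cA c, cB d \<star> cB c)"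
  "\<one>\<^bsub>cyl\<^esub> X = cyl_ide X"
  "\<a>\<^bsub>cyl\<^esub> k n m = (cyl_hcomp (cyl_hcomp k n) m, cyl_hcomp k (cyl_hcomp n m),
        \<a>\<^bsub>A\<^esub> (aF k) (aF n) (aF m), \<a> (aG k) (aG n) (aG m))"
  "\<l>\<^bsub>cyl\<^esub> m = (cyl_hcomp (cyl_ide (aT m)) m, m, \<l>\<^bsub>A\<^esub> (aF m), \<l> (aG m))"
  "\<r>\<^bsub>cyl\<^esub> m = (cyl_hcomp m (cyl_ide (aS m)), m, \<r>\<^bsub>A\<^esub> (aF m), \<r> (aG m))"
  by (simp_all add: cyl_def)

lemma cyl_objD [simp]:
  assumes "X \<in> cyl_objs"
  shows "fst X \<in> A.Obj" "fst (snd X) \<in> B.Obj" "oE X \<in> B.Arr" "B.src (oE X) = pf_obj F (fst X)" "B.trg (oE X) = fst (snd X)"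
    "B.equivalence (oE X)"
  using assms by (auto simp: cyl_objs_def)

lemma cyl_arrD [simp]:
  assumes "m \<in> cyl_arrs"
  shows "aS m \<in> cyl_objs" "aT m \<in> cyl_objs" "aF m \<in> A.Arr" "A.src (aF m) = fst (aS m)" "A.trg (aF m) = fst (aT m)"
    "aG m \<in> B.Arr" "B.src (aG m) = fst (snd (aS m))" "B.trg (aG m) = fst (snd (aT m))"
    "aP m \<in> B.Cell" "B.dm (aP m) = aG m \<odot> oE (aS m)" "B.cd (aP m) = oE (aT m) \<odot> pf_arr F (aF m)" "B.isoc (aP m)"
  using assms unfolding cyl_arrs_def by blast+

lemma cyl_cellD [simp]:
  assumes "c \<in> cyl_cells"
  shows "fst c \<in> cyl_arrs" "fst (snd c) \<in> cyl_arrs" "aS (fst (snd c)) = aS (fst c)" "aT (fst (snd c)) = aT (fst c)"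
    "cA c \<in> A.Cell" "A.dm (cA c) = aF (fst c)" "A.cd (cA c) = aF (fst (snd c))"
    "cB c \<in> B.Cell" "B.dm (cB c) = aG (fst c)" "B.cd (cB c) = aG (fst (snd c))"
  using assms unfolding cyl_cells_def by blast+

lemma cyl_compat:
  assumes "c \<in> cyl_cells"
  shows "aP (fst (snd c)) \<cdot> (cB c \<star> \<iota> (oE (aS (fst c)))) = (\<iota> (oE (aT (fst c))) \<star> pf_cell F (cA c)) \<cdot> aP (fst c)"
  using assms unfolding cyl_cells_def by blast

lemma cyl_sq:
  assumes "m \<in> cyl_arrs"
  shows "B.sq (oE (aS m)) (oE (aT m)) (pf_arr F (aF m)) (aG m) (aP m)"
  using assms by (simp add: B.sq_def)

lemma cyl_paste_sq:
  assumes "m \<in> cyl_arrs" "n \<in> cyl_arrs" "aT m = aS n"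
  shows "B.sq (oE (aS m)) (oE (aT n)) (pf_arr F (aF n) \<odot> pf_arr F (aF m)) (aG n \<odot> aG m) (cyl_paste n m)"
    "B.isoc (cyl_paste n m)"
  using B.sq_paste[OF cyl_sq[OF assms(1)], of "oE (aT n)" "pf_arr F (aF n)" "aG n" "aP n"] cyl_sq[OF assms(2)] assms
  by (simp_all add: cyl_paste_def)

lemma cyl_paste_cell [simp]:
  assumes "m \<in> cyl_arrs" "n \<in> cyl_arrs" "aT m = aS n"
  shows "cyl_paste n m \<in> B.Cell" "B.dm (cyl_paste n m) = (aG n \<odot> aG m) \<odot> oE (aS m)"
    "B.cd (cyl_paste n m) = oE (aT n) \<odot> pf_arr F (aF n) \<odot> pf_arr F (aF m)" "B.isoc (cyl_paste n m)"
  using cyl_paste_sq[OF assms] by (simp_all add: B.sq_def)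

lemma cyl_hcomp_sel [simp]:
  "aS (cyl_hcomp n m) = aS m" "aT (cyl_hcomp n m) = aT n" "aF (cyl_hcomp n m) = aF n \<odot>\<^bsub>A\<^esub> aF m"
  "aG (cyl_hcomp n m) = aG n \<odot> aG m"
  "aP (cyl_hcomp n m) = (\<iota> (oE (aT n)) \<star> pf_cmp F (aF n) (aF m)) \<cdot> cyl_paste n m"
  by (simp_all add: cyl_hcomp_def)

lemma cyl_ide_sel [simp]:
  "aS (cyl_ide X) = X" "aT (cyl_ide X) = X" "aF (cyl_ide X) = \<one>\<^bsub>A\<^esub> (fst X)"
  "aG (cyl_ide X) = \<one> (fst (snd X))"
  "aP (cyl_ide X) = (\<iota> (oE X) \<star> pf_unit F (fst X)) \<cdot> B.unit_sq (oE X)"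
  by (simp_all add: cyl_ide_def)

lemma unit_sq_cell [simp]:
  assumes "X \<in> cyl_objs"
  shows "B.unit_sq (oE X) \<in> B.Cell" "B.dm (B.unit_sq (oE X)) = \<one> (fst (snd X)) \<odot> oE X"
    "B.cd (B.unit_sq (oE X)) = oE X \<odot> \<one> (pf_obj F (fst X))" "B.isoc (B.unit_sq (oE X))"
  using assms B.sq_unit_sq[of "oE X"] by (simp_all add: B.sq_def)

lemma cyl_hcomp_arr [simp]:
  assumes "m \<in> cyl_arrs" "n \<in> cyl_arrs" "aT m = aS n"
  shows "cyl_hcomp n m \<in> cyl_arrs"
  unfolding cyl_arrs_def using assms by simp

lemma cyl_ide_arr [simp]:
  assumes "X \<in> cyl_objs"
  shows "cyl_ide X \<in> cyl_arrs"
  unfolding cyl_arrs_def using assms by simp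

lemma cyl_cellI:
  assumes "m \<in> cyl_arrs" "n \<in> cyl_arrs" "aS n = aS m" "aT n = aT m"
    "\<alpha> \<in> A.Cell" "A.dm \<alpha> = aF m" "A.cd \<alpha> = aF n" "\<beta> \<in> B.Cell" "B.dm \<beta> = aG m" "B.cd \<beta> = aG n"
    "aP n \<cdot> (\<beta> \<star> \<iota> (oE (aS m))) = (\<iota> (oE (aT m)) \<star> pf_cell F \<alpha>) \<cdot> aP m"
  shows "(m, n, \<alpha>, \<beta>) \<in> cyl_cells"
  unfolding cyl_cells_def using assms by simp

lemma cyl_idc_cell [simp]:
  assumes "m \<in> cyl_arrs"
  shows "(m, m, \<iota>\<^bsub>A\<^esub> (aF m), \<iota> (aG m)) \<in> cyl_cells"
  by (rule cyl_cellI) (use assms in simp_all)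

lemma cyl_vcomp_cell [simp]:
  assumes [simp]: "c \<in> cyl_cells" "d \<in> cyl_cells" "fst (snd c) = fst d"
  shows "(fst c, fst (snd d), cA d \<cdot>\<^bsub>A\<^esub> cA c, cB d \<cdot> cB c) \<in> cyl_cells"
proof (rule cyl_cellI)
  have [simp]: "aS (fst d) = aS (fst c)" "aT (fst d) = aT (fst c)"
    using cyl_cellD(3,4)[of c] by simp_all
  have c: "aP (fst d) \<cdot> (cB c \<star> \<iota> (oE (aS (fst c)))) = (\<iota> (oE (aT (fst c))) \<star> pf_cell F (cA c)) \<cdot> aP (fst c)"
    using cyl_compat[of c] by simp
  have d: "aP (fst (snd d)) \<cdot> (cB d \<star> \<iota> (oE (aS (fst c)))) = (\<iota> (oE (aT (fst c))) \<star> pf_cell F (cA d)) \<cdot> aP (fst d)"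
    using cyl_compat[of d] by simp
  show "aP (fst (snd d)) \<cdot> ((cB d \<cdot> cB c) \<star> \<iota> (oE (aS (fst c)))) =
    (\<iota> (oE (aT (fst c))) \<star> pf_cell F (cA d \<cdot>\<^bsub>A\<^esub> cA c)) \<cdot> aP (fst c)"
    by (simp add: B.whisker B.reassoc2[OF d] c)
qed (use cyl_cellD(3,4)[of c] in simp_all)

text \<open>\<open>paste_hcompc\<close> handles the pasting, and naturality of \<open>pf_cmp\<close>
  carries the 2-cells past the correcting comparison cell.\<close>

lemma cyl_hcompc_cell [simp]:
  assumes [simp]: "c \<in> cyl_cells" "d \<in> cyl_cells" and cd: "aT (fst c) = aS (fst d)"
  shows "(cyl_hcomp (fst d) (fst c), cyl_hcomp (fst (snd d)) (fst (snd c)), cA d \<star>\<^bsub>A\<^esub> cA c, cB d \<star> cB c) \<in> cyl_cells"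
proof (rule cyl_cellI)
  note [simp] = cd
  have p: "cyl_paste (fst (snd d)) (fst (snd c)) \<cdot> ((cB d \<star> cB c) \<star> \<iota> (oE (aS (fst c)))) =
    (\<iota> (oE (aT (fst d))) \<star> (pf_cell F (cA d) \<star> pf_cell F (cA c))) \<cdot> cyl_paste (fst d) (fst c)"
  proof -
    have "B.sq (oE (aS (fst c))) (oE (aS (fst d))) (pf_arr F (aF (fst c))) (aG (fst c)) (aP (fst c))"
      "B.sq (oE (aS (fst d))) (oE (aT (fst d))) (pf_arr F (aF (fst d))) (aG (fst d)) (aP (fst d))"
      "B.sq (oE (aS (fst c))) (oE (aS (fst d))) (pf_arr F (aF (fst (snd c)))) (aG (fst (snd c))) (aP (fst (snd c)))"
      "B.sq (oE (aS (fst d))) (oE (aT (fst d))) (pf_arr F (aF (fst (snd d)))) (aG (fst (snd d))) (aP (fst (snd d)))"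
      using cyl_sq[of "fst c"] cyl_sq[of "fst d"] cyl_sq[of "fst (snd c)"] cyl_sq[of "fst (snd d)"] by simp_all
    from B.paste_hcompc[OF this] show ?thesis
      using cyl_compat[of c] cyl_compat[of d] by (simp add: cyl_paste_def in_cells)
  qed
  have n: "pf_cmp F (aF (fst (snd d))) (aF (fst (snd c))) \<cdot> (pf_cell F (cA d) \<star> pf_cell F (cA c)) =
    pf_cell F (cA d \<star>\<^bsub>A\<^esub> cA c) \<cdot> pf_cmp F (aF (fst d)) (aF (fst c))"
    by (simp add: F_cmp_nat)
  have "(\<iota> (oE (aT (fst d))) \<star> pf_cmp F (aF (fst (snd d))) (aF (fst (snd c)))) \<cdot>
     (\<iota> (oE (aT (fst d))) \<star> (pf_cell F (cA d) \<star> pf_cell F (cA c))) =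
     (\<iota> (oE (aT (fst d))) \<star> pf_cell F (cA d \<star>\<^bsub>A\<^esub> cA c)) \<cdot> (\<iota> (oE (aT (fst d))) \<star> pf_cmp F (aF (fst d)) (aF (fst c)))"
    by (simp add: B.whisker_left[symmetric] n)
  note n' = B.reassoc2[OF this]
  show "aP (cyl_hcomp (fst (snd d)) (fst (snd c))) \<cdot> ((cB d \<star> cB c) \<star> \<iota> (oE (aS (cyl_hcomp (fst d) (fst c))))) =
    (\<iota> (oE (aT (cyl_hcomp (fst d) (fst c)))) \<star> pf_cell F (cA d \<star>\<^bsub>A\<^esub> cA c)) \<cdot> aP (cyl_hcomp (fst d) (fst c))"
    by (simp add: p n')
qed (use cd in simp_all)

text \<open>Compatibility of the inverse pair is checked after composing with the invertible
  \<open>\<iota> ?e' \<star> pf_cell F (cA c)\<close>, where the compatibility of \<open>c\<close>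
  applies.\<close>

lemma cyl_iso:
  assumes c: "c \<in> cyl_cells" and [simp]: "A.isoc (cA c)" "B.isoc (cB c)"
  shows "iso2 cyl c"
proof -
  note [simp] = c
  let ?m = "fst c" and ?n = "fst (snd c)"
  let ?e = "oE (aS ?m)" and ?e' = "oE (aT ?m)"
  have "aP ?m \<cdot> (B.invc (cB c) \<star> \<iota> ?e) = (\<iota> ?e' \<star> pf_cell F (A.invc (cA c))) \<cdot> aP ?n"
  proof (rule B.iso_cancel_left[of "\<iota> ?e' \<star> pf_cell F (cA c)"])
    have 1: "(cB c \<star> \<iota> ?e) \<cdot> (B.invc (cB c) \<star> \<iota> ?e) = \<iota> (aG ?n \<odot> ?e)"
      by (simp add: B.whisker_right[symmetric])
    have 2: "(\<iota> ?e' \<star> pf_cell F (cA c)) \<cdot> (\<iota> ?e' \<star> pf_cell F (A.invc (cA c))) = \<iota> (?e' \<odot> pf_arr F (aF ?n))"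
      by (simp add: B.whisker_left[symmetric] F_vcomp[symmetric] del: F_vcomp)
    show "(\<iota> ?e' \<star> pf_cell F (cA c)) \<cdot> aP ?m \<cdot> (B.invc (cB c) \<star> \<iota> ?e) =
       (\<iota> ?e' \<star> pf_cell F (cA c)) \<cdot> (\<iota> ?e' \<star> pf_cell F (A.invc (cA c))) \<cdot> aP ?n"
      using B.reassoc2[OF cyl_compat[OF c, symmetric], of "B.invc (cB c) \<star> \<iota> ?e"]
      by (simp add: B.reassoc2[OF 2] 1)
  qed simp_all
  then have "(?n, ?m, A.invc (cA c), B.invc (cB c)) \<in> cyl_cells"
    by (intro cyl_cellI) simp_all
  moreover have "(?m, ?n, cA c, cB c) = c" by simp
  ultimately show ?thesis
    unfolding iso2_def using c
    by (intro conjI bexI[of _ "(?n, ?m, A.invc (cA c), B.invc (cB c))"]) (simp_all add: in_cells)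
qed

text \<open>Each of the two composite squares is a triple pasting followed by comparison cells of
  \<open>F\<close>. In \<open>p\<close>, \<open>paste_assoc\<close> relates the pastings; in
  \<open>f\<close>, the associativity coherence of \<open>F\<close>, whiskered with the last
  equivalence, relates the comparison cells.\<close>

lemma cyl_assoc_cell [simp]:
  assumes [simp]: "m \<in> cyl_arrs" "n \<in> cyl_arrs" "k \<in> cyl_arrs" and c: "aT m = aS n" "aT n = aS k"
  shows "(cyl_hcomp (cyl_hcomp k n) m, cyl_hcomp k (cyl_hcomp n m), \<a>\<^bsub>A\<^esub> (aF k) (aF n) (aF m), \<a> (aG k) (aG n) (aG m)) \<in> cyl_cells"
proof (rule cyl_cellI)
  note [simp] = c
  let ?e0 = "oE (aS m)" and ?e1 = "oE (aS n)" and ?e2 = "oE (aS k)" and ?e3 = "oE (aT k)"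
  let ?u1 = "pf_arr F (aF m)" and ?u2 = "pf_arr F (aF n)" and ?u3 = "pf_arr F (aF k)"
  let ?P1 = "B.paste ?e3 ?e2 ?e0 ?u3 (?u2 \<odot> ?u1) (aG k) (aG n \<odot> aG m) (aP k) (cyl_paste n m)"
  let ?P2 = "B.paste ?e3 ?e1 ?e0 (?u3 \<odot> ?u2) ?u1 (aG k \<odot> aG n) (aG m) (cyl_paste k n) (aP m)"
  have s: "B.sq ?e0 ?e1 ?u1 (aG m) (aP m)" "B.sq ?e1 ?e2 ?u2 (aG n) (aP n)" "B.sq ?e2 ?e3 ?u3 (aG k) (aP k)"
    using cyl_sq[of m] cyl_sq[of n] cyl_sq[of k] by simp_all
  have s1: "B.sq ?e0 ?e2 (?u2 \<odot> ?u1) (aG n \<odot> aG m) (cyl_paste n m)"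
    and s2: "B.sq ?e1 ?e3 (?u3 \<odot> ?u2) (aG k \<odot> aG n) (cyl_paste k n)"
    using cyl_paste_sq[of m n] cyl_paste_sq[of n k] by simp_all
  have P1 [simp]: "?P1 \<in> B.Cell" "B.dm ?P1 = (aG k \<odot> aG n \<odot> aG m) \<odot> ?e0" "B.cd ?P1 = ?e3 \<odot> ?u3 \<odot> ?u2 \<odot> ?u1"
    using B.sq_paste(1)[OF s1 s(3)] by (simp_all add: B.sq_def)
  have P2 [simp]: "?P2 \<in> B.Cell" "B.dm ?P2 = ((aG k \<odot> aG n) \<odot> aG m) \<odot> ?e0" "B.cd ?P2 = ?e3 \<odot> (?u3 \<odot> ?u2) \<odot> ?u1"
    using B.sq_paste(1)[OF s(1) s2] by (simp_all add: B.sq_def)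
  have p1: "cyl_paste k (cyl_hcomp n m) = (\<iota> ?e3 \<star> (\<iota> ?u3 \<star> pf_cmp F (aF n) (aF m))) \<cdot> ?P1"
    using B.paste_vcomp_right[OF s1 s(3), of "pf_cmp F (aF n) (aF m)" "pf_arr F (aF n \<odot>\<^bsub>A\<^esub> aF m)"]
    by (simp add: cyl_paste_def[of k "cyl_hcomp n m"] in_cells)
  have p2: "cyl_paste (cyl_hcomp k n) m = (\<iota> ?e3 \<star> (pf_cmp F (aF k) (aF n) \<star> \<iota> ?u1)) \<cdot> ?P2"
    using B.paste_vcomp_left[OF s(1) s2, of "pf_cmp F (aF k) (aF n)" "pf_arr F (aF k \<odot>\<^bsub>A\<^esub> aF n)"]
    by (simp add: cyl_paste_def[of "cyl_hcomp k n" m] in_cells)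
  have p: "?P1 \<cdot> (\<a> (aG k) (aG n) (aG m) \<star> \<iota> ?e0) = (\<iota> ?e3 \<star> \<a> ?u3 ?u2 ?u1) \<cdot> ?P2"
    using B.paste_assoc[OF s] by (simp add: cyl_paste_def)
  have f: "(\<iota> ?e3 \<star> pf_cell F (\<a>\<^bsub>A\<^esub> (aF k) (aF n) (aF m))) \<cdot> (\<iota> ?e3 \<star> pf_cmp F (aF k \<odot>\<^bsub>A\<^esub> aF n) (aF m)) \<cdot>
      (\<iota> ?e3 \<star> (pf_cmp F (aF k) (aF n) \<star> \<iota> ?u1)) =
    (\<iota> ?e3 \<star> pf_cmp F (aF k) (aF n \<odot>\<^bsub>A\<^esub> aF m)) \<cdot> (\<iota> ?e3 \<star> (\<iota> ?u3 \<star> pf_cmp F (aF n) (aF m))) \<cdot> (\<iota> ?e3 \<star> \<a> ?u3 ?u2 ?u1)"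
    by (simp add: B.whisker_left[symmetric] F_assoc)
  show "aP (cyl_hcomp k (cyl_hcomp n m)) \<cdot> (\<a> (aG k) (aG n) (aG m) \<star> \<iota> (oE (aS (cyl_hcomp (cyl_hcomp k n) m)))) =
    (\<iota> (oE (aT (cyl_hcomp (cyl_hcomp k n) m))) \<star> pf_cell F (\<a>\<^bsub>A\<^esub> (aF k) (aF n) (aF m))) \<cdot> aP (cyl_hcomp (cyl_hcomp k n) m)"
    by (simp add: p1 p2 p B.reassoc3[OF f])
qed (use c in simp_all)

text \<open>As for associators, with \<open>paste_lunit\<close> and the left unit coherence of
  \<open>F\<close>.\<close>

lemma cyl_lunit_cell [simp]:
  assumes [simp]: "m \<in> cyl_arrs"
  shows "(cyl_hcomp (cyl_ide (aT m)) m, m, \<l>\<^bsub>A\<^esub> (aF m), \<l> (aG m)) \<in> cyl_cells"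
proof (rule cyl_cellI)
  let ?e = "oE (aS m)" and ?e' = "oE (aT m)" and ?u = "pf_arr F (aF m)"
  let ?P = "B.paste ?e' ?e' ?e (\<one> (pf_obj F (fst (aT m)))) ?u (\<one> (fst (snd (aT m)))) (aG m) (B.unit_sq ?e') (aP m)"
  have s': "B.sq ?e' ?e' (\<one> (pf_obj F (fst (aT m)))) (\<one> (fst (snd (aT m)))) (B.unit_sq ?e')"
    using B.sq_unit_sq(1)[of ?e'] by simp
  have [simp]: "?P \<in> B.Cell" "B.dm ?P = (\<one> (fst (snd (aT m))) \<odot> aG m) \<odot> ?e" "B.cd ?P = ?e' \<odot> \<one> (pf_obj F (fst (aT m))) \<odot> ?u"
    using B.sq_paste(1)[OF cyl_sq[of m] s'] by (simp_all add: B.sq_def)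
  have p: "cyl_paste (cyl_ide (aT m)) m = (\<iota> ?e' \<star> (pf_unit F (fst (aT m)) \<star> \<iota> ?u)) \<cdot> ?P"
    using B.paste_vcomp_left[OF cyl_sq[of m] s', of "pf_unit F (fst (aT m))" "pf_arr F (\<one>\<^bsub>A\<^esub> (fst (aT m)))"]
    by (simp add: cyl_paste_def in_cells)
  have f: "(\<iota> ?e' \<star> pf_cell F (\<l>\<^bsub>A\<^esub> (aF m))) \<cdot> (\<iota> ?e' \<star> pf_cmp F (\<one>\<^bsub>A\<^esub> (fst (aT m))) (aF m)) \<cdot>
      (\<iota> ?e' \<star> (pf_unit F (fst (aT m)) \<star> \<iota> ?u)) = \<iota> ?e' \<star> \<l> ?u"
    by (simp add: B.whisker_left[symmetric] F_lunit)
  have u: "aP m \<cdot> (\<l> (aG m) \<star> \<iota> ?e) = (\<iota> ?e' \<star> \<l> ?u) \<cdot> ?P"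
    using B.paste_lunit[OF cyl_sq[of m]] by simp
  show "aP m \<cdot> (\<l> (aG m) \<star> \<iota> (oE (aS (cyl_hcomp (cyl_ide (aT m)) m)))) =
    (\<iota> (oE (aT (cyl_hcomp (cyl_ide (aT m)) m))) \<star> pf_cell F (\<l>\<^bsub>A\<^esub> (aF m))) \<cdot> aP (cyl_hcomp (cyl_ide (aT m)) m)"
    by (simp add: p u B.reassoc3[OF f])
qed simp_all

lemma cyl_runit_cell [simp]:
  assumes [simp]: "m \<in> cyl_arrs"
  shows "(cyl_hcomp m (cyl_ide (aS m)), m, \<r>\<^bsub>A\<^esub> (aF m), \<r> (aG m)) \<in> cyl_cells"
proof (rule cyl_cellI)
  let ?e = "oE (aS m)" and ?e' = "oE (aT m)" and ?u = "pf_arr F (aF m)"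
  let ?P = "B.paste ?e' ?e ?e ?u (\<one> (pf_obj F (fst (aS m)))) (aG m) (\<one> (fst (snd (aS m)))) (aP m) (B.unit_sq ?e)"
  have s': "B.sq ?e ?e (\<one> (pf_obj F (fst (aS m)))) (\<one> (fst (snd (aS m)))) (B.unit_sq ?e)"
    using B.sq_unit_sq(1)[of ?e] by simp
  have [simp]: "?P \<in> B.Cell" "B.dm ?P = (aG m \<odot> \<one> (fst (snd (aS m)))) \<odot> ?e" "B.cd ?P = ?e' \<odot> ?u \<odot> \<one> (pf_obj F (fst (aS m)))"
    using B.sq_paste(1)[OF s' cyl_sq[of m]] by (simp_all add: B.sq_def)
  have p: "cyl_paste m (cyl_ide (aS m)) = (\<iota> ?e' \<star> (\<iota> ?u \<star> pf_unit F (fst (aS m)))) \<cdot> ?P"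
    using B.paste_vcomp_right[OF s' cyl_sq[of m], of "pf_unit F (fst (aS m))" "pf_arr F (\<one>\<^bsub>A\<^esub> (fst (aS m)))"]
    by (simp add: cyl_paste_def in_cells)
  have f: "(\<iota> ?e' \<star> pf_cell F (\<r>\<^bsub>A\<^esub> (aF m))) \<cdot> (\<iota> ?e' \<star> pf_cmp F (aF m) (\<one>\<^bsub>A\<^esub> (fst (aS m)))) \<cdot>
      (\<iota> ?e' \<star> (\<iota> ?u \<star> pf_unit F (fst (aS m)))) = \<iota> ?e' \<star> \<r> ?u"
    by (simp add: B.whisker_left[symmetric] F_runit)
  have u: "aP m \<cdot> (\<r> (aG m) \<star> \<iota> ?e) = (\<iota> ?e' \<star> \<r> ?u) \<cdot> ?P"
    using B.paste_runit[OF cyl_sq[of m]] by simp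
  show "aP m \<cdot> (\<r> (aG m) \<star> \<iota> (oE (aS (cyl_hcomp m (cyl_ide (aS m)))))) =
    (\<iota> (oE (aT (cyl_hcomp m (cyl_ide (aS m))))) \<star> pf_cell F (\<r>\<^bsub>A\<^esub> (aF m))) \<cdot> aP (cyl_hcomp m (cyl_ide (aS m)))"
    by (simp add: p u B.reassoc3[OF f])
qed simp_all

lemma bicategory_cyl: "bicategory cyl"
proof (rule bicategoryI, goal_cases)
  case (16 \<alpha> \<alpha>' \<beta> \<beta>')
  then show ?case by (simp add: A.interchange B.interchange)
next
  case (19 \<alpha> \<beta> \<gamma>)
  then show ?case by (simp add: A.assoc_nat B.assoc_nat)
next
  case (24 \<alpha>)
  then show ?case by (simp add: A.lunit_nat B.lunit_nat)
next
  case (25 \<alpha>)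
  then show ?case by (simp add: A.runit_nat B.runit_nat)
next
  case (26 f g h k)
  then show ?case by (simp add: A.pentagon B.pentagon)
next
  case (27 f g)
  then show ?case using A.triangle[of "aF f" "aF g"] B.triangle[of "aG f" "aG g"] by simp
qed (simp_all add: in_cells in_hom cyl_iso prod_eq_iff)

section \<open>The two projections\<close>

definition cyl_P where
  "cyl_P = \<lparr> pf_obj = fst, pf_arr = (\<lambda>m. aF m), pf_cell = (\<lambda>c. cA c),
     pf_cmp = (\<lambda>n m. \<iota>\<^bsub>A\<^esub> (aF n \<odot>\<^bsub>A\<^esub> aF m)), pf_unit = (\<lambda>X. \<iota>\<^bsub>A\<^esub> (\<one>\<^bsub>A\<^esub> (fst X))) \<rparr>"

definition cyl_Q where
  "cyl_Q = \<lparr> pf_obj = (\<lambda>X. fst (snd X)), pf_arr = (\<lambda>m. aG m), pf_cell = (\<lambda>c. cB c),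
     pf_cmp = (\<lambda>n m. \<iota> (aG n \<odot> aG m)), pf_unit = (\<lambda>X. \<iota> (\<one> (fst (snd X)))) \<rparr>"

lemma strict_cyl_P: "strict_functor cyl A cyl_P"
  unfolding strict_functor_def
proof (intro conjI)
  show "pseudofunctor cyl A cyl_P"
    by (rule pseudofunctorI) (simp_all add: cyl_P_def in_cells in_hom)
qed (simp_all add: cyl_P_def)

lemma strict_cyl_Q: "strict_functor cyl B cyl_Q"
  unfolding strict_functor_def
proof (intro conjI)
  show "pseudofunctor cyl B cyl_Q"
    by (rule pseudofunctorI) (simp_all add: cyl_Q_def in_cells in_hom)
qed (simp_all add: cyl_Q_def)

lemma cyl_cell_eqI:
  assumes "c \<in> cells cyl m n" "c' \<in> cells cyl m n" "cA c = cA c'" "cB c = cB c'"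
  shows "c = c'"
  using assms by (simp add: in_cells prod_eq_iff)

text \<open>The square is solved for its \<open>B\<close>-side along the source equivalence:
  essential surjectivity of whiskering on the right gives \<open>g\<close>, and full faithfulness
  gives the 2-cell and its uniqueness.\<close>

lemma surjective_equivalence_cyl_P: "surjective_equivalence cyl A cyl_P"
  unfolding surjective_equivalence_def
proof (intro conjI ballI impI)
  show "pseudofunctor cyl A cyl_P" using strict_cyl_P by (simp add: strict_functor_def)
next
  fix a assume a: "a \<in> A.Obj"
  then have "(a, pf_obj F a, \<one> (pf_obj F a)) \<in> cyl_objs"
    unfolding cyl_objs_def by (simp add: B.equivalence_ide)
  then show "\<exists>X \<in> b_obj cyl. pf_obj cyl_P X = a"
    by (intro bexI[of _ "(a, pf_obj F a, \<one> (pf_obj F a))"]) (simp_all add: cyl_P_def)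
next
  fix X Y f assume X: "X \<in> b_obj cyl" "Y \<in> b_obj cyl" "f \<in> hom A (pf_obj cyl_P X) (pf_obj cyl_P Y)"
  then have [simp]: "X \<in> cyl_objs" "Y \<in> cyl_objs" "f \<in> A.Arr" "A.src f = fst X" "A.trg f = fst Y"
    by (simp_all add: in_hom cyl_P_def)
  obtain g where g: "g \<in> B.Arr" "B.src g = fst (snd X)" "B.trg g = fst (snd Y)"
    "B.isomorphic (g \<odot> oE X) (oE Y \<odot> pf_arr F f)"
    by (rule B.equivalence_lift_right[of "oE X" "oE Y \<odot> pf_arr F f"]) simp_all
  obtain \<phi> where "B.isoc \<phi>" "\<phi> \<in> B.Cell" "B.dm \<phi> = g \<odot> oE X" "B.cd \<phi> = oE Y \<odot> pf_arr F f"
    using g(4) by (rule B.isomorphicE)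
  then have "(X, Y, f, g, \<phi>) \<in> cyl_arrs"
    unfolding cyl_arrs_def using g by simp
  then show "\<exists>m \<in> hom cyl X Y. pf_arr cyl_P m = f"
    by (intro bexI[of _ "(X, Y, f, g, \<phi>)"]) (simp_all add: cyl_P_def in_hom)
next
  fix X Y m n \<alpha> assume "m \<in> hom cyl X Y" "n \<in> hom cyl X Y"
    and a: "\<alpha> \<in> cells A (pf_arr cyl_P m) (pf_arr cyl_P n)"
  then have [simp]: "m \<in> cyl_arrs" "n \<in> cyl_arrs" "aS n = aS m" "aT n = aT m"
    "\<alpha> \<in> A.Cell" "A.dm \<alpha> = aF m" "A.cd \<alpha> = aF n" by (simp_all add: in_hom in_cells cyl_P_def)
  \<comment> \<open>The compatibility equation solved for
    \<open>\<beta> \<star> \<iota> (oE (aS m))\<close>.\<close>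
  let ?\<gamma> = "B.invc (aP n) \<cdot> (\<iota> (oE (aT m)) \<star> pf_cell F \<alpha>) \<cdot> aP m"
  have "?\<gamma> \<in> cells B (aG m \<odot> oE (aS m)) (aG n \<odot> oE (aS m))"
    by (simp add: in_cells)
  then obtain \<beta> where b: "\<beta> \<in> cells B (aG m) (aG n)" "\<beta> \<star> \<iota> (oE (aS m)) = ?\<gamma>"
    by (rule B.whisker_full_right[rotated]) simp_all
  then have "(m, n, \<alpha>, \<beta>) \<in> cyl_cells"
    by (intro cyl_cellI) (simp_all add: in_cells)
  then show "\<exists>c \<in> cells cyl m n. pf_cell cyl_P c = \<alpha>"
    by (intro bexI[of _ "(m, n, \<alpha>, \<beta>)"]) (simp_all add: cyl_P_def in_cells)
next
  fix X Y m n c c' assume c: "c \<in> cells cyl m n" "c' \<in> cells cyl m n" and eq: "pf_cell cyl_P c = pf_cell cyl_P c'"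
  then have [simp]: "c \<in> cyl_cells" "c' \<in> cyl_cells" "fst c = m" "fst c' = m" "fst (snd c) = n" "fst (snd c') = n"
    by (simp_all add: in_cells)
  have [simp]: "m \<in> cyl_arrs" "n \<in> cyl_arrs" "aS n = aS m" "aT n = aT m"
    using cyl_cellD(1-4)[of c] by simp_all
  have e: "cA c = cA c'" using eq by (simp add: cyl_P_def)
  have "aP n \<cdot> (cB c \<star> \<iota> (oE (aS m))) = aP n \<cdot> (cB c' \<star> \<iota> (oE (aS m)))"
    using cyl_compat[of c] cyl_compat[of c'] e by simp
  then have "cB c \<star> \<iota> (oE (aS m)) = cB c' \<star> \<iota> (oE (aS m))"
    by (rule B.iso_cancel_left[rotated -1]) simp_all
  then have "cB c = cB c'"
    by (rule B.whisker_faithful_right[of _ _ "aG m" "aG n", rotated -1]) (simp_all add: in_cells)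
  with c e show "c = c'" by (rule cyl_cell_eqI)
qed

text \<open>Now the square is solved for its \<open>A\<close>-side. Cancelling the target
  equivalence on the left yields only cells of \<open>B\<close> between images under
  \<open>F\<close>; the local properties of \<open>F\<close> turn these into cells of
  \<open>A\<close>.\<close>

lemma surjective_equivalence_cyl_Q:
  assumes F: "locally_faithful A F" "locally_full A B F" "locally_ess_surj A B F"
    and obj: "\<And>b. b \<in> B.Obj \<Longrightarrow> \<exists>a \<in> A.Obj. \<exists>e. B.equivalence e \<and> B.src e = pf_obj F a \<and> B.trg e = b"
  shows "surjective_equivalence cyl B cyl_Q"
  unfolding surjective_equivalence_def
proof (intro conjI ballI impI)
  show "pseudofunctor cyl B cyl_Q" using strict_cyl_Q by (simp add: strict_functor_def)
next
  fix b assume b: "b \<in> B.Obj"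
  then obtain a e where "a \<in> A.Obj" "B.equivalence e" "B.src e = pf_obj F a" "B.trg e = b"
    using obj by blast
  then have "(a, b, e) \<in> cyl_objs"
    unfolding cyl_objs_def using b by (simp add: B.equivalence_arr)
  then show "\<exists>X \<in> b_obj cyl. pf_obj cyl_Q X = b"
    by (intro bexI[of _ "(a, b, e)"]) (simp_all add: cyl_Q_def)
next
  fix X Y g assume X: "X \<in> b_obj cyl" "Y \<in> b_obj cyl" "g \<in> hom B (pf_obj cyl_Q X) (pf_obj cyl_Q Y)"
  then have [simp]: "X \<in> cyl_objs" "Y \<in> cyl_objs" "g \<in> B.Arr" "B.src g = fst (snd X)" "B.trg g = fst (snd Y)"
    by (simp_all add: in_hom cyl_Q_def)
  \<comment> \<open>\<open>u\<close> need not be an image under \<open>F\<close>. Replacing it by an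
    isomorphic image \<open>pf_arr F f\<close> changes the square only by an isomorphism, which is
    absorbed into \<phi>.\<close>
  obtain u where u: "u \<in> B.Arr" "B.src u = pf_obj F (fst X)" "B.trg u = pf_obj F (fst Y)"
    "B.isomorphic (oE Y \<odot> u) (g \<odot> oE X)"
    by (rule B.equivalence_lift_left[of "oE Y" "g \<odot> oE X"]) simp_all
  have "u \<in> hom B (pf_obj F (fst X)) (pf_obj F (fst Y))"
    using u by (simp add: in_hom)
  then obtain f where f: "f \<in> hom A (fst X) (fst Y)" "B.isomorphic u (pf_arr F f)"
    by (rule locally_ess_surjE[OF F(3)]) simp_all
  have [simp]: "f \<in> A.Arr" "A.src f = fst X" "A.trg f = fst Y" using f by (simp_all add: in_hom)
  obtain \<psi> where p: "B.isoc \<psi>" "\<psi> \<in> B.Cell" "B.dm \<psi> = u" "B.cd \<psi> = pf_arr F f"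
    using f(2) by (rule B.isomorphicE)
  then have "B.isomorphic (oE Y \<odot> u) (oE Y \<odot> pf_arr F f)"
    using u by (intro B.isomorphicI[of "\<iota> (oE Y) \<star> \<psi>"]) simp_all
  then have "B.isomorphic (g \<odot> oE X) (oE Y \<odot> pf_arr F f)"
    using u(4) B.isomorphic_sym B.isomorphic_trans by blast
  then obtain \<phi> where "B.isoc \<phi>" "\<phi> \<in> B.Cell" "B.dm \<phi> = g \<odot> oE X" "B.cd \<phi> = oE Y \<odot> pf_arr F f"
    by (rule B.isomorphicE)
  then have "(X, Y, f, g, \<phi>) \<in> cyl_arrs"
    unfolding cyl_arrs_def by simp
  then show "\<exists>m \<in> hom cyl X Y. pf_arr cyl_Q m = g"
    by (intro bexI[of _ "(X, Y, f, g, \<phi>)"]) (simp_all add: cyl_Q_def in_hom)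
next
  fix X Y m n \<beta> assume "m \<in> hom cyl X Y" "n \<in> hom cyl X Y"
    and a: "\<beta> \<in> cells B (pf_arr cyl_Q m) (pf_arr cyl_Q n)"
  then have [simp]: "m \<in> cyl_arrs" "n \<in> cyl_arrs" "aS n = aS m" "aT n = aT m"
    "\<beta> \<in> B.Cell" "B.dm \<beta> = aG m" "B.cd \<beta> = aG n" by (simp_all add: in_hom in_cells cyl_Q_def)
  let ?\<gamma> = "aP n \<cdot> (\<beta> \<star> \<iota> (oE (aS m))) \<cdot> B.invc (aP m)"
  have "?\<gamma> \<in> cells B (oE (aT m) \<odot> pf_arr F (aF m)) (oE (aT m) \<odot> pf_arr F (aF n))"
    by (simp add: in_cells)
  then obtain \<mu> where b: "\<mu> \<in> cells B (pf_arr F (aF m)) (pf_arr F (aF n))" "\<iota> (oE (aT m)) \<star> \<mu> = ?\<gamma>"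
    by (rule B.whisker_full_left[rotated]) simp_all
  obtain \<alpha> where a: "\<alpha> \<in> cells A (aF m) (aF n)" "pf_cell F \<alpha> = \<mu>"
    by (rule locally_fullE[OF F(2) b(1)]) simp_all
  then have "(m, n, \<alpha>, \<beta>) \<in> cyl_cells"
    using b by (intro cyl_cellI) (simp_all add: in_cells)
  then show "\<exists>c \<in> cells cyl m n. pf_cell cyl_Q c = \<beta>"
    by (intro bexI[of _ "(m, n, \<alpha>, \<beta>)"]) (simp_all add: cyl_Q_def in_cells)
next
  fix X Y m n c c' assume c: "c \<in> cells cyl m n" "c' \<in> cells cyl m n" and eq: "pf_cell cyl_Q c = pf_cell cyl_Q c'"
  then have [simp]: "c \<in> cyl_cells" "c' \<in> cyl_cells" "fst c = m" "fst c' = m" "fst (snd c) = n" "fst (snd c') = n"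
    by (simp_all add: in_cells)
  have [simp]: "m \<in> cyl_arrs" "n \<in> cyl_arrs" "aS n = aS m" "aT n = aT m"
    using cyl_cellD(1-4)[of c] by simp_all
  have [simp]: "A.dm (cA c) = aF m" "A.cd (cA c) = aF n" "A.dm (cA c') = aF m" "A.cd (cA c') = aF n"
    using cyl_cellD(6,7)[of c] cyl_cellD(6,7)[of c'] by simp_all
  have e: "cB c = cB c'" using eq by (simp add: cyl_Q_def)
  have "(\<iota> (oE (aT m)) \<star> pf_cell F (cA c)) \<cdot> aP m = (\<iota> (oE (aT m)) \<star> pf_cell F (cA c')) \<cdot> aP m"
    using cyl_compat[of c] cyl_compat[of c'] e by simp
  then have "\<iota> (oE (aT m)) \<star> pf_cell F (cA c) = \<iota> (oE (aT m)) \<star> pf_cell F (cA c')"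
    by (rule B.iso_cancel_right[rotated -1]) simp_all
  then have "pf_cell F (cA c) = pf_cell F (cA c')"
    by (rule B.whisker_faithful_left[of _ _ "pf_arr F (aF m)" "pf_arr F (aF n)", rotated -1]) (simp_all add: in_cells)
  then have "cA c = cA c'"
    by (rule locally_faithfulD[OF F(1), of _ "aF m" "aF n", rotated -1]) (simp_all add: in_cells)
  from c this e show "c = c'" by (rule cyl_cell_eqI)
qed

end

lemma span_if_biequivalent:
  fixes A :: "('ao, 'am, 'ac) bicat" and B :: "('bo, 'bm, 'bc) bicat"
  assumes "bicategory A" "bicategory B" "biequivalent A B"
  shows "\<exists>(C :: (('ao, 'bo, 'bm) cyl_obj, ('ao, 'bo, 'am, 'bm, 'bc) cyl_arr, ('ao, 'bo, 'am, 'bm, 'ac, 'bc) cyl_cell) bicat) P Q.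
    bicategory C \<and> strict_functor C A P \<and> surjective_equivalence C A P \<and>
    strict_functor C B Q \<and> surjective_equivalence C B Q"
proof -
  obtain F G where F: "pseudofunctor A B F" "pseudofunctor B A G"
    "equiv_in_functor_bicat A A (pf_comp A G F) (pf_id A)" "equiv_in_functor_bicat B B (pf_comp B F G) (pf_id B)"
    using assms(3) unfolding biequivalent_def by blast
  interpret F: psfunctor A B F by unfold_locales fact+
  interpret G: psfunctor B A G by unfold_locales fact+
  note l = biequivalence_locally_equivalence[OF F.psfunctor_axioms G.psfunctor_axioms F(3,4)]
  show ?thesis
    using F.bicategory_cyl F.strict_cyl_P F.surjective_equivalence_cyl_P F.strict_cyl_Q
      F.surjective_equivalence_cyl_Q[OF l] by blast
qed

section \<open>Identity transformations\<close>

context bicat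
begin

lemma pseudonatI:
  assumes "\<And>a. a \<in> b_obj D \<Longrightarrow> tr_obj \<sigma> a \<in> hom B (pf_obj H a) (pf_obj K a)"
    and "\<And>f. f \<in> b_arr D \<Longrightarrow> tr_arr \<sigma> f \<in> cells B (pf_arr K f \<odot> tr_obj \<sigma> (b_src D f)) (tr_obj \<sigma> (b_trg D f) \<odot> pf_arr H f)"
    and "\<And>f. f \<in> b_arr D \<Longrightarrow> isoc (tr_arr \<sigma> f)"
    and "\<And>\<alpha>. \<alpha> \<in> b_cell D \<Longrightarrow>
      tr_arr \<sigma> (b_cod D \<alpha>) \<cdot> (pf_cell K \<alpha> \<star> \<iota> (tr_obj \<sigma> (b_src D (b_dom D \<alpha>)))) =
      (\<iota> (tr_obj \<sigma> (b_trg D (b_dom D \<alpha>))) \<star> pf_cell H \<alpha>) \<cdot> tr_arr \<sigma> (b_dom D \<alpha>)"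
    and "\<And>f g. f \<in> b_arr D \<Longrightarrow> g \<in> b_arr D \<Longrightarrow> b_trg D f = b_src D g \<Longrightarrow>
      tr_arr \<sigma> (g \<odot>\<^bsub>D\<^esub> f) \<cdot> (pf_cmp K g f \<star> \<iota> (tr_obj \<sigma> (b_src D f))) =
      (\<iota> (tr_obj \<sigma> (b_trg D g)) \<star> pf_cmp H g f) \<cdot>
        paste (tr_obj \<sigma> (b_trg D g)) (tr_obj \<sigma> (b_trg D f)) (tr_obj \<sigma> (b_src D f))
          (pf_arr H g) (pf_arr H f) (pf_arr K g) (pf_arr K f) (tr_arr \<sigma> g) (tr_arr \<sigma> f)"
    and "\<And>a. a \<in> b_obj D \<Longrightarrow>
      tr_arr \<sigma> (\<one>\<^bsub>D\<^esub> a) \<cdot> (pf_unit K a \<star> \<iota> (tr_obj \<sigma> a)) = (\<iota> (tr_obj \<sigma> a) \<star> pf_unit H a) \<cdot> unit_sq (tr_obj \<sigma> a)"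
  shows "pseudonat D B H K \<sigma>"
  unfolding pseudonat_def Let_def
  by (intro conjI ballI impI; rule assms[unfolded paste_def unit_sq_def]; assumption)

lemma pseudonatD:
  assumes "pseudonat D B H K \<sigma>"
  shows "a \<in> b_obj D \<Longrightarrow> tr_obj \<sigma> a \<in> hom B (pf_obj H a) (pf_obj K a)"
    and "f \<in> b_arr D \<Longrightarrow> tr_arr \<sigma> f \<in> cells B (pf_arr K f \<odot> tr_obj \<sigma> (b_src D f)) (tr_obj \<sigma> (b_trg D f) \<odot> pf_arr H f)"
    and "f \<in> b_arr D \<Longrightarrow> isoc (tr_arr \<sigma> f)"
    and "\<alpha> \<in> b_cell D \<Longrightarrow>
      tr_arr \<sigma> (b_cod D \<alpha>) \<cdot> (pf_cell K \<alpha> \<star> \<iota> (tr_obj \<sigma> (b_src D (b_dom D \<alpha>)))) =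
      (\<iota> (tr_obj \<sigma> (b_trg D (b_dom D \<alpha>))) \<star> pf_cell H \<alpha>) \<cdot> tr_arr \<sigma> (b_dom D \<alpha>)"
    and "f \<in> b_arr D \<Longrightarrow> g \<in> b_arr D \<Longrightarrow> b_trg D f = b_src D g \<Longrightarrow>
      tr_arr \<sigma> (g \<odot>\<^bsub>D\<^esub> f) \<cdot> (pf_cmp K g f \<star> \<iota> (tr_obj \<sigma> (b_src D f))) =
      (\<iota> (tr_obj \<sigma> (b_trg D g)) \<star> pf_cmp H g f) \<cdot>
        paste (tr_obj \<sigma> (b_trg D g)) (tr_obj \<sigma> (b_trg D f)) (tr_obj \<sigma> (b_src D f))
          (pf_arr H g) (pf_arr H f) (pf_arr K g) (pf_arr K f) (tr_arr \<sigma> g) (tr_arr \<sigma> f)"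
    and "a \<in> b_obj D \<Longrightarrow>
      tr_arr \<sigma> (\<one>\<^bsub>D\<^esub> a) \<cdot> (pf_unit K a \<star> \<iota> (tr_obj \<sigma> a)) = (\<iota> (tr_obj \<sigma> a) \<star> pf_unit H a) \<cdot> unit_sq (tr_obj \<sigma> a)"
  using assms unfolding pseudonat_def Let_def paste_def unit_sq_def by blast+

text \<open>The square of an identity transformation at a 1-cell, as in
  \<open>tr_id\<close>.\<close>

definition idt where
  "idt u = invc (\<l> u) \<cdot> \<r> u"

lemma idt [simp]:
  assumes "u \<in> Arr"
  shows "idt u \<in> Cell" "dm (idt u) = u \<odot> \<one> (src u)" "cd (idt u) = \<one> (trg u) \<odot> u" "isoc (idt u)"
  using assms by (simp_all add: idt_def)

lemma lunit_idt:
  assumes "u \<in> Arr"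
  shows "\<l> u \<cdot> idt u = \<r> u" "r \<in> Cell \<Longrightarrow> cd r = u \<odot> \<one> (src u) \<Longrightarrow> \<l> u \<cdot> idt u \<cdot> r = \<r> u \<cdot> r"
  using assms by (simp_all add: idt_def)

lemma idt_nat:
  assumes [simp]: "\<alpha> \<in> Cell" "cd \<alpha> = v"
  shows "idt v \<cdot> (\<alpha> \<star> \<iota> (\<one> (src (dm \<alpha>)))) = (\<iota> (\<one> (trg (dm \<alpha>))) \<star> \<alpha>) \<cdot> idt (dm \<alpha>)"
proof (rule iso_cancel_left[of "\<l> v"])
  have [simp]: "v \<in> Arr" "src v = src (dm \<alpha>)" "trg v = trg (dm \<alpha>)" using dom_cod[of \<alpha>] by auto
  show "\<l> v \<cdot> idt v \<cdot> (\<alpha> \<star> \<iota> (\<one> (src (dm \<alpha>)))) = \<l> v \<cdot> (\<iota> (\<one> (trg (dm \<alpha>))) \<star> \<alpha>) \<cdot> idt (dm \<alpha>)"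
    by (simp add: lunit_idt nat)
  show "isoc (\<l> v)" "idt v \<cdot> (\<alpha> \<star> \<iota> (\<one> (src (dm \<alpha>)))) \<in> Cell" "(\<iota> (\<one> (trg (dm \<alpha>))) \<star> \<alpha>) \<cdot> idt (dm \<alpha>) \<in> Cell"
    "cd (idt v \<cdot> (\<alpha> \<star> \<iota> (\<one> (src (dm \<alpha>))))) = dm (\<l> v)" "cd ((\<iota> (\<one> (trg (dm \<alpha>))) \<star> \<alpha>) \<cdot> idt (dm \<alpha>)) = dm (\<l> v)"
    by simp_all
qed

text \<open>Composed with \<open>\<l> (v \<odot> u)\<close>, the pasting is swept by a unitor: it
  absorbs \<open>idt v\<close> and becomes a right unitor, the triangle makes that a left unitor of
  \<open>u\<close>, which absorbs \<open>idt u\<close>, and \<open>runit_hcomp\<close> collects the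
  result.\<close>

lemma paste_idt:
  assumes [simp]: "u \<in> Arr" "v \<in> Arr" "trg u = src v"
  shows "paste (\<one> (trg v)) (\<one> (src v)) (\<one> (src u)) v u v u (idt v) (idt u) = idt (v \<odot> u)"
proof (rule iso_cancel_left[of "\<l> (v \<odot> u)"])
  have 1: "\<l> (v \<odot> u) \<cdot> \<a> (\<one> (trg v)) v u = \<l> v \<star> \<iota> u"
    by (simp add: lunit_hcomp)
  have 2: "(\<l> v \<star> \<iota> u) \<cdot> (idt v \<star> \<iota> u) = \<r> v \<star> \<iota> u"
    by (simp add: interchange lunit_idt)
  have 3: "(\<r> v \<star> \<iota> u) \<cdot> invc (\<a> v (\<one> (src v)) u) = \<iota> v \<star> \<l> u"
    using triangle[of u v, symmetric] by simp
  have 4: "(\<iota> v \<star> \<l> u) \<cdot> (\<iota> v \<star> idt u) = \<iota> v \<star> \<r> u"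
    by (simp add: interchange lunit_idt)
  show "\<l> (v \<odot> u) \<cdot> paste (\<one> (trg v)) (\<one> (src v)) (\<one> (src u)) v u v u (idt v) (idt u) = \<l> (v \<odot> u) \<cdot> idt (v \<odot> u)"
    by (simp add: paste_def reassoc2[OF 1] reassoc2[OF 2] reassoc2[OF 3] reassoc2[OF 4] runit_hcomp lunit_idt)
qed (simp_all add: paste_def)

lemma unit_sq_ide: "a \<in> Obj \<Longrightarrow> unit_sq (\<one> a) = idt (\<one> a)"
  by (simp add: unit_sq_def idt_def lunit_ide_eq_runit_ide)

text \<open>Apart from its first factor, the right-hand side is the square of \<open>tr_comp\<close>
  for two identity transformations, so this is the equation making the unitor at
  \<open>\<one>\<close> a modification from their composite to the identity. As in
  \<open>paste_idt\<close>, a left unitor in front sweeps through all factors.\<close>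

lemma idt_comp_modification:
  assumes [simp]: "f \<in> Arr"
  shows "idt f \<cdot> (\<iota> f \<star> \<l> (\<one> (src f))) = (\<l> (\<one> (trg f)) \<star> \<iota> f) \<cdot>
    invc (\<a> (\<one> (trg f)) (\<one> (trg f)) f) \<cdot> (\<iota> (\<one> (trg f)) \<star> idt f) \<cdot> \<a> (\<one> (trg f)) f (\<one> (src f)) \<cdot>
    (idt f \<star> \<iota> (\<one> (src f))) \<cdot> invc (\<a> f (\<one> (src f)) (\<one> (src f)))"
proof (rule iso_cancel_left[of "\<l> f"])
  let ?a = "\<one> (src f)" and ?b = "\<one> (trg f)"
  have 1: "(\<l> ?b \<star> \<iota> f) \<cdot> invc (\<a> ?b ?b f) = \<l> (?b \<odot> f)"
    using lunit_hcomp[of f ?b, symmetric] by simp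
  have 2: "\<l> (?b \<odot> f) \<cdot> (\<iota> ?b \<star> idt f) = idt f \<cdot> \<l> (f \<odot> ?a)"
    using lunit_nat[of "idt f", OF _ refl refl] by simp
  have 3: "\<l> (f \<odot> ?a) \<cdot> \<a> ?b f ?a = \<l> f \<star> \<iota> ?a"
    using lunit_hcomp[of ?a f] by simp
  have 4: "(\<l> f \<star> \<iota> ?a) \<cdot> (idt f \<star> \<iota> ?a) = \<r> f \<star> \<iota> ?a"
    by (simp add: interchange lunit_idt)
  have 5: "(\<r> f \<star> \<iota> ?a) \<cdot> invc (\<a> f ?a ?a) = \<iota> f \<star> \<l> ?a"
    using triangle[of ?a f, symmetric] by simp
  show "\<l> f \<cdot> idt f \<cdot> (\<iota> f \<star> \<l> ?a) = \<l> f \<cdot> (\<l> ?b \<star> \<iota> f) \<cdot>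
    invc (\<a> ?b ?b f) \<cdot> (\<iota> ?b \<star> idt f) \<cdot> \<a> ?b f ?a \<cdot> (idt f \<star> \<iota> ?a) \<cdot> invc (\<a> f ?a ?a)"
    by (simp add: reassoc2[OF 1] reassoc2[OF 2] reassoc2[OF 3] reassoc2[OF 4] 5)
qed simp_all

end

context psfunctor
begin

lemma tr_id_sel [simp]: "tr_obj (tr_id B F) a = \<one> (pf_obj F a)" "tr_arr (tr_id B F) f = B.idt (pf_arr F f)"
  by (simp_all add: tr_id_def B.idt_def)

lemma pseudonat_tr_id: "pseudonat A B F F (tr_id B F)"
proof (rule B.pseudonatI, goal_cases)
  case (4 \<alpha>)
  then show ?case using B.idt_nat[of "pf_cell F \<alpha>", OF _ refl] by simp
next
  case (5 f g)
  note [simp] = this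
  have "B.paste (\<one> (pf_obj F (A.trg g))) (\<one> (pf_obj F (A.trg f))) (\<one> (pf_obj F (A.src f))) (pf_arr F g) (pf_arr F f) (pf_arr F g) (pf_arr F f)
      (B.idt (pf_arr F g)) (B.idt (pf_arr F f)) = B.idt (pf_arr F g \<odot> pf_arr F f)"
    using B.paste_idt[of "pf_arr F f" "pf_arr F g"] by simp
  then show ?case using B.idt_nat[of "pf_cmp F g f", OF _ refl] by simp
next
  case (6 a)
  then show ?case using B.idt_nat[of "pf_unit F a", OF _ refl] by (simp add: B.unit_sq_ide)
qed (simp_all add: in_hom in_cells)

end

section \<open>Strict surjective equivalences\<close>

locale strict_psfunctor = psfunctor A B F
  for A :: "('ao, 'am, 'ac) bicat" and B :: "('bo, 'bm, 'bc) bicat" (structure)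
    and F :: "('ao, 'am, 'ac, 'bo, 'bm, 'bc) psfun" +
  assumes strict: "strict_functor A B F"
begin

lemma strict_hcomp [simp]:
  assumes "f \<in> A.Arr" "g \<in> A.Arr" "A.trg f = A.src g"
  shows "pf_arr F (g \<odot>\<^bsub>A\<^esub> f) = pf_arr F g \<odot> pf_arr F f" "pf_cmp F g f = \<iota> (pf_arr F g \<odot> pf_arr F f)"
  using strict assms unfolding strict_functor_def by blast+

lemma strict_ide [simp]:
  assumes "a \<in> A.Obj"
  shows "pf_arr F (\<one>\<^bsub>A\<^esub> a) = \<one> (pf_obj F a)" "pf_unit F a = \<iota> (\<one> (pf_obj F a))"
  using strict assms unfolding strict_functor_def by blast+

text \<open>The comparison cells being identities, the naturality and coherence axioms collapse to
  strict preservation, here and in the next lemmas.\<close>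

lemma strict_hcompc [simp]:
  assumes "\<alpha> \<in> A.Cell" "\<beta> \<in> A.Cell" "A.trg (A.dm \<alpha>) = A.src (A.dm \<beta>)"
  shows "pf_cell F (\<beta> \<star>\<^bsub>A\<^esub> \<alpha>) = pf_cell F \<beta> \<star> pf_cell F \<alpha>"
  using F_cmp_nat[OF assms(1,2) refl refl assms(3)] assms by simp

lemma strict_assoc [simp]:
  assumes "f \<in> A.Arr" "g \<in> A.Arr" "h \<in> A.Arr" "A.trg f = A.src g" "A.trg g = A.src h"
  shows "pf_cell F (\<a>\<^bsub>A\<^esub> h g f) = \<a> (pf_arr F h) (pf_arr F g) (pf_arr F f)"
  using F_assoc[OF assms] assms by simp

lemma strict_lunit [simp]: "f \<in> A.Arr \<Longrightarrow> pf_cell F (\<l>\<^bsub>A\<^esub> f) = \<l> (pf_arr F f)"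
  using F_lunit[of f, OF _ refl] by simp

lemma strict_runit [simp]: "f \<in> A.Arr \<Longrightarrow> pf_cell F (\<r>\<^bsub>A\<^esub> f) = \<r> (pf_arr F f)"
  using F_runit[of f, OF _ refl] by simp

lemma F_inv [simp]:
  assumes "A.isoc \<alpha>"
  shows "pf_cell F (A.invc \<alpha>) = B.invc (pf_cell F \<alpha>)"
proof (rule B.inv_eqI[symmetric])
  have [simp]: "\<alpha> \<in> A.Cell" using assms by (rule A.iso_cell)
  show "pf_cell F (A.invc \<alpha>) \<cdot> pf_cell F \<alpha> = \<iota> (B.dm (pf_cell F \<alpha>))"
    using F_vcomp[of \<alpha> "A.invc \<alpha>"] assms by simp
  show "pf_cell F \<alpha> \<cdot> pf_cell F (A.invc \<alpha>) = \<iota> (B.cd (pf_cell F \<alpha>))"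
    using F_vcomp[of "A.invc \<alpha>" \<alpha>] assms by simp
qed (use assms A.iso_cell in auto)

lemma strict_paste:
  assumes "A.sq e e' u g \<phi>" "A.sq e' e'' u' g' \<phi>'"
  shows "pf_cell F (A.paste e'' e' e u' u g' g \<phi>' \<phi>) =
    B.paste (pf_arr F e'') (pf_arr F e') (pf_arr F e) (pf_arr F u') (pf_arr F u) (pf_arr F g') (pf_arr F g) (pf_cell F \<phi>') (pf_cell F \<phi>)"
  using assms by (simp add: A.sq_def A.paste_def B.paste_def)

lemma strict_unit_sq: "e \<in> A.Arr \<Longrightarrow> pf_cell F (A.unit_sq e) = B.unit_sq (pf_arr F e)"
  by (simp add: A.unit_sq_def B.unit_sq_def)

lemma strict_idt: "f \<in> A.Arr \<Longrightarrow> pf_cell F (A.idt f) = B.idt (pf_arr F f)"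
  by (simp add: A.idt_def B.idt_def)

end

locale surjective_strict = strict_psfunctor A B F
  for A :: "('ao, 'am, 'ac) bicat" and B :: "('bo, 'bm, 'bc) bicat" (structure)
    and F :: "('ao, 'am, 'ac, 'bo, 'bm, 'bc) psfun" +
  assumes surj: "surjective_equivalence A B F"
begin

section \<open>Lifting along a strict surjective equivalence, and its section\<close>

definition obj_lift where
  "obj_lift b = (SOME a. a \<in> A.Obj \<and> pf_obj F a = b)"

definition arr_lift where
  "arr_lift a a' g = (SOME f. f \<in> hom A a a' \<and> pf_arr F f = g)"

definition cell_lift where
  "cell_lift f f' \<beta> = (SOME \<alpha>. \<alpha> \<in> cells A f f' \<and> pf_cell F \<alpha> = \<beta>)"

lemma obj_lift [simp]:
  assumes "b \<in> B.Obj"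
  shows "obj_lift b \<in> A.Obj" "pf_obj F (obj_lift b) = b"
proof -
  have "\<exists>a. a \<in> A.Obj \<and> pf_obj F a = b" using surj assms unfolding surjective_equivalence_def by blast
  from someI_ex[OF this] show "obj_lift b \<in> A.Obj" "pf_obj F (obj_lift b) = b" by (simp_all add: obj_lift_def)
qed

lemma arr_lift [simp]:
  assumes "a \<in> A.Obj" "a' \<in> A.Obj" "g \<in> B.Arr" "B.src g = pf_obj F a" "B.trg g = pf_obj F a'"
  shows "arr_lift a a' g \<in> A.Arr" "A.src (arr_lift a a' g) = a" "A.trg (arr_lift a a' g) = a'" "pf_arr F (arr_lift a a' g) = g"
proof -
  have "g \<in> hom B (pf_obj F a) (pf_obj F a')" using assms by (simp add: in_hom)
  then have "\<exists>f. f \<in> hom A a a' \<and> pf_arr F f = g"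
    using surj assms(1,2) unfolding surjective_equivalence_def by blast
  from someI_ex[OF this] show "arr_lift a a' g \<in> A.Arr" "A.src (arr_lift a a' g) = a"
    "A.trg (arr_lift a a' g) = a'" "pf_arr F (arr_lift a a' g) = g"
    by (simp_all add: arr_lift_def in_hom)
qed

lemma cell_lift [simp]:
  assumes "f \<in> A.Arr" "f' \<in> A.Arr" "A.src f = A.src f'" "A.trg f = A.trg f'"
    "\<beta> \<in> B.Cell" "B.dm \<beta> = pf_arr F f" "B.cd \<beta> = pf_arr F f'"
  shows "cell_lift f f' \<beta> \<in> A.Cell" "A.dm (cell_lift f f' \<beta>) = f" "A.cd (cell_lift f f' \<beta>) = f'" "pf_cell F (cell_lift f f' \<beta>) = \<beta>"
proof -
  have "f \<in> hom A (A.src f') (A.trg f')" "f' \<in> hom A (A.src f') (A.trg f')" "\<beta> \<in> cells B (pf_arr F f) (pf_arr F f')"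
    "A.src f' \<in> A.Obj" "A.trg f' \<in> A.Obj"
    using assms by (simp_all add: in_hom in_cells)
  then have "\<exists>\<alpha>. \<alpha> \<in> cells A f f' \<and> pf_cell F \<alpha> = \<beta>"
    using surj unfolding surjective_equivalence_def by blast
  from someI_ex[OF this] show "cell_lift f f' \<beta> \<in> A.Cell" "A.dm (cell_lift f f' \<beta>) = f"
    "A.cd (cell_lift f f' \<beta>) = f'" "pf_cell F (cell_lift f f' \<beta>) = \<beta>"
    by (simp_all add: cell_lift_def in_cells)
qed

text \<open>Local faithfulness in the form in which it is used: equations between parallel 2-cells
  are tested in \<open>B\<close>, where the chosen lifts disappear.\<close>

lemma cell_eqI:
  assumes "\<alpha> \<in> A.Cell" "\<alpha>' \<in> A.Cell" "A.dm \<alpha> = A.dm \<alpha>'" "A.cd \<alpha> = A.cd \<alpha>'" "pf_cell F \<alpha> = pf_cell F \<alpha>'"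
  shows "\<alpha> = \<alpha>'"
proof -
  let ?f = "A.dm \<alpha>" and ?f' = "A.cd \<alpha>"
  have "?f \<in> hom A (A.src ?f) (A.trg ?f)" "?f' \<in> hom A (A.src ?f) (A.trg ?f)" "\<alpha> \<in> cells A ?f ?f'" "\<alpha>' \<in> cells A ?f ?f'"
    "A.src ?f \<in> A.Obj" "A.trg ?f \<in> A.Obj"
    using assms(1,2) A.dom_cod[OF assms(1)] assms(3,4) by (simp_all add: in_hom in_cells)
  then show ?thesis
    using surj assms(5) unfolding surjective_equivalence_def by blast
qed

lemma iso_reflect:
  assumes [simp]: "\<alpha> \<in> A.Cell" "B.isoc (pf_cell F \<alpha>)"
  shows "A.isoc \<alpha>"
proof (rule A.isoI)
  let ?\<beta> = "cell_lift (A.cd \<alpha>) (A.dm \<alpha>) (B.invc (pf_cell F \<alpha>))"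
  show "?\<beta> \<cdot>\<^bsub>A\<^esub> \<alpha> = \<iota>\<^bsub>A\<^esub> (A.dm \<alpha>)" by (rule cell_eqI) simp_all
  show "\<alpha> \<cdot>\<^bsub>A\<^esub> ?\<beta> = \<iota>\<^bsub>A\<^esub> (A.cd \<alpha>)" by (rule cell_eqI) simp_all
qed simp_all

lemma iso_cell_lift [simp]:
  assumes "f \<in> A.Arr" "f' \<in> A.Arr" "A.src f = A.src f'" "A.trg f = A.trg f'"
    "\<beta> \<in> B.Cell" "B.dm \<beta> = pf_arr F f" "B.cd \<beta> = pf_arr F f'" "B.isoc \<beta>"
  shows "A.isoc (cell_lift f f' \<beta>)"
  by (rule iso_reflect) (use assms in simp_all)

definition sec_arr where
  "sec_arr g = arr_lift (obj_lift (B.src g)) (obj_lift (B.trg g)) g"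

lemma sec_arr [simp]:
  assumes "g \<in> B.Arr"
  shows "sec_arr g \<in> A.Arr" "A.src (sec_arr g) = obj_lift (B.src g)" "A.trg (sec_arr g) = obj_lift (B.trg g)" "pf_arr F (sec_arr g) = g"
  using assms by (simp_all add: sec_arr_def)

text \<open>\<open>sec_arr g \<odot> sec_arr f\<close> and \<open>sec_arr (g \<odot> f)\<close>
  differ in general, but strictness of \<open>F\<close> puts both over \<open>g \<odot> f\<close>,
  so the identity 2-cell there lifts to an invertible comparison. Lifting identities makes
  \<open>F\<close> after \<open>sect\<close> the identity on carriers, comparison cells
  included.\<close>

definition sect where
  "sect = \<lparr> pf_obj = obj_lift, pf_arr = sec_arr,
     pf_cell = (\<lambda>\<beta>. cell_lift (sec_arr (B.dm \<beta>)) (sec_arr (B.cd \<beta>)) \<beta>),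
     pf_cmp = (\<lambda>g f. cell_lift (sec_arr g \<odot>\<^bsub>A\<^esub> sec_arr f) (sec_arr (g \<odot> f)) (\<iota> (g \<odot> f))),
     pf_unit = (\<lambda>b. cell_lift (\<one>\<^bsub>A\<^esub> (obj_lift b)) (sec_arr (\<one> b)) (\<iota> (\<one> b))) \<rparr>"

lemma pseudofunctor_section: "pseudofunctor B A sect"
proof (rule pseudofunctorI, goal_cases)
  case (4 f)
  then show ?case by (intro cell_eqI) (simp_all add: sect_def)
next
  case (5 \<alpha> \<beta>)
  then have "B.src (B.dm \<beta>) = B.src (B.dm \<alpha>)" "B.trg (B.dm \<beta>) = B.trg (B.dm \<alpha>)"
    using B.dom_cod[of \<alpha>] by simp_all
  with 5 show ?case by (intro cell_eqI) (simp_all add: sect_def)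
next
  case (8 \<alpha> \<beta>)
  then show ?case by (intro cell_eqI) (simp_all add: sect_def)
next
  case (11 f g h)
  then show ?case by (intro cell_eqI) (simp_all add: sect_def)
next
  case (12 f)
  then show ?case by (intro cell_eqI) (simp_all add: sect_def)
next
  case (13 f)
  then show ?case by (intro cell_eqI) (simp_all add: sect_def)
qed (simp_all add: sect_def in_hom in_cells)

lemma sect_sel [simp]:
  "b \<in> B.Obj \<Longrightarrow> pf_obj F (pf_obj sect b) = b"
  "g \<in> B.Arr \<Longrightarrow> pf_arr F (pf_arr sect g) = g"
  "\<beta> \<in> B.Cell \<Longrightarrow> pf_cell F (pf_cell sect \<beta>) = \<beta>"
  "f \<in> B.Arr \<Longrightarrow> g \<in> B.Arr \<Longrightarrow> B.trg f = B.src g \<Longrightarrow> pf_cell F (pf_cmp sect g f) = \<iota> (g \<odot> f)"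
  "b \<in> B.Obj \<Longrightarrow> pf_cell F (pf_unit sect b) = \<iota> (\<one> b)"
  by (simp_all add: sect_def)

sublocale S: psfunctor B A sect
  by unfold_locales (rule pseudofunctor_section)

end

text \<open>Equality with \<open>P \<circ> H\<close> only on the carriers of \<open>D\<close>: outside of them the records may differ.\<close>

definition strict_image where
  "strict_image D P H H' \<longleftrightarrow>
    (\<forall>a \<in> b_obj D. pf_obj H' a = pf_obj P (pf_obj H a)) \<and>
    (\<forall>f \<in> b_arr D. pf_arr H' f = pf_arr P (pf_arr H f)) \<and>
    (\<forall>\<alpha> \<in> b_cell D. pf_cell H' \<alpha> = pf_cell P (pf_cell H \<alpha>)) \<and>
    (\<forall>f \<in> b_arr D. \<forall>g \<in> b_arr D. b_trg D f = b_src D g \<longrightarrow> pf_cmp H' g f = pf_cell P (pf_cmp H g f)) \<and>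
    (\<forall>a \<in> b_obj D. pf_unit H' a = pf_cell P (pf_unit H a))"

text \<open>Whiskering of a transformation with a strict \<open>P\<close>: no comparison cells have
  to be inserted for the images of the squares to have the right type.\<close>

definition tr_image where
  "tr_image P \<sigma> = \<lparr> tr_obj = (\<lambda>a. pf_arr P (tr_obj \<sigma> a)), tr_arr = (\<lambda>f. pf_cell P (tr_arr \<sigma> f)) \<rparr>"

lemma tr_image_sel [simp]: "tr_obj (tr_image P \<sigma>) a = pf_arr P (tr_obj \<sigma> a)" "tr_arr (tr_image P \<sigma>) f = pf_cell P (tr_arr \<sigma> f)"
  by (simp_all add: tr_image_def)

section \<open>Lifting and pushing forward transformations and modifications\<close>

locale psfunctor_pair = H: psfunctor D A H + K: psfunctor D A K
  for D :: "('do, 'dm, 'dc) bicat" and A :: "('ao, 'am, 'ac) bicat" (structure)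
    and H :: "('do, 'dm, 'dc, 'ao, 'am, 'ac) psfun" and K :: "('do, 'dm, 'dc, 'ao, 'am, 'ac) psfun"
begin

text \<open>The typing and invertibility part of \<open>pseudonat\<close> without its equations. It
  is what rewriting needs to know of a transformation, and \<open>tr_comp\<close> preserves
  it.\<close>

definition transf where
  "transf \<sigma> \<longleftrightarrow> (\<forall>a \<in> H.A.Obj. tr_obj \<sigma> a \<in> hom A (pf_obj H a) (pf_obj K a)) \<and>
    (\<forall>f \<in> H.A.Arr. tr_arr \<sigma> f \<in> cells A (pf_arr K f \<odot> tr_obj \<sigma> (H.A.src f)) (tr_obj \<sigma> (H.A.trg f) \<odot> pf_arr H f) \<and>
      H.B.isoc (tr_arr \<sigma> f))"

lemma transf_obj:
  assumes "transf \<sigma>" "a \<in> H.A.Obj"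
  shows "tr_obj \<sigma> a \<in> H.B.Arr" "H.B.src (tr_obj \<sigma> a) = pf_obj H a" "H.B.trg (tr_obj \<sigma> a) = pf_obj K a"
  using assms by (auto simp: transf_def in_hom)

lemma transf_arr:
  assumes "transf \<sigma>" "f \<in> H.A.Arr"
  shows "tr_arr \<sigma> f \<in> H.B.Cell" "H.B.dm (tr_arr \<sigma> f) = pf_arr K f \<odot> tr_obj \<sigma> (H.A.src f)"
    "H.B.cd (tr_arr \<sigma> f) = tr_obj \<sigma> (H.A.trg f) \<odot> pf_arr H f" "H.B.isoc (tr_arr \<sigma> f)"
  using assms by (auto simp: transf_def in_cells)

lemma transf_sq:
  assumes "transf \<sigma>" "f \<in> H.A.Arr" "H.A.src f = a" "H.A.trg f = b"
  shows "H.B.sq (tr_obj \<sigma> a) (tr_obj \<sigma> b) (pf_arr H f) (pf_arr K f) (tr_arr \<sigma> f)"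
  using assms by (auto simp: H.B.sq_def transf_obj transf_arr)

lemma pseudonat_transf: "pseudonat D A H K \<sigma> \<Longrightarrow> transf \<sigma>"
  by (simp add: transf_def H.B.pseudonatD(1-3))

text \<open>Pointwise invertibility suffices, because the modification equation for the pointwise
  inverses is the given one composed with invertible cells on both sides.\<close>

lemma inv_modificationI:
  assumes s: "transf \<sigma>" and t: "transf \<tau>"
    and m: "modification D A H K \<sigma> \<tau> \<Gamma>" and i: "\<And>a. a \<in> H.A.Obj \<Longrightarrow> H.B.isoc (\<Gamma> a)"
  shows "inv_modification D A H K \<sigma> \<tau> \<Gamma>"
proof -
  note [simp] = transf_obj[OF s] transf_arr[OF s] transf_obj[OF t] transf_arr[OF t] i
  have G [simp]: "\<Gamma> a \<in> H.B.Cell" "H.B.dm (\<Gamma> a) = tr_obj \<sigma> a" "H.B.cd (\<Gamma> a) = tr_obj \<tau> a" if "a \<in> H.A.Obj" for a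
    using m that by (auto simp: modification_def in_cells)
  have "tr_arr \<sigma> f \<cdot> (\<iota> (pf_arr K f) \<star> H.B.invc (\<Gamma> (H.A.src f))) =
      (H.B.invc (\<Gamma> (H.A.trg f)) \<star> \<iota> (pf_arr H f)) \<cdot> tr_arr \<tau> f" if f [simp]: "f \<in> H.A.Arr" for f
  proof (rule H.B.iso_cancel_left[of "\<Gamma> (H.A.trg f) \<star> \<iota> (pf_arr H f)"])
    let ?a = "H.A.src f" and ?b = "H.A.trg f"
    have e: "tr_arr \<tau> f \<cdot> (\<iota> (pf_arr K f) \<star> \<Gamma> ?a) = (\<Gamma> ?b \<star> \<iota> (pf_arr H f)) \<cdot> tr_arr \<sigma> f"
      using m f unfolding modification_def by blast
    have 1: "(\<iota> (pf_arr K f) \<star> \<Gamma> ?a) \<cdot> (\<iota> (pf_arr K f) \<star> H.B.invc (\<Gamma> ?a)) = \<iota> (pf_arr K f \<odot> tr_obj \<tau> ?a)"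
      by (simp add: H.B.whisker_left[symmetric])
    have 2: "(\<Gamma> ?b \<star> \<iota> (pf_arr H f)) \<cdot> (H.B.invc (\<Gamma> ?b) \<star> \<iota> (pf_arr H f)) = \<iota> (tr_obj \<tau> ?b \<odot> pf_arr H f)"
      by (simp add: H.B.whisker_right[symmetric])
    show "(\<Gamma> ?b \<star> \<iota> (pf_arr H f)) \<cdot> tr_arr \<sigma> f \<cdot> (\<iota> (pf_arr K f) \<star> H.B.invc (\<Gamma> ?a)) =
      (\<Gamma> ?b \<star> \<iota> (pf_arr H f)) \<cdot> (H.B.invc (\<Gamma> ?b) \<star> \<iota> (pf_arr H f)) \<cdot> tr_arr \<tau> f"
      by (simp add: H.B.reassoc2[OF e[symmetric]] 1 H.B.reassoc2[OF 2])
  qed simp_all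
  then have "modification D A H K \<tau> \<sigma> (\<lambda>a. H.B.invc (\<Gamma> a))"
    unfolding modification_def by (simp add: in_cells)
  with m show ?thesis
    unfolding inv_modification_def by (intro conjI exI[of _ "\<lambda>a. H.B.invc (\<Gamma> a)"]) simp_all
qed

lemma inv_modificationD:
  assumes "inv_modification D A H K \<sigma> \<tau> \<Gamma>" "a \<in> H.A.Obj"
  shows "H.B.isoc (\<Gamma> a)"
proof -
  obtain \<Gamma>' where "\<Gamma> a \<in> cells A (tr_obj \<sigma> a) (tr_obj \<tau> a)" "\<Gamma>' a \<in> cells A (tr_obj \<tau> a) (tr_obj \<sigma> a)"
    "\<Gamma>' a \<cdot> \<Gamma> a = \<iota> (tr_obj \<sigma> a)" "\<Gamma> a \<cdot> \<Gamma>' a = \<iota> (tr_obj \<tau> a)"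
    using assms unfolding inv_modification_def modification_def by blast
  then show ?thesis by (intro H.B.isoI[of "\<Gamma> a" "\<Gamma>' a"]) (simp_all add: in_cells)
qed

sublocale KH: psfunctor_pair D A K H ..
sublocale HH: psfunctor_pair D A H H ..

lemma transf_tr_comp:
  assumes s: "transf \<sigma>" and t: "KH.transf \<tau>"
  shows "HH.transf (tr_comp D A H K H \<tau> \<sigma>)"
proof -
  note [simp] = transf_obj[OF s] transf_arr[OF s] KH.transf_obj[OF t] KH.transf_arr[OF t]
  show ?thesis
    unfolding HH.transf_def by (simp add: tr_comp_def Let_def in_hom in_cells)
qed

lemma transf_tr_id: "HH.transf (tr_id A H)"
  unfolding HH.transf_def by (simp add: in_hom in_cells)

end

locale lift_pair = surjective_strict A B F + D: bicat D + HK: psfunctor_pair D A H K + M: psfunctor D B M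
  for D :: "('do, 'dm, 'dc) bicat" and A :: "('ao, 'am, 'ac) bicat" and B :: "('bo, 'bm, 'bc) bicat" (structure)
    and F :: "('ao, 'am, 'ac, 'bo, 'bm, 'bc) psfun"
    and H :: "('do, 'dm, 'dc, 'ao, 'am, 'ac) psfun" and K :: "('do, 'dm, 'dc, 'ao, 'am, 'ac) psfun"
    and M :: "('do, 'dm, 'dc, 'bo, 'bm, 'bc) psfun" +
  assumes H_over_M: "strict_image D F H M" and K_over_M: "strict_image D F K M"
begin

lemma over_M [simp]:
  "a \<in> D.Obj \<Longrightarrow> pf_obj F (pf_obj H a) = pf_obj M a" "a \<in> D.Obj \<Longrightarrow> pf_obj F (pf_obj K a) = pf_obj M a"
  "f \<in> D.Arr \<Longrightarrow> pf_arr F (pf_arr H f) = pf_arr M f" "f \<in> D.Arr \<Longrightarrow> pf_arr F (pf_arr K f) = pf_arr M f"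
  "\<alpha> \<in> D.Cell \<Longrightarrow> pf_cell F (pf_cell H \<alpha>) = pf_cell M \<alpha>" "\<alpha> \<in> D.Cell \<Longrightarrow> pf_cell F (pf_cell K \<alpha>) = pf_cell M \<alpha>"
  "f \<in> D.Arr \<Longrightarrow> g \<in> D.Arr \<Longrightarrow> D.trg f = D.src g \<Longrightarrow> pf_cell F (pf_cmp H g f) = pf_cmp M g f"
  "f \<in> D.Arr \<Longrightarrow> g \<in> D.Arr \<Longrightarrow> D.trg f = D.src g \<Longrightarrow> pf_cell F (pf_cmp K g f) = pf_cmp M g f"
  "a \<in> D.Obj \<Longrightarrow> pf_cell F (pf_unit H a) = pf_unit M a" "a \<in> D.Obj \<Longrightarrow> pf_cell F (pf_unit K a) = pf_unit M a"
  using H_over_M K_over_M by (simp_all add: strict_image_def)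

text \<open>The identity transformation of the common image \<open>M\<close>, lifted cell by cell.
  Since \<open>H\<close> and \<open>K\<close> may differ in \<open>A\<close>, its components are
  merely 1-cells over identities.\<close>

definition conn where
  "conn = \<lparr> tr_obj = (\<lambda>a. arr_lift (pf_obj H a) (pf_obj K a) (\<one> (pf_obj M a))),
     tr_arr = (\<lambda>f. cell_lift
       (pf_arr K f \<odot>\<^bsub>A\<^esub> arr_lift (pf_obj H (D.src f)) (pf_obj K (D.src f)) (\<one> (pf_obj M (D.src f))))
       (arr_lift (pf_obj H (D.trg f)) (pf_obj K (D.trg f)) (\<one> (pf_obj M (D.trg f))) \<odot>\<^bsub>A\<^esub> pf_arr H f)
       (B.idt (pf_arr M f))) \<rparr>"

lemma conn_obj [simp]:
  assumes "a \<in> D.Obj"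
  shows "tr_obj conn a \<in> A.Arr" "A.src (tr_obj conn a) = pf_obj H a" "A.trg (tr_obj conn a) = pf_obj K a"
    "pf_arr F (tr_obj conn a) = \<one> (pf_obj M a)"
  using assms by (simp_all add: conn_def)

lemma conn_arr [simp]:
  assumes "f \<in> D.Arr"
  shows "tr_arr conn f \<in> A.Cell" "A.dm (tr_arr conn f) = pf_arr K f \<odot>\<^bsub>A\<^esub> tr_obj conn (D.src f)"
    "A.cd (tr_arr conn f) = tr_obj conn (D.trg f) \<odot>\<^bsub>A\<^esub> pf_arr H f" "A.isoc (tr_arr conn f)"
    "pf_cell F (tr_arr conn f) = B.idt (pf_arr M f)"
  using assms by (simp_all add: conn_def)

lemma transf_conn: "HK.transf conn"
  by (simp add: HK.transf_def in_hom in_cells)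

lemma pseudonat_conn: "pseudonat D A H K conn"
proof (rule A.pseudonatI, goal_cases)
  case (4 \<alpha>)
  with B.pseudonatD(4)[OF M.pseudonat_tr_id 4] show ?case
    by (intro cell_eqI) simp_all
next
  case (5 f g)
  note [simp] = this
  have s: "A.sq (tr_obj conn (D.src f)) (tr_obj conn (D.src g)) (pf_arr H f) (pf_arr K f) (tr_arr conn f)"
    "A.sq (tr_obj conn (D.src g)) (tr_obj conn (D.trg g)) (pf_arr H g) (pf_arr K g) (tr_arr conn g)"
    using HK.transf_sq[OF transf_conn] by simp_all
  let ?p = "A.paste (tr_obj conn (D.trg g)) (tr_obj conn (D.src g)) (tr_obj conn (D.src f))
     (pf_arr H g) (pf_arr H f) (pf_arr K g) (pf_arr K f) (tr_arr conn g) (tr_arr conn f)"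
  have [simp]: "?p \<in> A.Cell" "A.dm ?p = (pf_arr K g \<odot>\<^bsub>A\<^esub> pf_arr K f) \<odot>\<^bsub>A\<^esub> tr_obj conn (D.src f)"
    "A.cd ?p = tr_obj conn (D.trg g) \<odot>\<^bsub>A\<^esub> pf_arr H g \<odot>\<^bsub>A\<^esub> pf_arr H f"
    using A.sq_paste(1)[OF s] by (simp_all add: A.sq_def)
  from B.pseudonatD(5)[OF M.pseudonat_tr_id 5] show ?case
    by (intro cell_eqI) (simp_all add: strict_paste[OF s])
next
  case (6 a)
  note [simp] = this
  have [simp]: "A.unit_sq (tr_obj conn a) \<in> A.Cell" "A.dm (A.unit_sq (tr_obj conn a)) = \<one>\<^bsub>A\<^esub> (pf_obj K a) \<odot>\<^bsub>A\<^esub> tr_obj conn a"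
    "A.cd (A.unit_sq (tr_obj conn a)) = tr_obj conn a \<odot>\<^bsub>A\<^esub> \<one>\<^bsub>A\<^esub> (pf_obj H a)"
    using A.sq_unit_sq(1)[of "tr_obj conn a"] by (simp_all add: A.sq_def)
  from B.pseudonatD(6)[OF M.pseudonat_tr_id 6] show ?case
    by (intro cell_eqI) (simp_all add: strict_unit_sq)
qed (simp_all add: in_hom in_cells)

text \<open>The hypotheses are symmetric in \<open>H\<close> and \<open>K\<close>, so
  \<open>rev.conn\<close> is a transformation in the opposite direction.\<close>

sublocale rev: lift_pair D A B F K H M
  by unfold_locales (rule K_over_M H_over_M)+

lemma inv_modification_conn:
  "\<exists>\<Gamma>. inv_modification D A H H (tr_comp D A H K H rev.conn conn) (tr_id A H) \<Gamma>"
proof (intro exI HK.HH.inv_modificationI)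
  \<comment> \<open>Over \<open>M\<close> the composite has components
    \<open>\<one> \<odot> \<one>\<close>, which the unitor contracts; the modification equation then
    lies over \<open>idt_comp_modification\<close>.\<close>
  let ?\<Gamma> = "\<lambda>a. cell_lift (tr_obj rev.conn a \<odot>\<^bsub>A\<^esub> tr_obj conn a) (\<one>\<^bsub>A\<^esub> (pf_obj H a)) (\<l> (\<one> (pf_obj M a)))"
  have [simp]: "?\<Gamma> a \<in> A.Cell" "A.dm (?\<Gamma> a) = tr_obj rev.conn a \<odot>\<^bsub>A\<^esub> tr_obj conn a" "A.cd (?\<Gamma> a) = \<one>\<^bsub>A\<^esub> (pf_obj H a)"
    "A.isoc (?\<Gamma> a)" "pf_cell F (?\<Gamma> a) = \<l> (\<one> (pf_obj M a))" if "a \<in> D.Obj" for a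
    using that by simp_all
  show "HK.HH.transf (tr_comp D A H K H rev.conn conn)"
    by (rule HK.transf_tr_comp[OF transf_conn rev.transf_conn])
  show "HK.HH.transf (tr_id A H)" by (rule HK.transf_tr_id)
  show "modification D A H H (tr_comp D A H K H rev.conn conn) (tr_id A H) ?\<Gamma>"
    unfolding modification_def
  proof (intro conjI ballI)
    fix f assume f [simp]: "f \<in> D.Arr"
    from B.idt_comp_modification[of "pf_arr M f"]
    show "tr_arr (tr_id A H) f \<cdot>\<^bsub>A\<^esub> (\<iota>\<^bsub>A\<^esub> (pf_arr H f) \<star>\<^bsub>A\<^esub> ?\<Gamma> (D.src f)) =
      (?\<Gamma> (D.trg f) \<star>\<^bsub>A\<^esub> \<iota>\<^bsub>A\<^esub> (pf_arr H f)) \<cdot>\<^bsub>A\<^esub> tr_arr (tr_comp D A H K H rev.conn conn) f"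
      by (intro cell_eqI) (simp_all add: tr_comp_def Let_def strict_idt)
  qed (simp add: tr_comp_def in_cells)
  show "A.isoc (?\<Gamma> a)" if "a \<in> D.Obj" for a
    using that by simp
qed

end

lemma (in lift_pair) equiv_of_common_image: "equiv_in_functor_bicat D A H K"
  unfolding equiv_in_functor_bicat_def
  using pseudonat_conn rev.pseudonat_conn inv_modification_conn rev.inv_modification_conn by blast

locale strict_push = P: strict_psfunctor A B P + D: bicat D +
  HK: psfunctor_pair D A H K + HK': psfunctor_pair D B H' K'
  for D :: "('do, 'dm, 'dc) bicat" and A :: "('ao, 'am, 'ac) bicat" and B :: "('bo, 'bm, 'bc) bicat" (structure)
    and P :: "('ao, 'am, 'ac, 'bo, 'bm, 'bc) psfun"
    and H :: "('do, 'dm, 'dc, 'ao, 'am, 'ac) psfun" and K :: "('do, 'dm, 'dc, 'ao, 'am, 'ac) psfun"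
    and H' :: "('do, 'dm, 'dc, 'bo, 'bm, 'bc) psfun" and K' :: "('do, 'dm, 'dc, 'bo, 'bm, 'bc) psfun" +
  assumes H_image: "strict_image D P H H'" and K_image: "strict_image D P K K'"
begin

lemma image [simp]:
  "a \<in> D.Obj \<Longrightarrow> pf_obj H' a = pf_obj P (pf_obj H a)" "a \<in> D.Obj \<Longrightarrow> pf_obj K' a = pf_obj P (pf_obj K a)"
  "f \<in> D.Arr \<Longrightarrow> pf_arr H' f = pf_arr P (pf_arr H f)" "f \<in> D.Arr \<Longrightarrow> pf_arr K' f = pf_arr P (pf_arr K f)"
  "\<alpha> \<in> D.Cell \<Longrightarrow> pf_cell H' \<alpha> = pf_cell P (pf_cell H \<alpha>)" "\<alpha> \<in> D.Cell \<Longrightarrow> pf_cell K' \<alpha> = pf_cell P (pf_cell K \<alpha>)"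
  "f \<in> D.Arr \<Longrightarrow> g \<in> D.Arr \<Longrightarrow> D.trg f = D.src g \<Longrightarrow> pf_cmp H' g f = pf_cell P (pf_cmp H g f)"
  "f \<in> D.Arr \<Longrightarrow> g \<in> D.Arr \<Longrightarrow> D.trg f = D.src g \<Longrightarrow> pf_cmp K' g f = pf_cell P (pf_cmp K g f)"
  "a \<in> D.Obj \<Longrightarrow> pf_unit H' a = pf_cell P (pf_unit H a)" "a \<in> D.Obj \<Longrightarrow> pf_unit K' a = pf_cell P (pf_unit K a)"
  using H_image K_image by (simp_all add: strict_image_def)

text \<open>Applying \<open>P\<close> to each axiom of \<sigma> gives the axiom of its image,
  because a strict functor commutes with every operation that occurs there, \<open>paste\<close> and
  \<open>unit_sq\<close> included.\<close>

lemma pseudonat_image: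
  assumes n: "pseudonat D A H K \<sigma>"
  shows "pseudonat D B H' K' (tr_image P \<sigma>)"
proof -
  have t: "HK.transf \<sigma>" using n by (rule HK.pseudonat_transf)
  note [simp] = HK.transf_obj[OF t] HK.transf_arr[OF t]
  show ?thesis
  proof (rule P.B.pseudonatI, goal_cases)
    case (4 \<alpha>)
    with arg_cong[OF P.A.pseudonatD(4)[OF n 4], of "pf_cell P"] show ?case by simp
  next
    case (5 f g)
    note [simp] = this
    have s: "P.A.sq (tr_obj \<sigma> (D.src f)) (tr_obj \<sigma> (D.src g)) (pf_arr H f) (pf_arr K f) (tr_arr \<sigma> f)"
      "P.A.sq (tr_obj \<sigma> (D.src g)) (tr_obj \<sigma> (D.trg g)) (pf_arr H g) (pf_arr K g) (tr_arr \<sigma> g)"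
      using HK.transf_sq[OF t] by simp_all
    let ?p = "P.A.paste (tr_obj \<sigma> (D.trg g)) (tr_obj \<sigma> (D.src g)) (tr_obj \<sigma> (D.src f))
       (pf_arr H g) (pf_arr H f) (pf_arr K g) (pf_arr K f) (tr_arr \<sigma> g) (tr_arr \<sigma> f)"
    have [simp]: "?p \<in> P.A.Cell" "P.A.dm ?p = (pf_arr K g \<odot>\<^bsub>A\<^esub> pf_arr K f) \<odot>\<^bsub>A\<^esub> tr_obj \<sigma> (D.src f)"
      "P.A.cd ?p = tr_obj \<sigma> (D.trg g) \<odot>\<^bsub>A\<^esub> pf_arr H g \<odot>\<^bsub>A\<^esub> pf_arr H f"
      using P.A.sq_paste(1)[OF s] by (simp_all add: P.A.sq_def)
    from arg_cong[OF P.A.pseudonatD(5)[OF n 5], of "pf_cell P"] show ?case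
      by (simp add: P.strict_paste[OF s])
  next
    case (6 a)
    note [simp] = this
    have [simp]: "P.A.unit_sq (tr_obj \<sigma> a) \<in> P.A.Cell" "P.A.dm (P.A.unit_sq (tr_obj \<sigma> a)) = \<one>\<^bsub>A\<^esub> (pf_obj K a) \<odot>\<^bsub>A\<^esub> tr_obj \<sigma> a"
      "P.A.cd (P.A.unit_sq (tr_obj \<sigma> a)) = tr_obj \<sigma> a \<odot>\<^bsub>A\<^esub> \<one>\<^bsub>A\<^esub> (pf_obj H a)"
      using P.A.sq_unit_sq(1)[of "tr_obj \<sigma> a"] by (simp_all add: P.A.sq_def)
    from arg_cong[OF P.A.pseudonatD(6)[OF n 6], of "pf_cell P"] show ?case
      by (simp add: P.strict_unit_sq)
  qed (simp_all add: in_hom in_cells)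
qed

lemma inv_modification_image:
  assumes s: "pseudonat D A H K \<sigma>" and t: "pseudonat D A K H \<tau>"
    and s': "pseudonat D B H' K' (tr_image P \<sigma>)" and t': "pseudonat D B K' H' (tr_image P \<tau>)"
    and m: "inv_modification D A H H (tr_comp D A H K H \<tau> \<sigma>) (tr_id A H) \<Gamma>"
  shows "inv_modification D B H' H' (tr_comp D B H' K' H' (tr_image P \<tau>) (tr_image P \<sigma>)) (tr_id B H') (\<lambda>a. pf_cell P (\<Gamma> a))"
proof (rule HK'.HH.inv_modificationI)
  note st = HK.pseudonat_transf[OF s] HK.KH.pseudonat_transf[OF t]
  note [simp] = HK.transf_obj[OF st(1)] HK.transf_arr[OF st(1)] HK.KH.transf_obj[OF st(2)] HK.KH.transf_arr[OF st(2)]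
  show "HK'.HH.transf (tr_comp D B H' K' H' (tr_image P \<tau>) (tr_image P \<sigma>))"
    by (rule HK'.transf_tr_comp[OF HK'.pseudonat_transf[OF s'] HK'.KH.pseudonat_transf[OF t']])
  show "HK'.HH.transf (tr_id B H')" by (rule HK'.transf_tr_id)
  have mod: "modification D A H H (tr_comp D A H K H \<tau> \<sigma>) (tr_id A H) \<Gamma>"
    using m by (simp add: inv_modification_def)
  have G [simp]: "\<Gamma> a \<in> P.A.Cell" "P.A.dm (\<Gamma> a) = tr_obj \<tau> a \<odot>\<^bsub>A\<^esub> tr_obj \<sigma> a" "P.A.cd (\<Gamma> a) = \<one>\<^bsub>A\<^esub> (pf_obj H a)"
    if "a \<in> D.Obj" for a
    using mod that by (simp_all add: modification_def tr_comp_def in_cells)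
  show "P.B.isoc (pf_cell P (\<Gamma> a))" if "a \<in> D.Obj" for a
    using HK.HH.inv_modificationD[OF m that] by simp
  show "modification D B H' H' (tr_comp D B H' K' H' (tr_image P \<tau>) (tr_image P \<sigma>)) (tr_id B H') (\<lambda>a. pf_cell P (\<Gamma> a))"
    unfolding modification_def
  proof (intro conjI ballI)
    fix f assume f [simp]: "f \<in> D.Arr"
    have "tr_arr (tr_id A H) f \<cdot>\<^bsub>A\<^esub> (\<iota>\<^bsub>A\<^esub> (pf_arr H f) \<star>\<^bsub>A\<^esub> \<Gamma> (D.src f)) =
      (\<Gamma> (D.trg f) \<star>\<^bsub>A\<^esub> \<iota>\<^bsub>A\<^esub> (pf_arr H f)) \<cdot>\<^bsub>A\<^esub> tr_arr (tr_comp D A H K H \<tau> \<sigma>) f"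
      using mod f unfolding modification_def by blast
    from arg_cong[OF this, of "pf_cell P"]
    show "tr_arr (tr_id B H') f \<cdot> (\<iota> (pf_arr H' f) \<star> pf_cell P (\<Gamma> (D.src f))) =
      (pf_cell P (\<Gamma> (D.trg f)) \<star> \<iota> (pf_arr H' f)) \<cdot> tr_arr (tr_comp D B H' K' H' (tr_image P \<tau>) (tr_image P \<sigma>)) f"
      by (simp add: tr_comp_def Let_def P.strict_idt)
  qed (simp add: tr_comp_def in_cells)
qed

sublocale rev: strict_push D A B P K H K' H'
  by unfold_locales (rule K_image H_image)+

end

lemma (in strict_push) equiv_image:
  assumes "equiv_in_functor_bicat D A H K"
  shows "equiv_in_functor_bicat D B H' K'"
proof -
  obtain \<sigma> \<tau> \<Gamma> \<Delta> where st: "pseudonat D A H K \<sigma>" "pseudonat D A K H \<tau>"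
    and gd: "inv_modification D A H H (tr_comp D A H K H \<tau> \<sigma>) (tr_id A H) \<Gamma>"
      "inv_modification D A K K (tr_comp D A K H K \<sigma> \<tau>) (tr_id A K) \<Delta>"
    using assms unfolding equiv_in_functor_bicat_def by blast
  note st' = pseudonat_image[OF st(1)] rev.pseudonat_image[OF st(2)]
  show ?thesis
    unfolding equiv_in_functor_bicat_def
    using st' inv_modification_image[OF st st' gd(1)] rev.inv_modification_image[OF st(2,1) st'(2,1) gd(2)]
    by blast
qed

section \<open>From a span to a biequivalence\<close>

lemma pseudofunctor_id:
  assumes "bicategory A"
  shows "pseudofunctor A A (pf_id A)"
proof -
  interpret bicat A by unfold_locales fact
  show ?thesis by (rule pseudofunctorI) (simp_all add: pf_id_def in_hom in_cells)
qed

lemma equiv_round_trip: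
  assumes P: "surjective_strict C A P" and Q: "surjective_strict C B Q"
  shows "equiv_in_functor_bicat A A
    (pf_comp A (pf_comp A P (surjective_strict.sect C B Q)) (pf_comp B Q (surjective_strict.sect C A P))) (pf_id A)"
proof -
  interpret P: surjective_strict C A P by fact
  interpret Q: surjective_strict C B Q by fact
  interpret F: psfunctor_comp A C B P.sect Q ..
  interpret G: psfunctor_comp B C A Q.sect P ..
  let ?F = "pf_comp B Q P.sect" and ?G = "pf_comp A P Q.sect"
  interpret H: psfunctor_comp A B C ?F Q.sect ..
  interpret GF: psfunctor_comp A B A ?F ?G ..
  interpret I: psfunctor A A "pf_id A"
    by unfold_locales (rule pseudofunctor_id[OF P.B.bicategory])
  let ?H = "pf_comp C Q.sect ?F"
  \<comment> \<open>Write S and T for the sections of \<open>P\<close> and \<open>Q\<close>. By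
    \<open>i1\<close> and \<open>i2\<close> both T Q S and S lie over Q S along \<open>Q\<close>,
    which makes them equivalent; by \<open>i3\<close> and \<open>i4\<close>, \<open>P\<close> sends
    them to the round trip P T Q S and to the identity. \<open>i1\<close> and \<open>i4\<close> use
    that a section is strictly right inverse on carriers, \<open>i2\<close> and \<open>i3\<close>
    that the comparison cells of \<open>Q\<close> and \<open>P\<close> are identities.\<close>
  have i1: "strict_image A Q ?H ?F" by (simp add: strict_image_def pf_comp_def)
  have i2: "strict_image A Q P.sect ?F" by (simp add: strict_image_def pf_comp_def)
  have i3: "strict_image A P ?H (pf_comp A ?G ?F)" by (simp add: strict_image_def pf_comp_def)
  have i4: "strict_image A P P.sect (pf_id A)" by (simp add: strict_image_def pf_id_def)
  interpret L: lift_pair A C B Q ?H P.sect ?F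
    by unfold_locales (rule i1 i2)+
  interpret R: strict_push A C A P ?H P.sect "pf_comp A ?G ?F" "pf_id A"
    by unfold_locales (rule i3 i4)+
  show ?thesis by (rule R.equiv_image[OF L.equiv_of_common_image])
qed

lemma biequivalent_if_span:
  assumes "bicategory A" "bicategory B" "bicategory C"
    and P: "strict_functor C A P" "surjective_equivalence C A P"
    and Q: "strict_functor C B Q" "surjective_equivalence C B Q"
  shows "biequivalent A B"
proof -
  interpret P: surjective_strict C A P
    by unfold_locales (use assms in \<open>simp_all add: strict_functor_def\<close>)
  interpret Q: surjective_strict C B Q
    by unfold_locales (use assms in \<open>simp_all add: strict_functor_def\<close>)
  interpret F: psfunctor_comp A C B P.sect Q ..
  interpret G: psfunctor_comp B C A Q.sect P ..
  show ?thesis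
    unfolding biequivalent_def
    using F.pseudofunctor_comp G.pseudofunctor_comp
      equiv_round_trip[OF P.surjective_strict_axioms Q.surjective_strict_axioms]
      equiv_round_trip[OF Q.surjective_strict_axioms P.surjective_strict_axioms] by blast
qed

text \<open>HOL has no quantifier over types, so the equivalence is stated as two implications: the
  span obtained from a biequivalence has the explicit types of the cylinder construction, while the
  span in the converse may have carriers of any types.\<close>

theorem theoremC:
  fixes A :: "('ao, 'am, 'ac) bicat" and B :: "('bo, 'bm, 'bc) bicat"
  assumes "bicategory A" and "bicategory B"
  shows "(biequivalent A B \<longrightarrow>
           (\<exists>(C :: ('ao \<times> 'bo \<times> 'bm,
                     ('ao \<times> 'bo \<times> 'bm) \<times> ('ao \<times> 'bo \<times> 'bm) \<times> 'am \<times> 'bm \<times> 'bc,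
                     (('ao \<times> 'bo \<times> 'bm) \<times> ('ao \<times> 'bo \<times> 'bm) \<times> 'am \<times> 'bm \<times> 'bc) \<times>
                     (('ao \<times> 'bo \<times> 'bm) \<times> ('ao \<times> 'bo \<times> 'bm) \<times> 'am \<times> 'bm \<times> 'bc) \<times> 'ac \<times> 'bc) bicat)
               P Q.
              bicategory C \<and>
              strict_functor C A P \<and> surjective_equivalence C A P \<and>
              strict_functor C B Q \<and> surjective_equivalence C B Q)) \<and>
         (\<forall>(C :: ('co, 'cm, 'cc) bicat) P Q.
              bicategory C \<and>
              strict_functor C A P \<and> surjective_equivalence C A P \<and>
              strict_functor C B Q \<and> surjective_equivalence C B Q
              \<longrightarrow> biequivalent A B)"
proof (intro conjI impI allI)
  assume "biequivalent A B"
  then show "\<exists>(C :: (('ao, 'bo, 'bm) cyl_obj, ('ao, 'bo, 'am, 'bm, 'bc) cyl_arr, ('ao, 'bo, 'am, 'bm, 'ac, 'bc) cyl_cell) bicat) P Q.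
    bicategory C \<and> strict_functor C A P \<and> surjective_equivalence C A P \<and>
    strict_functor C B Q \<and> surjective_equivalence C B Q"
    by (rule span_if_biequivalent[OF assms])
next
  fix C :: "('co, 'cm, 'cc) bicat" and P Q
  assume "bicategory C \<and> strict_functor C A P \<and> surjective_equivalence C A P \<and>
    strict_functor C B Q \<and> surjective_equivalence C B Q"
  then show "biequivalent A B"
    using biequivalent_if_span[OF assms] by blast
qed

end
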